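(* Let $X$ be a compact connected abelian group with $\dim X=d<\infty$, and let $F$ be a finite set of epimorphisms of $X$ with $|F|>\dim X$. Then $F$ is mixing if and only if every subset $E\subset F$ with $|E|=d+1$ is mixing.
   Context: $m$ is the normalized Haar measure on $X$ and $\mathcal{B}$ is the completion of the Borel $\sigma$-algebra. An epimorphism of $X$ is a continuous surjective homomorphism $X\to X$. A finite set $F$, $|F|>1$, of epimorphisms of $X$ is called mixing if for every collection of sets $B_\gamma\in\mathcal{B}$, $\gamma\in F$, one has $m\left(\bigcap_{\gamma\in F}\gamma^{-n}(B_\gamma)\right)\to\prod_{\gamma\in F}m(B_\gamma)$ as $n\to\infty$, where $\gamma^{-n}(B)$ is the preimage of $B$ under $\gamma^n$. The dimension of $X$ equals the rank of its character group. *)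

theory Defs
  imports "HOL-Analysis.Analysis" "HOL-Probability.Probability_Measure" "HOL-Library.Extended_Nat"
begin

definition normalized_haar :: "'a::topological_ab_group_add measure \<Rightarrow> bool" where
  "normalized_haar m \<longleftrightarrow>
     sets m = sets borel \<and> prob_space m \<and>
     (\<forall>a. \<forall>A\<in>sets m. emeasure m ((\<lambda>x. a + x) ` A) = emeasure m A) \<and>
     (\<forall>A\<in>sets m. emeasure m A = (INF U\<in>{U. open U \<and> A \<subseteq> U}. emeasure m U)) \<and>
     (\<forall>A\<in>sets m. emeasure m A = (SUP K\<in>{K. compact K \<and> K \<subseteq> A}. emeasure m K))"

definition epimorphism :: "('a::topological_ab_group_add \<Rightarrow> 'a) \<Rightarrow> bool" where
  "epimorphism \<gamma> \<longleftrightarrow>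
     continuous_on UNIV \<gamma> \<and> surj \<gamma> \<and> (\<forall>x y. \<gamma> (x + y) = \<gamma> x + \<gamma> y)"

definition mixing :: "'a::topological_ab_group_add measure \<Rightarrow> ('a \<Rightarrow> 'a) set \<Rightarrow> bool" where
  "mixing m F \<longleftrightarrow>
     finite F \<and> card F > 1 \<and> (\<forall>\<gamma>\<in>F. epimorphism \<gamma>) \<and>
     (\<forall>B. (\<forall>\<gamma>\<in>F. B \<gamma> \<in> sets (completion m)) \<longrightarrow>
        (\<lambda>n. measure (completion m) (\<Inter>\<gamma>\<in>F. (\<gamma> ^^ n) -` B \<gamma>))
          \<longlonglongrightarrow> (\<Prod>\<gamma>\<in>F. measure (completion m) (B \<gamma>)))"

definition characters :: "('a::topological_ab_group_add \<Rightarrow> complex) set" where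
  "characters =
     {\<phi>. continuous_on UNIV \<phi> \<and> (\<forall>x. norm (\<phi> x) = 1) \<and> (\<forall>x y. \<phi> (x + y) = \<phi> x * \<phi> y)}"

text \<open>The character group is written multiplicatively (pointwise product), so an integer
  linear relation between characters is a product of integer powers that is constantly 1.\<close>

definition independent_characters :: "('a::topological_ab_group_add \<Rightarrow> complex) set \<Rightarrow> bool" where
  "independent_characters A \<longleftrightarrow>
     A \<subseteq> characters \<and> finite A \<and>
     (\<forall>k::('a \<Rightarrow> complex) \<Rightarrow> int.
        (\<forall>x. (\<Prod>\<phi>\<in>A. \<phi> x powi k \<phi>) = 1) \<longrightarrow> (\<forall>\<phi>\<in>A. k \<phi> = 0))"

text \<open>The dimension of a compact connected abelian group is taken to be the (torsion-free)
  rank of its character group; it is infinite if there is no bound on the size of finite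
  independent sets of characters.\<close>

definition group_dim :: "'a::topological_ab_group_add itself \<Rightarrow> enat" where
  "group_dim _ =
     (SUP A\<in>{A :: ('a \<Rightarrow> complex) set. independent_characters A}. enat (card A))"

end

(* By Peter-Weyl (characters separate points, hence trigonometric polynomials are dense in L^1),
   F fails to be mixing iff some relation  prod_{g in F} chi_g o g^n = 1  between characters,
   not all trivial, holds for infinitely many n. The character group is torsion-free of rank d,
   so up to a common denominator the dual maps are injective integer d x d matrices T_g and the
   relation reads  sum_g T_g^n u_g = 0. By Skolem-Mahler-Lech this persists along a whole
   arithmetic progression, and a relation of minimal support along the progression involves
   at most d + 1 of the matrices, by counting the coefficients of polynomials in the T_g.
   Peter-Weyl for abelian groups is obtained by power iteration: for hermitian h the normalized
   convolution powers of h converge to a convolution idempotent, and the minimal idempotents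
   are multiples of characters. *)

theory Submission
 imports Defs "HOL-Computational_Algebra.Computational_Algebra" "HOL-Library.Function_Algebras"
begin

text \<open>One denominator N serves all dual maps at once: at time n every term of a relation then
  carries the same factor N^n, which torsion-freeness removes, so the set of times is unchanged.
  Surjectivity of the epimorphisms makes the matrices injective, hence invertible modulo every large
  prime p. Hansel's p-adic proof of Skolem-Mahler-Lech rests on this: modulo p^2 some common power b
  of all the matrices is the identity. The exponent 2 is chosen because i! contains at most i
  factors p, so the factorials in the Newton series still leave p^i in its i-th term. Passing to
  b-th powers costs nothing: a relation for them at all times n is one for the original maps at the
  times b n. On the analytic side m is only given as translation invariant and regular. Its
  invariance under epimorphisms is deduced from the values of integrals of characters, and it is
  what makes approximation in L^1 uniform in n, so that mixing can be tested on characters instead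
  of sets.\<close>

abbreviation cont :: "('a::topological_space \<Rightarrow> 'b::topological_space) \<Rightarrow> bool" where
 "cont f \<equiv> continuous_on UNIV f"

abbreviation orbit_prod :: "('a \<Rightarrow> 'a) set \<Rightarrow> (('a \<Rightarrow> 'a) \<Rightarrow> 'a \<Rightarrow> complex) \<Rightarrow> nat \<Rightarrow> 'a \<Rightarrow> complex" where
 "orbit_prod F f n x \<equiv> \<Prod>\<gamma>\<in>F. f \<gamma> ((\<gamma> ^^ n) x)"

abbreviation relation_times :: "('a \<Rightarrow> 'a) set \<Rightarrow> (('a \<Rightarrow> 'a) \<Rightarrow> 'a \<Rightarrow> complex) \<Rightarrow> nat set" where
 "relation_times F f \<equiv> {n. \<forall>x. orbit_prod F f n x = 1}"

abbreviation orbit_preimage :: "('a \<Rightarrow> 'a) set \<Rightarrow> (('a \<Rightarrow> 'a) \<Rightarrow> 'a set) \<Rightarrow> nat \<Rightarrow> 'a set" where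
 "orbit_preimage F A n \<equiv> \<Inter>\<gamma>\<in>F. (\<gamma> ^^ n) -` A \<gamma>"

abbreviation orbit_sum :: "'g set \<Rightarrow> ('g \<Rightarrow> 'v \<Rightarrow> 'v) \<Rightarrow> ('g \<Rightarrow> 'v) \<Rightarrow> nat \<Rightarrow> 'v::comm_monoid_add" where
 "orbit_sum F T u n \<equiv> \<Sum>\<gamma>\<in>F. (T \<gamma> ^^ n) (u \<gamma>)"

section \<open>Integration of continuous functions\<close>

text \<open>A finite subcover is made disjoint by removing from each new set what is already
  covered. The pieces are only Borel, which is enough to turn local uniform estimates into
  approximation by finite sums of indicators.\<close>

lemma finite_borel_partition:
 fixes U :: "'a::topological_space \<Rightarrow> 'a set"
 assumes "compact (UNIV::'a set)" and "\<And>x. open (U x)" and "\<And>x. x \<in> U x"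
 obtains S A where "finite S" "\<And>s. s \<in> S \<Longrightarrow> A s \<in> sets borel" "\<And>s. s \<in> S \<Longrightarrow> A s \<subseteq> U s"
  "disjoint_family_on A S" "(\<Union>s\<in>S. A s) = UNIV"
proof -
 obtain S where S: "finite S" "UNIV = (\<Union>s\<in>S. U s)"
 proof -
  have "UNIV \<subseteq> \<Union>(range U)" using assms(3) by auto
  then obtain C where C: "C \<subseteq> range U" "finite C" "UNIV \<subseteq> \<Union>C"
   using compactE[OF assms(1), of "range U"] assms(2) by blast
  then obtain S where "finite S" "C = U ` S" by (meson finite_subset_image)
  then show thesis using C that[of S] by auto
 qed
 have "\<exists>A. (\<forall>s\<in>T. A s \<in> sets borel \<and> A s \<subseteq> U s) \<and> disjoint_family_on A T \<and> (\<Union>s\<in>T. A s) = (\<Union>s\<in>T. U s)"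
  if "finite T" for T
  using that
 proof induct
  case empty
  then show ?case by (auto simp: disjoint_family_on_def)
 next
  case (insert t T)
  then obtain A where A: "\<forall>s\<in>T. A s \<in> sets borel \<and> A s \<subseteq> U s" "disjoint_family_on A T"
   "(\<Union>s\<in>T. A s) = (\<Union>s\<in>T. U s)" by blast
  have "(\<Union>s\<in>T. A s) \<in> sets borel" using A(1) insert(1) by auto
  then have 1: "U t - (\<Union>s\<in>T. A s) \<in> sets borel" using assms(2) by auto
  let ?A = "A(t := U t - (\<Union>s\<in>T. A s))"
  have "\<forall>s\<in>insert t T. ?A s \<in> sets borel \<and> ?A s \<subseteq> U s" using A(1) 1 by auto
  moreover have "disjoint_family_on ?A (insert t T)"
   using A(2) insert(2) unfolding disjoint_family_on_def by auto
  moreover have "(\<Union>s\<in>insert t T. ?A s) = (\<Union>s\<in>insert t T. U s)"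
  proof -
   have "(\<Union>s\<in>T. ?A s) = (\<Union>s\<in>T. A s)" using insert(2) by auto
   then show ?thesis using A(3) by auto
  qed
  ultimately show ?case by blast
 qed
 from this[OF S(1)] obtain A where "\<forall>s\<in>S. A s \<in> sets borel \<and> A s \<subseteq> U s" "disjoint_family_on A S"
  "(\<Union>s\<in>S. A s) = (\<Union>s\<in>S. U s)" by blast
 then show thesis using S that[of S A] by auto
qed

locale compact_haar =
 fixes m :: "'a::{topological_ab_group_add,t2_space} measure"
 assumes compact_UNIV: "compact (UNIV :: 'a set)" and haar: "normalized_haar m"
begin

lemma sets_m [simp, measurable_cong]: "sets m = sets borel"
 using haar by (simp add: normalized_haar_def)

lemma space_m [simp]: "space m = UNIV"
 using sets_eq_imp_space_eq[OF sets_m] by simp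

sublocale prob_space m
 using haar by (simp add: normalized_haar_def)

lemma bounded_continuous:
 fixes f :: "'a \<Rightarrow> 'b::{banach,second_countable_topology}"
 assumes "cont f"
 obtains B where "B > 0" "\<And>x. norm (f x) \<le> B"
proof -
 have "bounded (range f)" by (rule compact_imp_bounded[OF compact_continuous_image[OF assms compact_UNIV]])
 then show thesis using that unfolding bounded_pos by auto
qed

lemma integrable_bounded:
 fixes f :: "'a \<Rightarrow> 'b::{banach,second_countable_topology}"
 assumes "f \<in> borel_measurable borel" "\<And>x. norm (f x) \<le> B"
 shows "integrable m f"
proof (rule integrable_const_bound[of _ B])
 show "f \<in> borel_measurable m" using assms(1) measurable_cong_sets[OF sets_m refl] by blast
qed (use assms in auto)

lemma integrable_cont [intro]:
 fixes f :: "'a \<Rightarrow> 'b::{banach,second_countable_topology}"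
 assumes "cont f"
 shows "integrable m f"
proof -
 obtain B where "\<And>x. norm (f x) \<le> B" using bounded_continuous[OF assms] by blast
 then show ?thesis by (rule integrable_bounded[OF borel_measurable_continuous_onI[OF assms]])
qed

lemma integral_bound:
 fixes f :: "'a \<Rightarrow> 'b::{banach,second_countable_topology}"
 assumes "\<And>x. norm (f x) \<le> B" "B \<ge> 0"
 shows "norm (integral\<^sup>L m f) \<le> B"
proof (cases "integrable m f")
 case True
 have "norm (integral\<^sup>L m f) \<le> integral\<^sup>L m (\<lambda>x. norm (f x))" by simp
 also have "\<dots> \<le> integral\<^sup>L m (\<lambda>x. B)" by (rule integral_mono) (use True assms in auto)
 finally show ?thesis by (simp add: prob_space[simplified])
\<comment> \<open>A function that is not integrable has integral 0 by convention, so the bound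
  persists.\<close>
qed (use assms in \<open>simp add: not_integrable_integral_eq\<close>)

lemma emeasure_translation: "A \<in> sets borel \<Longrightarrow> emeasure m ((\<lambda>x. a + x) ` A) = emeasure m A"
 using haar unfolding normalized_haar_def sets_m by blast

lemma outer_regular:
 "A \<in> sets borel \<Longrightarrow> emeasure m A = (INF U\<in>{U. open U \<and> A \<subseteq> U}. emeasure m U)"
 using haar unfolding normalized_haar_def sets_m by blast

lemma inner_regular:
 "A \<in> sets borel \<Longrightarrow> emeasure m A = (SUP K\<in>{K. compact K \<and> K \<subseteq> A}. emeasure m K)"
 using haar unfolding normalized_haar_def sets_m by blast

lemma distr_translation: "distr m m (\<lambda>x. a + x) = m"
proof (rule measure_eqI)
 fix A assume A: "A \<in> sets (distr m m (\<lambda>x. a + x))"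
 have [measurable]: "(\<lambda>x. a + x) \<in> borel_measurable borel"
  by (intro borel_measurable_continuous_onI continuous_intros)
 have eq: "(\<lambda>x. a + x) -` A = (\<lambda>x. -a + x) ` A" by (force simp: image_def algebra_simps)
 have "emeasure (distr m m (\<lambda>x. a + x)) A = emeasure m ((\<lambda>x. a + x) -` A)"
  using A by (subst emeasure_distr) (auto simp: measurable_cong_sets[OF sets_m sets_m])
 also have "\<dots> = emeasure m A"
  unfolding eq using A by (intro emeasure_translation) simp
 finally show "emeasure (distr m m (\<lambda>x. a + x)) A = emeasure m A" .
qed simp

abbreviation mean :: "('a \<Rightarrow> 'b::{banach,second_countable_topology}) \<Rightarrow> 'b" where
 "mean f \<equiv> integral\<^sup>L m f"

lemma integral_translation:
 fixes f :: "'a \<Rightarrow> 'b::{banach,second_countable_topology}"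
 assumes "f \<in> borel_measurable borel"
 shows "(\<integral>x. f (a + x) \<partial>m) = mean f"
proof -
 have "(\<lambda>x. a + x) \<in> borel_measurable borel"
  by (intro borel_measurable_continuous_onI continuous_intros)
 then have "(\<lambda>x. a + x) \<in> measurable m m" by (simp add: measurable_cong_sets[OF sets_m sets_m])
 moreover have "f \<in> borel_measurable m" using assms by (simp add: measurable_cong_sets[OF sets_m refl])
 ultimately have "integral\<^sup>L (distr m m (\<lambda>x. a + x)) f = (\<integral>x. f (a + x) \<partial>m)"
  by (rule integral_distr)
 then show ?thesis unfolding distr_translation by simp
qed

text \<open>Compactness of the second factor makes continuity in the first variable uniform in the
  second.\<close>

lemma tube:
 fixes F :: "'a \<Rightarrow> 'a \<Rightarrow> complex"
 assumes "cont (case_prod F)" "e > 0"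
 shows "\<exists>X. x \<in> X \<and> open X \<and> (\<forall>x'\<in>X. \<forall>y. norm (F x' y - F x y) \<le> e)"
proof -
 have "continuous_on (UNIV \<times> UNIV) (case_prod F)" using assms by simp
 from continuous_on_prod_compactE[OF this compact_UNIV UNIV_I assms(2)] obtain X
  where X: "x \<in> X" "open X" "\<forall>x'\<in>X \<inter> UNIV. \<forall>t\<in>UNIV. dist (case (x', t) of (x, y) \<Rightarrow> F x y) (case (x, t) of (x, y) \<Rightarrow> F x y) \<le> e" .
 then show ?thesis by (intro exI[of _ X]) (simp add: dist_norm)
qed

lemma slice_continuous:
 assumes "cont (case_prod F :: _ \<Rightarrow> complex)"
 shows "cont (F x)" "cont (\<lambda>x. F x y)"
proof -
 have "cont (\<lambda>y. (x, y))" "cont (\<lambda>x. (x, y))"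
  by (intro continuous_on_Pair continuous_on_const continuous_on_id)+
 from this[THEN continuous_on_compose2[OF assms]]
 show "cont (F x)" "cont (\<lambda>x. F x y)" by simp_all
qed

lemma continuous_integral:
 fixes F :: "'a \<Rightarrow> 'a \<Rightarrow> complex"
 assumes "cont (case_prod F)"
 shows "cont (\<lambda>x. \<integral>y. F x y \<partial>m)"
 unfolding continuous_on_topological
proof (intro ballI allI impI)
 fix x B assume B: "open B" "(\<integral>y. F x y \<partial>m) \<in> B"
 then obtain e where e: "e > 0" "ball (\<integral>y. F x y \<partial>m) e \<subseteq> B" by (meson open_contains_ball)
 have e2: "e/2 > 0" using e by simp
 obtain X where X: "x \<in> X" "open X" "\<forall>x'\<in>X. \<forall>y. norm (F x' y - F x y) \<le> e/2"
  using tube[of F "e/2" x, OF assms e2] by blast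
 have "(\<integral>y. F x' y \<partial>m) \<in> B" if "x' \<in> X" for x'
 proof -
  have iF: "integrable m (F x)" for x
   by (rule integrable_cont[OF slice_continuous(1)[of F, OF assms]])
  have "(\<integral>y. F x' y \<partial>m) - (\<integral>y. F x y \<partial>m) = (\<integral>y. F x' y - F x y \<partial>m)"
   by (rule Bochner_Integration.integral_diff[OF iF iF, symmetric])
  moreover have "norm (\<integral>y. F x' y - F x y \<partial>m) \<le> e/2"
   by (rule integral_bound) (use X that e in auto)
  ultimately show ?thesis using e by (auto simp: dist_norm norm_minus_commute subset_eq)
 qed
 then show "\<exists>A. open A \<and> x \<in> A \<and> (\<forall>y\<in>UNIV. y \<in> A \<longrightarrow> (\<integral>ya. F y ya \<partial>m) \<in> B)"
  using X by blast
qed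

lemma simple_sum:
 assumes "finite S" "disjoint_family_on A S" "(\<Union>s\<in>S. A s) = UNIV"
 shows "\<exists>s\<in>S. x \<in> A s \<and> (\<forall>f. (\<Sum>t\<in>S. indicator (A t) x * f t) = (f s :: complex))"
proof -
 obtain s where s: "s \<in> S" "x \<in> A s" using assms(3) by blast
 have "(\<Sum>t\<in>S. indicator (A t) x * f t) = (f s :: complex)" for f
 proof -
  have "(\<Sum>t\<in>S. indicator (A t) x * f t) = (\<Sum>t\<in>S. if t = s then f s else 0)"
   using assms(2) s unfolding disjoint_family_on_def
   by (intro sum.cong) (auto simp: indicator_def)
  then show ?thesis using s assms(1) by simp
 qed
 then show ?thesis using s by blast
qed


text \<open>No measurability on the product space enters. By \<open>tube\<close> the kernel is
  uniformly within e of a finite sum of indicators in x times continuous functions of y; for such a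
  sum both iterated integrals are computed term by term, and each order of integration contributes
  an error of at most e.\<close>

lemma Fubini_continuous:
 fixes F :: "'a \<Rightarrow> 'a \<Rightarrow> complex"
 assumes "cont (case_prod F)"
 shows "(\<integral>x. \<integral>y. F x y \<partial>m \<partial>m) = (\<integral>y. \<integral>x. F x y \<partial>m \<partial>m)"
proof -
 have sw: "cont (case_prod (\<lambda>y x. F x y))"
  using continuous_on_compose2[OF assms continuous_on_swap[of UNIV]]
  by (simp add: prod.swap_def split_beta')
 have iF1: "integrable m (\<lambda>y. F x y)" for x
  by (rule integrable_cont[OF slice_continuous(1)[of F, OF assms]])
 have iF2: "integrable m (\<lambda>x. F x y)" for y
  by (rule integrable_cont[OF slice_continuous(2)[of F, OF assms]])
 have iF3: "integrable m (\<lambda>x. \<integral>y. F x y \<partial>m)"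
  by (rule integrable_cont[OF continuous_integral[of F, OF assms]])
 have iF4: "integrable m (\<lambda>y. \<integral>x. F x y \<partial>m)"
  by (rule integrable_cont[OF continuous_integral[of "\<lambda>y x. F x y", OF sw]])
 have "norm ((\<integral>x. \<integral>y. F x y \<partial>m \<partial>m) - (\<integral>y. \<integral>x. F x y \<partial>m \<partial>m)) \<le> 2 * e" if e: "e > 0" for e
 proof -
  have "\<exists>X. x \<in> X \<and> open X \<and> (\<forall>x'\<in>X. \<forall>y. norm (F x' y - F x y) \<le> e)" for x
   using tube[of F e x, OF assms e] .
  then have "\<forall>x. \<exists>X. x \<in> X \<and> open X \<and> (\<forall>x'\<in>X. \<forall>y. norm (F x' y - F x y) \<le> e)" by (rule allI)
  from choice[OF this] obtain U
   where U': "\<forall>x. x \<in> U x \<and> open (U x) \<and> (\<forall>x'\<in>U x. \<forall>y. norm (F x' y - F x y) \<le> e)" ..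
  then have U: "\<And>x. x \<in> U x" "\<And>x. open (U x)"
   "\<And>x x' y. x' \<in> U x \<Longrightarrow> norm (F x' y - F x y) \<le> e" by blast+
  obtain S A where S: "finite S" "\<And>s. s \<in> S \<Longrightarrow> A s \<in> sets borel" "\<And>s. s \<in> S \<Longrightarrow> A s \<subseteq> U s"
   "disjoint_family_on A S" "(\<Union>s\<in>S. A s) = UNIV"
   by (rule finite_borel_partition[OF compact_UNIV U(2) U(1)]) (rule that)
  define G where "G x y = (\<Sum>s\<in>S. indicator (A s) x * F s y)" for x y
  have FG: "norm (F x y - G x y) \<le> e" for x y
  proof -
   obtain s where s: "s \<in> S" "x \<in> A s" "\<forall>f. (\<Sum>t\<in>S. indicator (A t) x * f t) = (f s :: complex)"
    using simple_sum[OF S(1,4,5), of x] by blast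
   have "G x y = F s y" unfolding G_def by (rule spec[OF s(3), of "\<lambda>t. F t y"])
   then show ?thesis using U(3)[of x s y] S(3)[OF s(1)] s(2) by auto
  qed
  have iA: "integrable m (\<lambda>x. indicator (A s) x * c)" if "s \<in> S" for s and c :: complex
   by (rule integrable_bounded[of _ "norm c"])
    (use S(2)[OF that] in \<open>auto simp: indicator_def norm_mult\<close>)
  have intA: "(\<integral>x. indicator (A s) x * c \<partial>m) = of_real (measure m (A s)) * c" if "s \<in> S" for s and c :: complex
  proof -
   have eq: "(\<lambda>x. indicator (A s) x * c) = (\<lambda>x. complex_of_real (indicator (A s) x) * c)"
    by (auto simp: indicator_def)
   show ?thesis unfolding eq integral_mult_left_zero integral_complex_of_real
    using S(2)[OF that] by simp
  qed
  have Gx: "(\<integral>x. G x y \<partial>m) = (\<Sum>s\<in>S. of_real (measure m (A s)) * F s y)" for y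
   unfolding G_def
   by (subst Bochner_Integration.integral_sum) (rule iA, assumption, rule sum.cong[OF refl], rule intA)
  have Gy: "(\<integral>y. G x y \<partial>m) = (\<Sum>s\<in>S. indicator (A s) x * (\<integral>y. F s y \<partial>m))" for x
   unfolding G_def
   by (subst Bochner_Integration.integral_sum) (auto intro!: integrable_mult_right iF1)
  have "(\<integral>x. \<integral>y. G x y \<partial>m \<partial>m) = (\<Sum>s\<in>S. of_real (measure m (A s)) * (\<integral>y. F s y \<partial>m))"
   unfolding Gy
   by (subst Bochner_Integration.integral_sum) (rule iA, assumption, rule sum.cong[OF refl], rule intA)
  moreover have "(\<integral>y. \<integral>x. G x y \<partial>m \<partial>m) = (\<Sum>s\<in>S. of_real (measure m (A s)) * (\<integral>y. F s y \<partial>m))"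
   unfolding Gx
   by (subst Bochner_Integration.integral_sum) (auto intro!: integrable_mult_right iF1)
  ultimately have GG: "(\<integral>x. \<integral>y. G x y \<partial>m \<partial>m) = (\<integral>y. \<integral>x. G x y \<partial>m \<partial>m)" by simp
  have iGx: "integrable m (\<lambda>y. \<integral>x. G x y \<partial>m)" unfolding Gx
   by (intro Bochner_Integration.integrable_sum integrable_mult_right iF1)
  have iGy: "integrable m (\<lambda>x. \<integral>y. G x y \<partial>m)" unfolding Gy
   by (intro Bochner_Integration.integrable_sum iA)
  have iG1: "integrable m (\<lambda>y. G x y)" for x unfolding G_def
   by (intro Bochner_Integration.integrable_sum integrable_mult_right iF1)
  have iG2: "integrable m (\<lambda>x. G x y)" for y unfolding G_def
   by (intro Bochner_Integration.integrable_sum iA)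
  have "norm ((\<integral>y. F x y \<partial>m) - (\<integral>y. G x y \<partial>m)) \<le> e" for x
   unfolding Bochner_Integration.integral_diff[OF iF1 iG1, symmetric]
   by (rule integral_bound) (use FG e in auto)
  then have 1: "norm ((\<integral>x. \<integral>y. F x y \<partial>m \<partial>m) - (\<integral>x. \<integral>y. G x y \<partial>m \<partial>m)) \<le> e"
   unfolding Bochner_Integration.integral_diff[OF iF3 iGy, symmetric]
   by (rule integral_bound) (use e in auto)
  have "norm ((\<integral>x. F x y \<partial>m) - (\<integral>x. G x y \<partial>m)) \<le> e" for y
   unfolding Bochner_Integration.integral_diff[OF iF2 iG2, symmetric]
   by (rule integral_bound) (use FG e in auto)
  then have 2: "norm ((\<integral>y. \<integral>x. F x y \<partial>m \<partial>m) - (\<integral>y. \<integral>x. G x y \<partial>m \<partial>m)) \<le> e"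
   unfolding Bochner_Integration.integral_diff[OF iF4 iGx, symmetric]
   by (rule integral_bound) (use e in auto)
  from norm_triangle_ineq4[of "(\<integral>x. \<integral>y. F x y \<partial>m \<partial>m) - (\<integral>x. \<integral>y. G x y \<partial>m \<partial>m)"
   "(\<integral>y. \<integral>x. F x y \<partial>m \<partial>m) - (\<integral>y. \<integral>x. G x y \<partial>m \<partial>m)"] 1 2 GG show ?thesis by simp
 qed
 \<comment> \<open>A positive norm could be taken as 3 e, but it is at most 2 e.\<close>
 from this[of "norm ((\<integral>x. \<integral>y. F x y \<partial>m \<partial>m) - (\<integral>y. \<integral>x. F x y \<partial>m \<partial>m)) / 3"]
 show ?thesis by (cases "norm ((\<integral>x. \<integral>y. F x y \<partial>m \<partial>m) - (\<integral>y. \<integral>x. F x y \<partial>m \<partial>m)) = 0") auto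
qed


text \<open>Only translation invariance is available. Integrating f(y - x) over y first gives the
  mean of f, over x first the mean of its reflection.\<close>

lemma integral_reflect:
 fixes f :: "'a \<Rightarrow> complex"
 assumes f: "cont f"
 shows "(\<integral>x. f (- x) \<partial>m) = mean f"
proof -
 have c: "cont (\<lambda>x. f (- x))"
  by (intro continuous_on_compose2[OF f] continuous_intros) auto
 have F: "cont (case_prod (\<lambda>x y. f (y - x)))"
  unfolding split_beta' by (intro continuous_on_compose2[OF f] continuous_intros) auto
 have 1: "(\<integral>y. f (y - x) \<partial>m) = mean f" for x
  using integral_translation[OF borel_measurable_continuous_onI[OF f], of "-x"] by simp
 have 2: "(\<integral>x. f (y - x) \<partial>m) = (\<integral>x. f (- x) \<partial>m)" for y
  using integral_translation[OF borel_measurable_continuous_onI[OF c], of "-y"] by simp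
 show ?thesis using Fubini_continuous[OF F] by (simp add: 1 2 prob_space[simplified])
qed

lemma integral_reflect_translate:
 fixes f :: "'a \<Rightarrow> complex"
 assumes f: "cont f"
 shows "(\<integral>y. f (x - y) \<partial>m) = mean f"
proof -
 have c: "cont (\<lambda>x. f (- x))"
  by (intro continuous_on_compose2[OF f] continuous_intros) auto
 show ?thesis
  using integral_translation[OF borel_measurable_continuous_onI[OF c], of "-x"] integral_reflect[OF f]
  by simp
qed

section \<open>The convolution algebra of continuous functions and its L^2 estimates\<close>

definition conv :: "('a \<Rightarrow> complex) \<Rightarrow> ('a \<Rightarrow> complex) \<Rightarrow> 'a \<Rightarrow> complex"
 where "conv f g x = (\<integral>y. f (x - y) * g y \<partial>m)"

lemma continuous_conv_kernel:
 fixes f g :: "'a \<Rightarrow> complex"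
 assumes f: "cont f" and g: "cont g"
 shows "cont (\<lambda>y. f (x - y) * g y)"
 by (intro continuous_intros g continuous_on_compose2[OF f]) auto

lemma continuous_conv:
 assumes f: "cont f" and g: "cont g"
 shows "cont (conv f g)"
proof -
 have "cont (case_prod (\<lambda>x y. f (x - y) * g y))"
  unfolding split_beta'
  by (intro continuous_intros continuous_on_compose2[OF f] continuous_on_compose2[OF g]) auto
 from continuous_integral[OF this] show ?thesis unfolding conv_def[abs_def] .
qed

lemma conv_commute:
 assumes f: "cont f" and g: "cont g"
 shows "conv f g = conv g f"
proof
 fix x
 show "conv f g x = conv g f x"
  unfolding conv_def
  using integral_reflect_translate[OF continuous_conv_kernel[OF f g, of x], of x]
  by (simp add: mult.commute)
qed

lemma conv_assoc:
 assumes f: "cont f" and g: "cont g" and h: "cont h"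
 shows "conv (conv f g) h = conv f (conv g h)"
proof
 fix x
 have F: "cont (case_prod (\<lambda>z y. f (x - z) * (g (z - y) * h y)))"
  unfolding split_beta'
  by (intro continuous_intros continuous_on_compose2[OF f] continuous_on_compose2[OF g]
    continuous_on_compose2[OF h]) auto
 have "conv f (conv g h) x = (\<integral>z. \<integral>y. f (x - z) * (g (z - y) * h y) \<partial>m \<partial>m)"
  unfolding conv_def by simp
 also have "\<dots> = (\<integral>y. \<integral>z. f (x - z) * (g (z - y) * h y) \<partial>m \<partial>m)"
  by (rule Fubini_continuous[OF F])
 also have "\<dots> = (\<integral>y. (\<integral>z. f (x - y - z) * g z \<partial>m) * h y \<partial>m)"
 proof (rule Bochner_Integration.integral_cong[OF refl])
  fix y
  have c: "cont (\<lambda>z. f (x - z) * (g (z - y) * h y))"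
   by (intro continuous_intros continuous_on_compose2[OF f] continuous_on_compose2[OF g]) auto
  have "(\<integral>z. f (x - z) * (g (z - y) * h y) \<partial>m) = (\<integral>z. f (x - (y + z)) * (g ((y + z) - y) * h y) \<partial>m)"
   using integral_translation[OF borel_measurable_continuous_onI[OF c], of y] by simp
  also have "\<dots> = (\<integral>z. (f (x - y - z) * g z) * h y \<partial>m)"
   by (simp add: algebra_simps)
  also have "\<dots> = (\<integral>z. f (x - y - z) * g z \<partial>m) * h y" by simp
  finally show "(\<integral>z. f (x - z) * (g (z - y) * h y) \<partial>m) = (\<integral>z. f (x - y - z) * g z \<partial>m) * h y" .
 qed
 finally show "conv (conv f g) h x = conv f (conv g h) x" unfolding conv_def by simp
qed

lemma conv_add_right:
 assumes f: "cont f" and g: "cont g" and h: "cont h"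
 shows "conv f (\<lambda>x. g x + h x) = (\<lambda>x. conv f g x + conv f h x)"
proof
 fix x
 show "conv f (\<lambda>x. g x + h x) x = conv f g x + conv f h x"
  unfolding conv_def distrib_left
  by (rule Bochner_Integration.integral_add) (rule integrable_cont continuous_conv_kernel assms)+
qed

lemma conv_scale_right: "conv f (\<lambda>x. c * g x) = (\<lambda>x. c * conv f g x)"
 unfolding conv_def by (simp add: mult.left_commute)

lemma conv_scale_left: "conv (\<lambda>x. c * f x) g = (\<lambda>x. c * conv f g x)"
 unfolding conv_def by (simp add: mult.assoc)

lemma conv_diff_right:
 assumes f: "cont f" and g: "cont g" and h: "cont h"
 shows "conv f (\<lambda>x. g x - h x) = (\<lambda>x. conv f g x - conv f h x)"
proof
 fix x
 show "conv f (\<lambda>x. g x - h x) x = conv f g x - conv f h x"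
  unfolding conv_def right_diff_distrib
  by (rule Bochner_Integration.integral_diff) (rule integrable_cont continuous_conv_kernel assms)+
qed

lemma conv_diff_left:
 assumes f: "cont f" and g: "cont g" and h: "cont h"
 shows "conv (\<lambda>x. g x - h x) f = (\<lambda>x. conv g f x - conv h f x)"
proof
 fix x
 show "conv (\<lambda>x. g x - h x) f x = conv g f x - conv h f x"
  unfolding conv_def left_diff_distrib
  by (rule Bochner_Integration.integral_diff) (rule integrable_cont continuous_conv_kernel assms)+
qed

text \<open>Fixed points of the involution sending f to the conjugate of its reflection: convolution
  with such an f is a self-adjoint operator.\<close>

definition hermitian :: "('a \<Rightarrow> complex) \<Rightarrow> bool"
 where "hermitian f \<longleftrightarrow> cont f \<and> (\<forall>x. f (- x) = cnj (f x))"

lemma hermitian_cont: "hermitian f \<Longrightarrow> cont f"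
 by (simp add: hermitian_def)

lemma hermitian_diff: "hermitian f \<Longrightarrow> hermitian g \<Longrightarrow> hermitian (\<lambda>x. f x - g x)"
 by (auto simp: hermitian_def intro: continuous_on_diff)

lemma hermitian_scale: "hermitian f \<Longrightarrow> hermitian (\<lambda>x. complex_of_real c * f x)"
 by (auto simp: hermitian_def intro: continuous_intros)

lemma hermitian_conv:
 assumes f: "hermitian f" and g: "hermitian g"
 shows "hermitian (conv f g)"
 unfolding hermitian_def
proof (intro conjI allI)
 note c = hermitian_cont[OF f] hermitian_cont[OF g]
 show "cont (conv f g)" by (rule continuous_conv[OF c])
 fix x
 have "conv f g (- x) = (\<integral>y. f (- x - - y) * g (- y) \<partial>m)"
  unfolding conv_def
  using integral_reflect[OF continuous_conv_kernel[OF c, of "-x"]] by simp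
 also have "\<dots> = (\<integral>y. cnj (f (x - y) * g y) \<partial>m)"
 proof (rule Bochner_Integration.integral_cong[OF refl])
  fix y
  have "f (- x - - y) = f (- (x - y))" by simp
  also have "\<dots> = cnj (f (x - y))" using f unfolding hermitian_def by blast
  finally show "f (- x - - y) * g (- y) = cnj (f (x - y) * g y)"
   using g unfolding hermitian_def by simp
 qed
 also have "\<dots> = cnj (conv f g x)" unfolding conv_def by (rule Bochner_Integration.integral_cnj)
 finally show "conv f g (- x) = cnj (conv f g x)" .
qed

text \<open>The square of the L^2 norm. For a convolution idempotent it equals the value at 0, which
  is the trace of the corresponding projection.\<close>

definition l2 :: "('a \<Rightarrow> complex) \<Rightarrow> real"
 where "l2 f = (\<integral>x. (norm (f x))\<^sup>2 \<partial>m)"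

lemma l2_nonneg: "l2 f \<ge> 0"
 unfolding l2_def by (rule integral_nonneg_AE) simp

lemma Cauchy_Schwarz_integral:
 fixes u v :: "'a \<Rightarrow> real"
 assumes u: "cont u" and v: "cont v"
 shows "(\<integral>x. u x * v x \<partial>m)\<^sup>2 \<le> (\<integral>x. (u x)\<^sup>2 \<partial>m) * (\<integral>x. (v x)\<^sup>2 \<partial>m)"
proof -
 define a b c where "a = (\<integral>x. (u x)\<^sup>2 \<partial>m)" and "b = (\<integral>x. u x * v x \<partial>m)" and "c = (\<integral>x. (v x)\<^sup>2 \<partial>m)"
 have i: "integrable m (\<lambda>x. (u x)\<^sup>2)" "integrable m (\<lambda>x. u x * v x)" "integrable m (\<lambda>x. (v x)\<^sup>2)"
  by (intro integrable_cont continuous_intros u v)+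
 have q: "0 \<le> a - 2 * t * b + t\<^sup>2 * c" for t
 proof -
  have "0 \<le> (\<integral>x. (u x - t * v x)\<^sup>2 \<partial>m)" by (rule integral_nonneg_AE) simp
  also have "\<dots> = (\<integral>x. ((u x)\<^sup>2 - (2 * t) * (u x * v x)) + t\<^sup>2 * (v x)\<^sup>2 \<partial>m)"
   by (rule Bochner_Integration.integral_cong[OF refl]) (simp add: power2_eq_square algebra_simps)
  also have "\<dots> = a - 2 * t * b + t\<^sup>2 * c"
   unfolding a_def b_def c_def using i by simp
  finally show ?thesis .
 qed
 have "b\<^sup>2 \<le> a * c"
 proof (cases "c = 0")
  case True
  have "b = 0"
  proof (rule ccontr)
   assume "b \<noteq> 0"
   \<comment> \<open>With c = 0 the expression a - 2 t b is affine in t and equals -1 at this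
     t.\<close>
   then show False using q[of "(a + 1) / (2 * b)"] True by (simp add: field_simps)
  qed
  then show ?thesis using True by simp
 next
  case False
  have "c \<ge> 0" unfolding c_def by (rule integral_nonneg_AE) simp
  with False have "c > 0" by simp
  then show ?thesis using q[of "b / c"] by (simp add: field_simps power2_eq_square)
 qed
 then show ?thesis unfolding a_def b_def c_def .
qed

text \<open>This bound turns L^2 estimates into uniform ones: convolution with a fixed function maps
  L^2 Cauchy sequences to uniformly Cauchy sequences.\<close>

lemma conv_bound:
 assumes f: "cont f" and g: "cont g"
 shows "(norm (conv f g x))\<^sup>2 \<le> l2 f * l2 g"
proof -
 have c: "cont (\<lambda>y. norm (f (x - y)))"
  by (intro continuous_intros continuous_on_compose2[OF f]) auto
 have "norm (conv f g x) \<le> (\<integral>y. norm (f (x - y)) * norm (g y) \<partial>m)"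
  unfolding conv_def norm_mult[symmetric] by (rule integral_norm_bound)
 then have "(norm (conv f g x))\<^sup>2 \<le> (\<integral>y. norm (f (x - y)) * norm (g y) \<partial>m)\<^sup>2"
  by (intro power_mono) auto
 also have "\<dots> \<le> (\<integral>y. (norm (f (x - y)))\<^sup>2 \<partial>m) * l2 g"
  unfolding l2_def by (intro Cauchy_Schwarz_integral c continuous_intros g)
 also have "(\<integral>y. (norm (f (x - y)))\<^sup>2 \<partial>m) = l2 f"
 proof -
  have "cont (\<lambda>y. complex_of_real ((norm (f y))\<^sup>2))"
   by (intro continuous_intros f)
  from integral_reflect_translate[OF this, of x] show ?thesis unfolding l2_def
   by (simp only: integral_complex_of_real of_real_eq_iff)
 qed
 finally show ?thesis .
qed

lemma conv_self_zero:
 assumes "hermitian f"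
 shows "conv f f 0 = of_real (l2 f)"
proof -
 have "conv f f 0 = (\<integral>y. complex_of_real ((norm (f y))\<^sup>2) \<partial>m)"
  unfolding conv_def
 proof (rule Bochner_Integration.integral_cong[OF refl])
  fix y
  have "f (0 - y) = cnj (f y)" using assms unfolding hermitian_def by simp
  then show "f (0 - y) * f y = complex_of_real ((norm (f y))\<^sup>2)"
   by (simp only: complex_norm_square mult.commute)
 qed
 then show ?thesis unfolding l2_def by (simp only: integral_complex_of_real)
qed

text \<open>Finitely many translates of a nonempty open set cover the compact group, so if one were
  null the whole space, of measure 1, would be null.\<close>

lemma null_open_empty:
 assumes U: "open U" "emeasure m U = 0"
 shows "U = {}"
proof (rule ccontr)
 assume "U \<noteq> {}"
 then obtain u where u: "u \<in> U" by blast
 define V where "V a = (\<lambda>x. a + x) ` U" for a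
 have op: "open (V a)" for a
 proof -
  have "V a = (\<lambda>x. -a + x) -` U" unfolding V_def by (force simp: image_def algebra_simps)
  moreover have "open ((\<lambda>x. -a + x) -` U)"
   by (rule open_vimage[OF U(1)]) (intro continuous_intros)
  ultimately show ?thesis by simp
 qed
 have null: "V a \<in> null_sets m" for a
  using emeasure_translation[of U a] U op[of a] unfolding V_def by (auto simp: null_sets_def)
 have "UNIV \<subseteq> (\<Union>a\<in>UNIV. V a)"
 proof
  fix x show "x \<in> (\<Union>a\<in>UNIV. V a)"
  proof (rule UN_I)
   show "x \<in> V (x - u)" unfolding V_def by (rule image_eqI[of _ _ u]) (use u in simp_all)
  qed simp
 qed
 then obtain S where S: "finite S" "UNIV \<subseteq> (\<Union>a\<in>S. V a)"
  using compactE_image[OF compact_UNIV, of UNIV V] op by metis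
 have "(\<Union>a\<in>S. V a) \<in> null_sets m" using S(1) null by (intro null_sets_UN') (auto intro: countable_finite)
 moreover have "(\<Union>a\<in>S. V a) = UNIV" using S(2) by blast
 ultimately have "emeasure m UNIV = 0" by (auto simp: null_sets_def)
 then show False using emeasure_space_1 by simp
qed

lemma l2_eq_0:
 assumes f: "cont f" and "l2 f = 0"
 shows "f = (\<lambda>x. 0)"
proof -
 have i: "integrable m (\<lambda>x. (norm (f x))\<^sup>2)" by (intro integrable_cont continuous_intros f)
 have "AE x in m. (norm (f x))\<^sup>2 = 0"
  using assms(2) integral_nonneg_eq_0_iff_AE[OF i] unfolding l2_def by simp
 then have ae: "AE x in m. x \<notin> {x. f x \<noteq> 0}" by (auto elim!: eventually_mono)
 have op: "open {x. f x \<noteq> 0}"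
  by (rule open_Collect_neq[OF f]) (rule continuous_on_const)
 have "emeasure m {x. f x \<noteq> 0} = 0"
  using ae op AE_iff_measurable[of "{x. f x \<noteq> 0}" m "\<lambda>x. x \<notin> {x. f x \<noteq> 0}"] by simp
 from null_open_empty[OF op this] show ?thesis by auto
qed

end

section \<open>Spectral decomposition of convolution operators\<close>

text \<open>Log-convexity makes the ratios a (n + 1) / a n increase and submultiplicativity bounds
  them by a 0; L is their limit. Since no ratio exceeds L, the normalized sequence decreases.
  Letting m tend to infinity in a (m + N + 1) / a m <= a N gives L^(N + 1) <= a N, so the limit
  stays at least 1. In the application a n is the sum of lambda^(n + 1) over the eigenvalues lambda
  of h * h; then L is the largest eigenvalue and c its multiplicity.\<close>

lemma logconvex_normalization:
 fixes a :: "nat \<Rightarrow> real"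
 assumes pos: "\<And>n. a n > 0"
  and logconvex: "\<And>n. (a (Suc n))\<^sup>2 \<le> a n * a (Suc (Suc n))"
  and submult: "\<And>i j. a (Suc (i + j)) \<le> a i * a j"
 shows "\<exists>L>0. \<exists>c. (\<lambda>n. a n / L ^ Suc n) \<longlonglongrightarrow> c \<and> c \<ge> 1"
proof -
 define r where "r n = a (Suc n) / a n" for n
 have rpos: "r n > 0" for n using pos by (simp add: r_def)
 have "r n \<le> r (Suc n)" for n
  using logconvex[of n] pos[of n] pos[of "Suc n"] by (simp add: r_def field_simps power2_eq_square)
 then have inc: "incseq r" by (rule incseq_SucI)
 have rb: "r n \<le> a 0" for n
  using submult[of n 0] pos[of n] by (simp add: r_def field_simps)
 obtain L where L: "r \<longlonglongrightarrow> L" "\<forall>n. r n \<le> L"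
  using incseq_convergent[OF inc, of "a 0"] rb by blast
 have Lpos: "L > 0" using rpos[of 0] L(2) by (meson less_le_trans)
 define A where "A n = a n / L ^ Suc n" for n
 have "A (Suc n) \<le> A n" for n
 proof -
  have "a (Suc n) \<le> L * a n" using L(2)[rule_format, of n] pos[of n] by (simp add: r_def field_simps)
  then have "A (Suc n) \<le> (L * a n) / L ^ Suc (Suc n)"
   unfolding A_def using Lpos by (intro divide_right_mono) auto
  then show ?thesis using Lpos by (simp add: A_def)
 qed
 then have dec: "decseq A" by (rule decseq_SucI)
 have ge: "A N \<ge> 1" for N
 proof -
  have "(\<lambda>m. a (Suc (m + N)) / a m) \<longlonglongrightarrow> L ^ Suc N" for N
  proof (induct N)
   case 0
   then show ?case using L(1) by (simp add: r_def[abs_def])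
  next
   case (Suc N)
   have "(\<lambda>m. r (m + Suc N)) \<longlonglongrightarrow> L" by (rule LIMSEQ_ignore_initial_segment[OF L(1)])
   from tendsto_mult[OF this Suc] show ?case
    unfolding r_def using pos by (simp add: less_imp_neq[THEN not_sym])
  qed
  then have "L ^ Suc N \<le> a N"
  proof (rule LIMSEQ_le_const2)
   show "\<exists>M. \<forall>n\<ge>M. a (Suc (n + N)) / a n \<le> a N"
    using submult pos by (intro exI[of _ 0]) (simp add: field_simps)
  qed
  then show ?thesis using Lpos by (simp add: A_def field_simps)
 qed
 obtain c where c: "A \<longlonglongrightarrow> c" "\<forall>i. c \<le> A i" using decseq_convergent[OF dec, of 1] ge by blast
 have "c \<ge> 1" by (rule LIMSEQ_le_const[OF c(1)]) (use ge in auto)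
 then show ?thesis using Lpos c(1) unfolding A_def[abs_def] by blast
qed

section \<open>Convolution powers and power iteration\<close>

context compact_haar
begin

lemma conv_zero_right: "conv f (\<lambda>x. 0) = (\<lambda>x. 0)"
 by (rule ext) (simp add: conv_def)

lemma conv_uniform_limit:
 assumes lim: "uniform_limit UNIV F f sequentially" and F: "\<And>n. cont (F n)"
  and f: "cont f" and g: "cont g"
 shows "(\<lambda>n. conv g (F n) x) \<longlonglongrightarrow> conv g f x"
proof (rule LIMSEQ_I)
 fix e :: real assume e: "e > 0"
 obtain B where B: "B > 0" "\<And>x. norm (g x) \<le> B" using bounded_continuous[OF g] by blast
 have "\<forall>\<^sub>F n in sequentially. \<forall>x\<in>UNIV. dist (F n x) (f x) < e / (2 * B)"
  using uniform_limitD[OF lim, of "e / (2 * B)"] e B(1) by simp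
 then obtain N where N: "\<And>n x. n \<ge> N \<Longrightarrow> norm (F n x - f x) < e / (2 * B)"
  unfolding eventually_sequentially dist_norm by blast
 have "norm (conv g (F n) x - conv g f x) < e" if n: "n \<ge> N" for n
 proof -
  have "conv g (F n) x - conv g f x = conv g (\<lambda>x. F n x - f x) x"
   by (simp add: conv_diff_right[OF g F f])
  also have "norm \<dots> \<le> e / 2"
   unfolding conv_def
  proof (rule integral_bound)
   fix y
   have "norm (g (x - y)) * norm (F n y - f y) \<le> B * (e / (2 * B))"
    using B N[OF n, of y] by (intro mult_mono) auto
   then show "norm (g (x - y) * (F n y - f y)) \<le> e / 2" using B(1) by (simp add: norm_mult)
  qed (use e in simp)
  finally show ?thesis using e by simp
 qed
 then show "\<exists>no. \<forall>n\<ge>no. norm (conv g (F n) x - conv g f x) < e" by blast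
qed

text \<open>The index n stands for the (n + 1)-fold power, because the convolution algebra has in
  general no unit to serve as zeroth power. This is the source of the index
  \<open>Suc (i + j)\<close> in products.\<close>

primrec conv_pow :: "('a \<Rightarrow> complex) \<Rightarrow> nat \<Rightarrow> 'a \<Rightarrow> complex" where
 "conv_pow h 0 = h"
| "conv_pow h (Suc n) = conv h (conv_pow h n)"

lemma hermitian_conv_pow: "hermitian h \<Longrightarrow> hermitian (conv_pow h n)"
 by (induct n) (auto intro: hermitian_conv)

lemma conv_conv_pow:
 assumes "hermitian h"
 shows "conv (conv_pow h i) (conv_pow h j) = conv_pow h (Suc (i + j))"
proof (induct i)
 case (Suc i)
 note c = hermitian_cont[OF assms] hermitian_cont[OF hermitian_conv_pow[OF assms]]
 show ?case using conv_assoc[OF c(1) c(2) c(2), of i j] Suc by simp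
qed simp

lemma conv_pow_left_unit:
 assumes "hermitian h" "cont Q" "conv Q h = h"
 shows "conv Q (conv_pow h n) = conv_pow h n"
proof (cases n)
 case (Suc k)
 note c = hermitian_cont[OF assms(1)] hermitian_cont[OF hermitian_conv_pow[OF assms(1)]]
 show ?thesis using conv_assoc[OF assms(2) c(1) c(2), of k] Suc assms(3) by simp
qed (simp add: assms(3))

lemma l2_pos:
 assumes "cont f" "f \<noteq> (\<lambda>x. 0)"
 shows "l2 f > 0"
 using l2_nonneg[of f] l2_eq_0[OF assms(1)] assms(2) by (metis less_le)

lemma l2_conv_pow:
 assumes "hermitian h"
 shows "complex_of_real (l2 (conv_pow h n)) = conv_pow h (Suc (n + n)) 0"
 using conv_self_zero[OF hermitian_conv_pow[OF assms]] conv_conv_pow[OF assms] by metis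

text \<open>A self-adjoint element is not nilpotent: once a power vanishes all later ones do, but
  the squared norm of power n is the value at 0 of the power with index 2 n + 1.\<close>

lemma l2_conv_pow_pos:
 assumes h: "hermitian h" "h \<noteq> (\<lambda>x. 0)"
 shows "l2 (conv_pow h n) > 0"
proof (induct n)
 case 0
 then show ?case using l2_pos[OF hermitian_cont[OF h(1)] h(2)] by simp
next
 case (Suc n)
 have "conv_pow h (Suc n) \<noteq> (\<lambda>x. 0)"
 proof
  assume z: "conv_pow h (Suc n) = (\<lambda>x. 0)"
  have "conv_pow h (Suc n + j) = (\<lambda>x. 0)" for j
   by (induct j) (use z in \<open>simp_all add: conv_zero_right\<close>)
  from this[of n] l2_conv_pow[OF h(1), of n] Suc show False by simp
 qed
 then show ?case by (intro l2_pos hermitian_cont hermitian_conv_pow h)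
qed

text \<open>The squared norm of the middle power is a value at 0 that can be split unevenly, as the
  convolution of the two neighbouring powers, before Cauchy-Schwarz is applied.\<close>

lemma l2_conv_pow_logconvex:
 assumes h: "hermitian h"
 shows "(l2 (conv_pow h (Suc n)))\<^sup>2 \<le> l2 (conv_pow h n) * l2 (conv_pow h (Suc (Suc n)))"
proof -
 have "complex_of_real (l2 (conv_pow h (Suc n))) = conv (conv_pow h n) (conv_pow h (Suc (Suc n))) 0"
  unfolding conv_conv_pow[OF h] l2_conv_pow[OF h] by simp
 then have "norm (conv (conv_pow h n) (conv_pow h (Suc (Suc n))) 0) = \<bar>l2 (conv_pow h (Suc n))\<bar>"
  by (metis norm_of_real)
 then show ?thesis
  using conv_bound[OF hermitian_cont[OF hermitian_conv_pow[OF h]]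
    hermitian_cont[OF hermitian_conv_pow[OF h]], of n "Suc (Suc n)" 0] by (metis power2_abs)
qed

lemma norm_conv_self_le:
 assumes "cont f"
 shows "norm (conv f f x) \<le> l2 f"
 using conv_bound[OF assms assms, of x] l2_nonneg[of f]
 by (metis power2_eq_square power2_le_imp_le)

text \<open>The squared norm is split into two even powers evaluated at 0. An even power is bounded
  pointwise by the squared norm of its half, and the total mass is 1.\<close>

lemma l2_conv_pow_submult:
 assumes h: "hermitian h"
 shows "l2 (conv_pow h (Suc (i + j))) \<le> l2 (conv_pow h i) * l2 (conv_pow h j)"
proof -
 note c = hermitian_cont[OF hermitian_conv_pow[OF h]]
 have b: "norm (conv_pow h (Suc (n + n)) x) \<le> l2 (conv_pow h n)" for n x
  using norm_conv_self_le[OF c[of n], of x] unfolding conv_conv_pow[OF h] .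
 have "complex_of_real (l2 (conv_pow h (Suc (i + j))))
   = conv (conv_pow h (Suc (i + i))) (conv_pow h (Suc (j + j))) 0"
  unfolding conv_conv_pow[OF h] l2_conv_pow[OF h] by (simp add: algebra_simps)
 then have "l2 (conv_pow h (Suc (i + j))) \<le> norm (conv (conv_pow h (Suc (i + i))) (conv_pow h (Suc (j + j))) 0)"
  by (metis norm_of_real abs_ge_self)
 also have "\<dots> \<le> l2 (conv_pow h i) * l2 (conv_pow h j)"
  unfolding conv_def
 proof (rule integral_bound)
  show "norm (conv_pow h (Suc (i + i)) (0 - y) * conv_pow h (Suc (j + j)) y)
    \<le> l2 (conv_pow h i) * l2 (conv_pow h j)" for y
   unfolding norm_mult by (intro mult_mono b l2_nonneg norm_ge_zero)
 qed (simp add: l2_nonneg)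
 finally show ?thesis .
qed

text \<open>Power iteration: the powers of \<open>h * h\<close>, divided by the powers of the largest
 eigenvalue \<open>L\<close> of convolution with \<open>h * h\<close>, converge to the projection onto its eigenspace.\<close>

lemma top_eigenprojection:
 assumes h: "hermitian h" "h \<noteq> (\<lambda>x. 0)"
 shows "\<exists>P L. hermitian P \<and> P \<noteq> (\<lambda>x. 0) \<and> conv P P = P \<and> L > 0 \<and>
  conv (conv h h) P = (\<lambda>x. complex_of_real L * P x) \<and>
  (\<forall>Q. cont Q \<and> conv Q h = h \<longrightarrow> conv Q P = P)"
proof -
 note ch = hermitian_cont[OF h(1)]
 obtain L l where L: "L > 0" and lim: "(\<lambda>n. l2 (conv_pow h n) / L ^ Suc n) \<longlonglongrightarrow> l" and l: "l \<ge> 1"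
  using logconvex_normalization[of "\<lambda>n. l2 (conv_pow h n)", OF l2_conv_pow_pos[OF h]
   l2_conv_pow_logconvex[OF h(1)] l2_conv_pow_submult[OF h(1)]] by blast
 \<comment> \<open>\<open>conv_pow h (Suc (n + n))\<close> is the (n + 1)-fold power of h * h, so G
   n is the (n + 1)-fold power of h * h divided by L.\<close>
 define G where "G n = (\<lambda>x. complex_of_real (1 / L ^ Suc n) * conv_pow h (Suc (n + n)) x)" for n
 have hG: "hermitian (G n)" for n
  unfolding G_def by (intro hermitian_scale hermitian_conv_pow h)
 note cG = hermitian_cont[OF hG]
 have GG: "conv (G i) (G j) = G (Suc (i + j))" for i j
  unfolding G_def conv_scale_left conv_scale_right conv_conv_pow[OF h(1)]
  using L by (auto simp: field_simps power_add)
 define A where "A n = l2 (conv_pow h n) / L ^ Suc n" for n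
 have A: "A \<longlonglongrightarrow> l" using lim unfolding A_def[abs_def] .
 have G0: "G n 0 = complex_of_real (A n)" for n
  unfolding G_def A_def using l2_conv_pow[OF h(1), of n] by simp
 have l2G: "l2 (\<lambda>x. G i x - G j x) = A (Suc (i + i)) - 2 * A (Suc (i + j)) + A (Suc (j + j))" for i j
 proof -
  have "complex_of_real (l2 (\<lambda>x. G i x - G j x)) = conv (\<lambda>x. G i x - G j x) (\<lambda>x. G i x - G j x) 0"
   by (rule conv_self_zero[symmetric, OF hermitian_diff[OF hG hG]])
  also have "\<dots> = complex_of_real (A (Suc (i + i)) - 2 * A (Suc (i + j)) + A (Suc (j + j)))"
   unfolding conv_diff_left[OF continuous_on_diff[OF cG cG] cG cG] conv_diff_right[OF cG cG cG] GG G0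
   by (simp add: add.commute)
  finally show ?thesis by (simp only: of_real_eq_iff)
 qed
 have Cau: "\<exists>M. \<forall>i\<ge>M. \<forall>j\<ge>M. l2 (\<lambda>x. G i x - G j x) < e" if e: "e > 0" for e
 proof -
  have "e / 4 > 0" using e by simp
  from LIMSEQ_D[OF A this] obtain M where M: "\<And>n. n \<ge> M \<Longrightarrow> norm (A n - l) < e / 4" by blast
  have "l2 (\<lambda>x. G i x - G j x) < e" if "i \<ge> M" "j \<ge> M" for i j
   unfolding l2G using M[of "Suc (i + i)"] M[of "Suc (i + j)"] M[of "Suc (j + j)"] that
   by (simp add: abs_if split: if_splits)
  then show ?thesis by blast
 qed
 \<comment> \<open>The sequence G is Cauchy in L^2. One more convolution with G 0 makes it uniformly
   Cauchy and shifts the index by one.\<close>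
 have "uniformly_Cauchy_on UNIV (\<lambda>n. G (Suc n))"
 proof (rule uniformly_Cauchy_onI)
  fix e :: real assume e: "e > 0"
  have l0: "l2 (G 0) \<ge> 0" by (rule l2_nonneg)
  then have "e\<^sup>2 / (l2 (G 0) + 1) > 0" using e by simp
  from Cau[OF this] obtain M where M: "\<And>i j. i \<ge> M \<Longrightarrow> j \<ge> M \<Longrightarrow> l2 (\<lambda>x. G i x - G j x) < e\<^sup>2 / (l2 (G 0) + 1)" by blast
  have "dist (G (Suc i) x) (G (Suc j) x) < e" if ij: "i \<ge> M" "j \<ge> M" for i j x
  proof -
   have "G (Suc i) x - G (Suc j) x = conv (G 0) (\<lambda>x. G i x - G j x) x"
    unfolding conv_diff_right[OF cG cG cG] GG by simp
   then have "(norm (G (Suc i) x - G (Suc j) x))\<^sup>2 \<le> l2 (G 0) * l2 (\<lambda>x. G i x - G j x)"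
    using conv_bound[OF cG continuous_on_diff[OF cG cG], of 0 i j x] by simp
   also have "\<dots> \<le> l2 (G 0) * (e\<^sup>2 / (l2 (G 0) + 1))"
    by (intro mult_left_mono l0 less_imp_le M ij)
   also have "\<dots> < e\<^sup>2" using l0 e by (simp add: field_simps)
   finally show ?thesis unfolding dist_norm by (rule power2_less_imp_less) (use e in simp)
  qed
  then show "\<exists>M. \<forall>x\<in>UNIV. \<forall>i\<ge>M. \<forall>j\<ge>M. dist (G (Suc i) x) (G (Suc j) x) < e" by blast
 qed
 then obtain P where P: "uniform_limit UNIV (\<lambda>n. G (Suc n)) P sequentially"
  using Cauchy_uniformly_convergent unfolding uniformly_convergent_on_def by blast
 have cP: "cont P"
  by (rule uniform_limit_theorem[OF _ P]) (use cG in auto)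
 have pt: "(\<lambda>n. G (Suc n) x) \<longlonglongrightarrow> P x" for x by (rule tendsto_uniform_limitI[OF P]) simp
 have pt_shift: "(\<lambda>n. G (n + k) x) \<longlonglongrightarrow> P x" for k x
 proof -
  have "(\<lambda>n. G n x) \<longlonglongrightarrow> P x" using pt[of x] by (rule LIMSEQ_imp_Suc)
  then show ?thesis by (rule LIMSEQ_ignore_initial_segment)
 qed
 have hP: "hermitian P"
  unfolding hermitian_def
 proof (intro conjI allI cP)
  fix x
  have "(\<lambda>n. G (Suc n) (- x)) \<longlonglongrightarrow> cnj (P x)"
   using tendsto_cnj[OF pt[of x]] hG unfolding hermitian_def by simp
  then show "P (- x) = cnj (P x)" using pt[of "-x"] LIMSEQ_unique by blast
 qed
 have P0: "P 0 = complex_of_real l"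
 proof (rule LIMSEQ_unique[OF pt])
  show "(\<lambda>n. G (Suc n) 0) \<longlonglongrightarrow> complex_of_real l"
   unfolding G0 by (intro tendsto_of_real LIMSEQ_Suc[OF A])
 qed
 \<comment> \<open>The lower bound 1 for the limit of the normalized squared norms is what keeps the
   projection from vanishing.\<close>
 have nz: "P \<noteq> (\<lambda>x. 0)" using P0 l by auto
 have GP: "conv (G i) P = P" for i
 proof
  fix x
  have "(\<lambda>n. conv (G i) (G (Suc n)) x) \<longlonglongrightarrow> conv (G i) P x"
   by (rule conv_uniform_limit[OF P cG cP cG])
  moreover have "(\<lambda>n. conv (G i) (G (Suc n)) x) \<longlonglongrightarrow> P x"
   unfolding GG using pt_shift[of "Suc (Suc i)" x] by (simp add: add.commute)
  ultimately show "conv (G i) P x = P x" by (rule LIMSEQ_unique)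
 qed
 have PP: "conv P P = P"
 proof
  fix x
  have "(\<lambda>n. conv P (G (Suc n)) x) \<longlonglongrightarrow> conv P P x"
   by (rule conv_uniform_limit[OF P cG cP cP])
  then have "(\<lambda>n. P x) \<longlonglongrightarrow> conv P P x" unfolding conv_commute[OF cP cG] GP .
  then show "conv P P x = P x" using LIMSEQ_unique tendsto_const by blast
 qed
 have "conv h h = (\<lambda>x. complex_of_real L * G 0 x)"
  using L by (simp add: G_def)
 then have kP: "conv (conv h h) P = (\<lambda>x. complex_of_real L * P x)"
  by (simp add: conv_scale_left GP)
 \<comment> \<open>If Q is an idempotent whose range contains h, this places P in the range of Q,
   where minimality of Q can be applied to it.\<close>
 have QP: "conv Q P = P" if Q: "cont Q" "conv Q h = h" for Q
 proof
  fix x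
  have "conv Q (G n) = G n" for n
   unfolding G_def conv_scale_right conv_pow_left_unit[OF h(1) Q] ..
  then have "(\<lambda>n. G (Suc n) x) \<longlonglongrightarrow> conv Q P x"
   using conv_uniform_limit[OF P cG cP Q(1), of x] by simp
  then show "conv Q P x = P x" using pt LIMSEQ_unique by blast
 qed
 show ?thesis using hP nz PP L kP QP by blast
qed

end

section \<open>Separation of points by characters\<close>

lemma compact_Hausdorff_separating_function:
 fixes S T :: "'a::t2_space set"
 assumes "compact (UNIV :: 'a set)" "closed S" "closed T" "S \<inter> T = {}"
 shows "\<exists>f :: 'a \<Rightarrow> real. cont f \<and> (\<forall>x. 0 \<le> f x \<and> f x \<le> 1) \<and> (\<forall>x\<in>S. f x = 0) \<and> (\<forall>x\<in>T. f x = 1)"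
proof -
 have "Hausdorff_space (euclidean :: 'a topology)"
  unfolding Hausdorff_space_def disjnt_def using hausdorff by (simp add: conj_assoc) blast
 then have "normal_space (euclidean :: 'a topology)"
  using assms(1) by (intro compact_Hausdorff_or_regular_imp_normal_space) (simp_all add: compact_space_def)
 from Urysohn_lemma[OF this, of S T 0 1] assms obtain f where
  "continuous_map euclidean (top_of_set {0..1::real}) f" "f ` S \<subseteq> {0}" "f ` T \<subseteq> {1}"
  unfolding disjnt_def by auto
 then show ?thesis
  by (intro exI[of _ f]) (auto simp: continuous_map_in_subtopology)
qed

section \<open>Minimal idempotents of the convolution algebra\<close>

context compact_haar
begin

text \<open>Convolution with P is an orthogonal projection commuting with translations, and
  \<open>conv P Q = Q\<close> says that the range of Q lies in that of P.\<close>

definition idempotent :: "('a \<Rightarrow> complex) \<Rightarrow> bool"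
 where "idempotent P \<longleftrightarrow> hermitian P \<and> P \<noteq> (\<lambda>x. 0) \<and> conv P P = P"

lemma idempotent_at_0: "idempotent P \<Longrightarrow> P 0 = of_real (l2 P)"
 using conv_self_zero[of P] by (simp add: idempotent_def)

text \<open>P = P * P is bounded pointwise by l = \<open>l2 P\<close>; integrating its square over a
  space of mass 1 gives l <= l^2.\<close>

lemma l2_idempotent_ge_1:
 assumes "idempotent P"
 shows "l2 P \<ge> 1"
proof -
 have c: "cont P" and PP: "conv P P = P" and nz: "P \<noteq> (\<lambda>x. 0)"
  using assms hermitian_cont unfolding idempotent_def by blast+
 have b: "norm (P x) \<le> l2 P" for x using norm_conv_self_le[OF c, of x] PP by simp
 have "l2 P \<le> (\<integral>x. (l2 P)\<^sup>2 \<partial>m)"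
  unfolding l2_def[of P]
 proof (rule integral_mono)
  show "integrable m (\<lambda>x. (norm (P x))\<^sup>2)" by (intro integrable_cont continuous_intros c)
 qed (use b l2_nonneg[of P] in \<open>auto simp: l2_def[symmetric] intro!: power_mono\<close>)
 then have "l2 P * 1 \<le> l2 P * l2 P" by (simp add: prob_space[simplified] power2_eq_square)
 then show ?thesis using l2_pos[OF c nz] by (simp only: mult_le_cancel_left_pos)
qed

text \<open>Descent on the integer part of \<open>l2\<close>. If R is a proper subprojection of Q,
  then Q - R is an idempotent with \<open>l2\<close> equal to the difference, which is at least 1,
  so the integer part drops.\<close>

lemma minimal_idempotent:
 assumes P: "idempotent P"
 shows "\<exists>Q. idempotent Q \<and> conv P Q = Q \<and> (\<forall>R. idempotent R \<and> conv Q R = R \<longrightarrow> R = Q)"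
proof -
 have cP: "cont P" using P hermitian_cont unfolding idempotent_def by blast
 have "idempotent P \<and> conv P P = P" using P by (simp add: idempotent_def)
 from ex_has_least_nat[of "\<lambda>Q. idempotent Q \<and> conv P Q = Q", OF this, of "\<lambda>Q. nat \<lfloor>l2 Q\<rfloor>"]
 obtain Q where Q: "idempotent Q" "conv P Q = Q"
  and min: "\<And>R. idempotent R \<Longrightarrow> conv P R = R \<Longrightarrow> nat \<lfloor>l2 Q\<rfloor> \<le> nat \<lfloor>l2 R\<rfloor>" by blast
 have cQ: "cont Q" using Q hermitian_cont unfolding idempotent_def by blast
 have "R = Q" if R: "idempotent R" "conv Q R = R" for R
 proof (rule ccontr)
  assume ne: "R \<noteq> Q"
  have cR: "cont R" using R hermitian_cont unfolding idempotent_def by blast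
  have hD: "hermitian (\<lambda>x. Q x - R x)"
   using Q(1) R(1) by (auto simp: idempotent_def intro: hermitian_diff)
  have DD: "conv (\<lambda>x. Q x - R x) (\<lambda>x. Q x - R x) = (\<lambda>x. Q x - R x)"
   unfolding conv_diff_left[OF continuous_on_diff[OF cQ cR] cQ cR] conv_diff_right[OF cQ cQ cR]
    conv_diff_right[OF cR cQ cR] conv_commute[OF cR cQ] R(2)
   using Q(1) R(1) by (auto simp: idempotent_def)
  have D: "idempotent (\<lambda>x. Q x - R x)"
   unfolding idempotent_def using hD DD ne by (metis eq_iff_diff_eq_0 ext)
  have "complex_of_real (l2 (\<lambda>x. Q x - R x)) = complex_of_real (l2 Q - l2 R)"
   using idempotent_at_0[OF D] idempotent_at_0[OF Q(1)] idempotent_at_0[OF R(1)] by simp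
  then have "l2 Q - l2 R \<ge> 1" using l2_idempotent_ge_1[OF D] by (simp only: of_real_eq_iff)
  moreover have "conv P R = R" using conv_assoc[OF cP cQ cR] Q(2) R(2) by simp
  then have "nat \<lfloor>l2 Q\<rfloor> \<le> nat \<lfloor>l2 R\<rfloor>" using min R by blast
  ultimately show False using l2_idempotent_ge_1[OF R(1)] by linarith
 qed
 then show ?thesis using Q by blast
qed

text \<open>By minimality Q is the top eigenprojection of every nonzero hermitian u in its range, so
  u * u is a positive multiple of Q, the unit there. In particular u is not a zero divisor. For g
  with g * g = l^2 Q the product of g - l Q and g + l Q vanishes, so one factor is zero.\<close>

lemma minimal_idempotent_range:
 assumes Q: "idempotent Q" and min: "\<And>R. idempotent R \<Longrightarrow> conv Q R = R \<Longrightarrow> R = Q"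
  and g: "hermitian g" "conv Q g = g"
 shows "\<exists>c::real. g = (\<lambda>x. of_real c * Q x)"
proof (cases "g = (\<lambda>x. 0)")
 case True
 then show ?thesis by (intro exI[of _ 0]) simp
next
 case False
 have hQ: "hermitian Q" and QQ: "conv Q Q = Q" and cQ: "cont Q"
  using Q hermitian_cont unfolding idempotent_def by blast+
 have sq: "\<exists>L>0. conv u u = (\<lambda>x. complex_of_real L * Q x)"
  if u: "hermitian u" "conv Q u = u" "u \<noteq> (\<lambda>x. 0)" for u
 proof -
  obtain P L where P: "hermitian P" "P \<noteq> (\<lambda>x. 0)" "conv P P = P" "L > 0"
    "conv (conv u u) P = (\<lambda>x. complex_of_real L * P x)"
    "\<forall>R. cont R \<and> conv R u = u \<longrightarrow> conv R P = P"
   using top_eigenprojection[OF u(1,3)] by blast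
  have "P = Q" using min P cQ u(2) unfolding idempotent_def by blast
  have cu: "cont u" by (rule hermitian_cont[OF u(1)])
  have "conv (conv u u) Q = conv u u"
   unfolding conv_assoc[OF cu cu cQ] conv_commute[OF cu cQ] u(2) ..
  then show ?thesis using P \<open>P = Q\<close> by auto
 qed
 obtain L where L: "L > 0" "conv g g = (\<lambda>x. complex_of_real L * Q x)" using sq[OF g False] by blast
 define l where "l = sqrt L"
 have l: "l * l = L" using L(1) by (simp add: l_def)
 define u where "u = (\<lambda>x. g x - complex_of_real l * Q x)"
 define v where "v = (\<lambda>x. g x - complex_of_real (- l) * Q x)"
 have cg: "cont g" by (rule hermitian_cont[OF g(1)])
 have clQ: "cont (\<lambda>x. complex_of_real t * Q x)" for t
  by (intro continuous_intros cQ)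
 have hu: "hermitian (\<lambda>x. g x - complex_of_real t * Q x)" for t
  by (intro hermitian_diff hermitian_scale g hQ)
 have Qu: "conv Q (\<lambda>x. g x - complex_of_real t * Q x) = (\<lambda>x. g x - complex_of_real t * Q x)" for t
  unfolding conv_diff_right[OF cQ cg clQ] conv_scale_right g(2) QQ ..
 have cu: "cont u" unfolding u_def by (intro hermitian_cont hu)
 have cv: "cont v" unfolding v_def by (intro hermitian_cont hu)
 have Qv: "conv Q v = v" unfolding v_def by (rule Qu)
 have gQ: "conv g Q = g" unfolding conv_commute[OF cg cQ] g(2) ..
 have uv: "conv u v = (\<lambda>x. 0)"
  unfolding u_def conv_diff_left[OF cv cg clQ] conv_scale_left
  unfolding v_def Qu conv_diff_right[OF cg cg clQ] conv_scale_right L(2) gQ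
  using l by (auto simp: algebra_simps simp flip: of_real_mult)
 have "u = (\<lambda>x. 0) \<or> v = (\<lambda>x. 0)"
 proof (rule ccontr)
  assume "\<not> ?thesis"
  then have nz: "u \<noteq> (\<lambda>x. 0)" "v \<noteq> (\<lambda>x. 0)" by auto
  obtain M where M: "M > 0" "conv u u = (\<lambda>x. complex_of_real M * Q x)"
   using sq[of u] nz(1) hu Qu unfolding u_def by blast
  have "conv (conv u u) v = (\<lambda>x. 0)" unfolding conv_assoc[OF cu cu cv] uv by (rule conv_zero_right)
  moreover have "conv (conv u u) v = (\<lambda>x. complex_of_real M * v x)"
   unfolding M(2) conv_scale_left Qv ..
  ultimately show False using M(1) nz(2) by (auto simp: fun_eq_iff)
 qed
 then show ?thesis
 proof
  assume "u = (\<lambda>x. 0)"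
  then show ?thesis unfolding u_def by (intro exI[of _ l]) (auto simp: fun_eq_iff)
 next
  assume "v = (\<lambda>x. 0)"
  then show ?thesis unfolding v_def by (intro exI[of _ "- l"]) (auto simp: fun_eq_iff eq_neg_iff_add_eq_0)
 qed
qed

text \<open>The range of Q is stable under translation and one-dimensional, so translating Q
  multiplies it by a scalar. Evaluation at 0 identifies the scalar, and Q divided by its value at 0
  is multiplicative.\<close>

lemma minimal_idempotent_character:
 assumes Q: "idempotent Q" and min: "\<And>R. idempotent R \<Longrightarrow> conv Q R = R \<Longrightarrow> R = Q"
 shows "\<exists>\<psi>\<in>characters. Q = (\<lambda>x. of_real (l2 Q) * \<psi> x)"
proof -
 have hQ: "hermitian Q" and QQ: "conv Q Q = Q" and cQ: "cont Q"
  using Q hermitian_cont unfolding idempotent_def by blast+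
 have hQ': "Q (- x) = cnj (Q x)" for x using hQ unfolding hermitian_def by blast
 have lpos: "l2 Q > 0" using l2_idempotent_ge_1[OF Q] by simp
 have ex: "\<exists>c. \<forall>x. Q (x - a) = c * Q x" for a
 proof -
  define T where "T b = (\<lambda>x. Q (x - b))" for b
  have cT: "cont (T b)" for b
   unfolding T_def by (intro continuous_on_compose2[OF cQ] continuous_intros) auto
  have QT: "conv Q (T b) = T b" for b
  proof
   fix x
   have "conv Q (T b) x = conv (T b) Q x" by (simp add: conv_commute[OF cQ cT])
   also have "\<dots> = conv Q Q (x - b)" unfolding conv_def T_def by (simp add: algebra_simps)
   finally show "conv Q (T b) x = T b x" by (simp add: QQ T_def)
  qed
  have T': "T b (- x) = cnj (T (- b) x)" for b x
   unfolding T_def using hQ'[of "x + b"] by (simp add: minus_diff_commute[of x b] add.commute)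
  \<comment> \<open>A translate need not be hermitian, but g1 and g2 are, and twice the translate T
    a is g1 - \<i> g2.\<close>
  define g1 where "g1 = (\<lambda>x. T a x + T (- a) x)"
  define g2 where "g2 = (\<lambda>x. \<i> * (T a x - T (- a) x))"
  have h1: "hermitian g1" unfolding hermitian_def g1_def
   using cT by (auto intro!: continuous_on_add simp: T')
  have h2: "hermitian g2" unfolding hermitian_def g2_def
   using cT by (auto intro!: continuous_on_mult continuous_on_const continuous_on_diff simp: T' algebra_simps)
  have Q1: "conv Q g1 = g1" unfolding g1_def conv_add_right[OF cQ cT cT] QT ..
  have Q2: "conv Q g2 = g2" unfolding g2_def conv_scale_right conv_diff_right[OF cQ cT cT] QT ..
  obtain c1 where c1: "g1 = (\<lambda>x. complex_of_real c1 * Q x)"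
   using minimal_idempotent_range[OF Q min h1 Q1] by blast
  obtain c2 where c2: "g2 = (\<lambda>x. complex_of_real c2 * Q x)"
   using minimal_idempotent_range[OF Q min h2 Q2] by blast
  have "Q (x - a) = ((of_real c1 - \<i> * of_real c2) / 2) * Q x" for x
  proof -
   have "2 * T a x = g1 x - \<i> * g2 x" unfolding g1_def g2_def by (simp add: algebra_simps)
   then show ?thesis unfolding c1 c2 T_def by (simp add: field_simps)
  qed
  then show ?thesis by blast
 qed
 define \<psi> where "\<psi> x = Q x / of_real (l2 Q)" for x
 have Q0: "Q 0 = of_real (l2 Q)" by (rule idempotent_at_0[OF Q])
 have mult: "\<psi> (x + y) = \<psi> x * \<psi> y" for x y
 proof -
  obtain c where c: "\<And>x. Q (x - (- y)) = c * Q x" using ex[of "- y"] by blast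
  from c[of 0] have "c = \<psi> y" using lpos by (simp add: \<psi>_def Q0)
  then show ?thesis using c[of x] by (simp add: \<psi>_def)
 qed
 have "norm (\<psi> x) = 1" for x
 proof -
  have "\<psi> (- x) = cnj (\<psi> x)" by (simp add: \<psi>_def hQ')
  then have "complex_of_real ((norm (\<psi> x))\<^sup>2) = \<psi> (x + - x)"
   unfolding mult by (simp only: complex_norm_square)
  also have "\<dots> = 1" using lpos by (simp add: \<psi>_def Q0)
  finally have "(norm (\<psi> x))\<^sup>2 = 1" by (simp only: of_real_eq_1_iff)
  then show ?thesis by (simp add: power2_eq_1_iff) (smt (verit) norm_ge_zero)
 qed
 moreover have "cont \<psi>"
  unfolding \<psi>_def using lpos by (intro continuous_intros cQ) simp
 ultimately have "\<psi> \<in> characters" using mult by (simp add: characters_def)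
 moreover have "Q = (\<lambda>x. of_real (l2 Q) * \<psi> x)" using lpos by (auto simp: \<psi>_def)
 ultimately show ?thesis by blast
qed

text \<open>Below the top eigenprojection P of h * h lies a minimal idempotent Q, a multiple of a
  character. On the range of P convolution with h * h is multiplication by L > 0, so h cannot
  annihilate Q.\<close>

lemma hermitian_Fourier_coefficient:
 assumes h: "hermitian h" "h \<noteq> (\<lambda>x. 0)"
 shows "\<exists>\<psi>\<in>characters. conv h \<psi> \<noteq> (\<lambda>x. 0)"
proof -
 obtain P L where P: "hermitian P" "P \<noteq> (\<lambda>x. 0)" "conv P P = P" "L > 0"
  "conv (conv h h) P = (\<lambda>x. complex_of_real L * P x)"
  using top_eigenprojection[OF h] by blast
 have iP: "idempotent P" using P by (simp add: idempotent_def)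
 obtain Q where Q: "idempotent Q" "conv P Q = Q"
  and min: "\<And>R. idempotent R \<Longrightarrow> conv Q R = R \<Longrightarrow> R = Q"
  using minimal_idempotent[OF iP] by blast
 obtain \<psi> where \<psi>: "\<psi> \<in> characters" "Q = (\<lambda>x. of_real (l2 Q) * \<psi> x)"
  using minimal_idempotent_character[OF Q(1) min] by blast
 note ch = hermitian_cont[OF h(1)]
 note cP = hermitian_cont[OF P(1)]
 have cQ: "cont Q" using Q hermitian_cont unfolding idempotent_def by blast
 have "conv h \<psi> \<noteq> (\<lambda>x. 0)"
 proof
  assume z: "conv h \<psi> = (\<lambda>x. 0)"
  have "conv h Q = (\<lambda>x. 0)" by (subst \<psi>(2)) (simp add: conv_scale_right z)
  then have "conv (conv h h) Q = (\<lambda>x. 0)" unfolding conv_assoc[OF ch ch cQ] by (simp add: conv_zero_right)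
  moreover have "conv (conv h h) Q = (\<lambda>x. complex_of_real L * Q x)"
   using conv_assoc[OF continuous_conv[OF ch ch] cP cQ] unfolding Q(2) P(5) conv_scale_left by simp
  ultimately show False using P(4) Q(1) by (auto simp: fun_eq_iff idempotent_def)
 qed
 then show ?thesis using \<psi>(1) by blast
qed

text \<open>The test function \<open>2 f(x) - f(x - z) - f(x + z)\<close> is annihilated by convolution with every
 character that is trivial at \<open>z\<close>.\<close>

lemma characters_separate_zero:
 assumes z: "z \<noteq> (0::'a)"
 shows "\<exists>\<psi>\<in>characters. \<psi> z \<noteq> 1"
proof -
 obtain u :: "'a \<Rightarrow> real" where u: "cont u" "u z = 0" "u 0 = 1"
  using compact_Hausdorff_separating_function[OF compact_UNIV, of "{z}" "{0}"] z by auto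
 \<comment> \<open>Multiplying by the reflection makes f real and even, hence h hermitian, and keeps
   f 0 = 1 while f vanishes at both z and -z. Therefore h 0 = 2.\<close>
 define f where "f x = complex_of_real (u x * u (- x))" for x
 have cf: "cont f" unfolding f_def
  by (intro continuous_intros u(1) continuous_on_compose2[OF u(1)]) auto
 define T where "T a = (\<lambda>x. f (x - a))" for a
 have cT: "cont (T b)" for b
  unfolding T_def by (intro continuous_on_compose2[OF cf] continuous_intros) auto
 have c2f: "cont (\<lambda>x. 2 * f x)" by (intro continuous_intros cf)
 define h where "h = (\<lambda>x. 2 * f x - (T z x + T (- z) x))"
 have ch: "cont h" unfolding h_def by (intro continuous_intros c2f cT)
 have ff: "f (- x) = f x" for x by (simp add: f_def mult.commute)
 have rf: "cnj (f x) = f x" for x by (simp add: f_def)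
 have fz: "f z = 0" "f (- z) = 0" "f 0 = 1" using u by (auto simp: f_def)
 have "h (- x) = cnj (h x)" for x
  using ff[of "x + z"] ff[of "x - z"]
  by (simp add: h_def T_def rf ff minus_diff_commute[of x z] add.commute)
 then have hh: "hermitian h" using ch by (simp add: hermitian_def)
 have "h 0 \<noteq> 0" by (simp add: h_def T_def fz)
 then have "h \<noteq> (\<lambda>x. 0)" by auto
 from hermitian_Fourier_coefficient[OF hh this] obtain \<psi>
  where \<psi>: "\<psi> \<in> characters" "conv h \<psi> \<noteq> (\<lambda>x. 0)" by blast
 have c\<psi>: "cont \<psi>" and m\<psi>: "\<And>x y. \<psi> (x + y) = \<psi> x * \<psi> y" and n\<psi>: "\<And>x. norm (\<psi> x) = 1"
  using \<psi>(1) by (auto simp: characters_def)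
 have "\<psi> z \<noteq> 1"
 proof
  assume 1: "\<psi> z = 1"
  have "\<psi> 0 = \<psi> 0 * \<psi> 0" using m\<psi>[of 0 0] by simp
  moreover have "\<psi> 0 \<noteq> 0" using n\<psi>[of 0] by auto
  ultimately have "\<psi> 0 = 1" by simp
  then have 2: "\<psi> (- z) = 1" using m\<psi>[of z "- z"] 1 by simp
  have T: "conv (T a) \<psi> = conv f \<psi>" if "\<psi> (- a) = 1" for a
  proof
   fix x
   have "conv (T a) \<psi> x = conv f \<psi> (x - a)" unfolding conv_def T_def by (simp add: algebra_simps)
   also have "\<dots> = conv \<psi> f (- a + x)" by (simp add: conv_commute[OF cf c\<psi>])
   also have "\<dots> = conv \<psi> f x" unfolding conv_def add_diff_eq[symmetric] m\<psi>[of "- a"] that by simp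
   finally show "conv (T a) \<psi> x = conv f \<psi> x" by (simp add: conv_commute[OF cf c\<psi>])
  qed
  have cTT: "cont (\<lambda>x. T z x + T (- z) x)" by (intro continuous_intros cT)
  have "conv h \<psi> = (\<lambda>x. 2 * conv f \<psi> x - conv (\<lambda>x. T z x + T (- z) x) \<psi> x)"
   unfolding h_def conv_diff_left[OF c\<psi> c2f cTT] conv_scale_left ..
  also have "conv (\<lambda>x. T z x + T (- z) x) \<psi> = (\<lambda>x. conv f \<psi> x + conv f \<psi> x)"
   unfolding conv_commute[OF cTT c\<psi>] conv_add_right[OF c\<psi> cT cT]
   unfolding conv_commute[OF c\<psi> cT] using 1 2 by (simp add: T)
  finally show False using \<psi>(2) by (simp add: fun_eq_iff)
 qed
 then show ?thesis using \<psi>(1) by blast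
qed

lemma characters_separate:
 assumes "x \<noteq> (y::'a)"
 shows "\<exists>\<psi>\<in>characters. \<psi> x \<noteq> \<psi> y"
proof -
 obtain \<psi> where \<psi>: "\<psi> \<in> characters" "\<psi> (x - y) \<noteq> 1" using characters_separate_zero[of "x - y"] assms by auto
 then have "\<psi> x = \<psi> (x - y) * \<psi> y" and "norm (\<psi> y) = 1"
  unfolding characters_def by (metis (mono_tags, lifting) diff_add_cancel mem_Collect_eq)+
 then have "\<psi> x \<noteq> \<psi> y" using \<psi>(2) by auto
 then show ?thesis using \<psi>(1) by blast
qed

end

section \<open>Trigonometric polynomials and invariance of the Haar measure\<close>

lemma character_const_1: "(\<lambda>x. 1) \<in> characters"
 by (simp add: characters_def)

lemma character_mult: "f \<in> characters \<Longrightarrow> g \<in> characters \<Longrightarrow> (\<lambda>x. f x * g x) \<in> characters"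
 by (auto simp: characters_def norm_mult intro: continuous_on_mult)

lemma character_cnj: "f \<in> characters \<Longrightarrow> (\<lambda>x. cnj (f x)) \<in> characters"
 by (auto simp: characters_def intro: continuous_on_cnj)

lemma character_prod:
 "(\<And>i. i \<in> I \<Longrightarrow> f i \<in> characters) \<Longrightarrow> (\<lambda>x. \<Prod>i\<in>I. f i x) \<in> characters"
proof (induct I rule: infinite_finite_induct)
 case (insert i I)
 then show ?case using character_mult[of "f i"] by simp
qed (simp_all add: character_const_1)

lemma character_comp: "f \<in> characters \<Longrightarrow> epimorphism g \<Longrightarrow> (\<lambda>x. f (g x)) \<in> characters"
 by (auto simp: characters_def epimorphism_def intro: continuous_on_compose2)

lemma character_nonzero: "f \<in> characters \<Longrightarrow> f x \<noteq> 0"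
 unfolding characters_def by (metis (mono_tags, lifting) mem_Collect_eq norm_zero zero_neq_one)

lemma epi_funpow: "epimorphism g \<Longrightarrow> epimorphism (g ^^ n)"
proof (induct n)
 case 0
 then show ?case by (simp add: epimorphism_def continuous_on_id)
next
 case (Suc n)
 then have g: "epimorphism g" and h: "epimorphism (g ^^ n)" by auto
 from g h have c: "cont g" "cont (g ^^ n)" and s: "surj g" "surj (g ^^ n)"
  unfolding epimorphism_def by auto
 have "cont (\<lambda>x. g ((g ^^ n) x))" by (rule continuous_on_compose2[OF c]) simp
 moreover have "surj (\<lambda>x. g ((g ^^ n) x))" using comp_surj[OF s(2,1)] by (simp add: o_def)
 ultimately show ?case using g h by (simp add: epimorphism_def o_def)
qed

text \<open>There is no clause for 0, which arises only as a zero multiple of an element; hence the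
  nonemptiness assumption in \<open>lspan_sum\<close>.\<close>

inductive_set lspan :: "('b \<Rightarrow> complex) set \<Rightarrow> ('b \<Rightarrow> complex) set" for D where
 base: "f \<in> D \<Longrightarrow> (\<lambda>x. c * f x) \<in> lspan D"
| add: "f \<in> lspan D \<Longrightarrow> g \<in> lspan D \<Longrightarrow> (\<lambda>x. f x + g x) \<in> lspan D"

lemma lspan_scale: "f \<in> lspan D \<Longrightarrow> (\<lambda>x. c * f x) \<in> lspan D"
proof (induct rule: lspan.induct)
 case (base f b)
 then show ?case using lspan.base[of f D "c * b"] by (simp add: mult.assoc)
next
 case (add f g)
 then show ?case using lspan.add[OF add(2,4)] by (simp add: distrib_left)
qed

lemma lspan_sum:
 assumes "D \<noteq> {}" "\<And>i. i \<in> I \<Longrightarrow> f i \<in> lspan D"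
 shows "(\<lambda>x. \<Sum>i\<in>I. f i x) \<in> lspan D"
 using assms(2)
proof (induct I rule: infinite_finite_induct)
 case (insert i I)
 then show ?case using lspan.add[of "f i" D] by simp
qed (use lspan.base[of _ D 0] assms(1) in auto)

lemma lspan_mult:
 assumes D: "\<And>f g. f \<in> D \<Longrightarrow> g \<in> D \<Longrightarrow> (\<lambda>x. f x * g x) \<in> D"
  and "f \<in> lspan D" "g \<in> lspan D"
 shows "(\<lambda>x. f x * g x) \<in> lspan D"
 using assms(2)
proof (induct rule: lspan.induct)
 case (base f c)
 have "(\<lambda>x. f x * g x) \<in> lspan D" using assms(3)
 proof (induct rule: lspan.induct)
  case (base g b)
  then show ?case using lspan.base[OF D[OF \<open>f \<in> D\<close> base(1)], of b] by (simp add: mult.left_commute)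
 next
  case (add g h)
  then show ?case using lspan.add[OF add(2,4)] by (simp add: distrib_left)
 qed
 from lspan_scale[OF this, of c] show ?case by (simp add: mult.assoc)
next
 case (add f h)
 then show ?case using lspan.add[OF add(2,4)] by (simp add: distrib_right)
qed

context compact_haar
begin

abbreviation trig where "trig \<equiv> lspan (characters :: ('a \<Rightarrow> complex) set)"

lemma continuous_trig: "f \<in> trig \<Longrightarrow> cont f"
 by (induct rule: lspan.induct) (auto simp: characters_def intro: continuous_on_add continuous_on_mult_left)

lemma trig_mult: "f \<in> trig \<Longrightarrow> g \<in> trig \<Longrightarrow> (\<lambda>x. f x * g x) \<in> trig"
 by (rule lspan_mult[OF character_mult])

text \<open>The real Stone-Weierstrass theorem is applied to the real functions that lie in
  \<open>trig\<close> as complex functions. Conjugates of characters are characters, so these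
  include the real and imaginary parts of characters, which separate points.\<close>

lemma trig_dense:
 fixes f :: "'a \<Rightarrow> real"
 assumes "cont f" "e > 0"
 shows "\<exists>g\<in>trig. \<forall>x. norm (of_real (f x) - g x) < e"
proof -
 have "\<exists>g. (\<lambda>x. complex_of_real (g x)) \<in> trig \<and> (\<forall>x\<in>UNIV. \<bar>f x - g x\<bar> < e)"
 proof (rule Stone_Weierstrass_HOL[OF compact_UNIV _ _ _ _ _ assms])
  fix c :: real show "(\<lambda>x. complex_of_real c) \<in> trig"
   using lspan.base[OF character_const_1, of "complex_of_real c"] by simp
 next
  fix g :: "'a \<Rightarrow> real" assume "(\<lambda>x. complex_of_real (g x)) \<in> trig"
  from continuous_on_Re[OF continuous_trig[OF this]] show "cont g" by simp
 next
  fix f g :: "'a \<Rightarrow> real"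
  assume "(\<lambda>x. complex_of_real (f x)) \<in> trig \<and> (\<lambda>x. complex_of_real (g x)) \<in> trig"
  then show "(\<lambda>x. complex_of_real (f x + g x)) \<in> trig" "(\<lambda>x. complex_of_real (f x * g x)) \<in> trig"
   using lspan.add[of "\<lambda>x. complex_of_real (f x)" characters] trig_mult[of "\<lambda>x. complex_of_real (f x)"] by auto
 next
  fix x y :: 'a assume "x \<in> UNIV \<and> y \<in> UNIV \<and> x \<noteq> y"
  then obtain \<psi> where \<psi>: "\<psi> \<in> characters" "\<psi> x \<noteq> \<psi> y" using characters_separate by blast
  have 1: "(\<lambda>x. (1/2) * \<psi> x + (1/2) * cnj (\<psi> x)) \<in> trig"
   by (intro lspan.intros \<psi>(1) character_cnj)
  have 2: "(\<lambda>x. (- \<i>/2) * \<psi> x + (\<i>/2) * cnj (\<psi> x)) \<in> trig"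
   by (intro lspan.intros \<psi>(1) character_cnj)
  have "(\<lambda>x. (1/2) * \<psi> x + (1/2) * cnj (\<psi> x)) = (\<lambda>x. complex_of_real (Re (\<psi> x)))"
   by (auto simp: complex_eq_iff)
  moreover have "(\<lambda>x. (- \<i>/2) * \<psi> x + (\<i>/2) * cnj (\<psi> x)) = (\<lambda>x. complex_of_real (Im (\<psi> x)))"
   by (auto simp: complex_eq_iff)
  ultimately show "\<exists>f. (\<lambda>x. complex_of_real (f x)) \<in> trig \<and> f x \<noteq> f y"
   using 1 2 \<psi>(2) by (metis complex_eq_iff)
 qed
 then obtain g where g: "(\<lambda>x. complex_of_real (g x)) \<in> trig" "\<And>x. \<bar>f x - g x\<bar> < e" by blast
 show ?thesis by (rule bexI[OF _ g(1)]) (use g(2) in \<open>simp flip: of_real_diff\<close>)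
qed

text \<open>Translation by a point a multiplies the integral by the value of the character at a,
  which forces 0 as soon as one value differs from 1.\<close>

lemma integral_character:
 assumes "\<psi> \<in> characters"
 shows "mean \<psi> = (if \<forall>x. \<psi> x = 1 then 1 else 0)"
proof (cases "\<forall>x. \<psi> x = 1")
 case True
 then have "\<psi> = (\<lambda>x. 1)" by auto
 then show ?thesis by (simp add: prob_space[simplified])
next
 case False
 then obtain a where a: "\<psi> a \<noteq> 1" by blast
 have c: "cont \<psi>" using assms by (simp add: characters_def)
 have "mean \<psi> = (\<integral>x. \<psi> (a + x) \<partial>m)"
  using integral_translation[OF borel_measurable_continuous_onI[OF c]] by simp
 also have "\<dots> = \<psi> a * mean \<psi>" using assms by (simp add: characters_def)
 finally show ?thesis using a False by auto
qed

text \<open>Surjectivity is the point: a character is trivial exactly when its composition with g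
  is, and integrals of characters see nothing else.\<close>

lemma integral_epimorphism_trig:
 assumes "epimorphism g" "f \<in> trig"
 shows "(\<integral>x. f (g x) \<partial>m) = mean f"
 using assms(2)
proof (induct rule: lspan.induct)
 case (base f c)
 have "(\<forall>x. f (g x) = 1) \<longleftrightarrow> (\<forall>x. f x = 1)"
  using assms(1) unfolding epimorphism_def surj_def by metis
 then show ?case
  using integral_character[OF character_comp[OF base assms(1)]] integral_character[OF base] by simp
next
 case (add f h)
 have cg: "cont g" using assms(1) by (simp add: epimorphism_def)
 note c = continuous_trig[OF add(1)] continuous_trig[OF add(3)]
 have i: "integrable m (\<lambda>x. f (g x))" "integrable m (\<lambda>x. h (g x))"
  by (rule integrable_cont; rule continuous_on_compose2[OF c(1) cg] continuous_on_compose2[OF c(2) cg]; simp)+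
 show ?case
  using add(2,4) by (simp add: Bochner_Integration.integral_add[OF i]
    Bochner_Integration.integral_add[OF integrable_cont[OF c(1)] integrable_cont[OF c(2)]])
qed

lemma integral_epimorphism:
 fixes f :: "'a \<Rightarrow> real"
 assumes g: "epimorphism g" and f: "cont f"
 shows "(\<integral>x. f (g x) \<partial>m) = mean f"
proof -
 have cg: "cont g" using g by (simp add: epimorphism_def)
 have cf: "cont (\<lambda>x. complex_of_real (f x))" by (intro continuous_intros f)
 have "norm ((\<integral>x. complex_of_real (f (g x)) \<partial>m) - (\<integral>x. complex_of_real (f x) \<partial>m)) \<le> 2 * e" if e: "e > 0" for e
 proof -
  obtain h where h: "h \<in> trig" "\<And>x. norm (of_real (f x) - h x) < e" using trig_dense[OF f e] by blast
  note ch = continuous_trig[OF h(1)]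
  have i1: "integrable m (\<lambda>x. complex_of_real (f (g x)))"
   by (rule integrable_cont[OF continuous_on_compose2[OF cf cg]]) simp
  have i2: "integrable m (\<lambda>x. h (g x))"
   by (rule integrable_cont[OF continuous_on_compose2[OF ch cg]]) simp
  note i3 = integrable_cont[OF cf] and i4 = integrable_cont[OF ch]
  have 1: "norm ((\<integral>x. complex_of_real (f (g x)) \<partial>m) - (\<integral>x. h (g x) \<partial>m)) \<le> e"
   unfolding Bochner_Integration.integral_diff[OF i1 i2, symmetric]
   by (rule integral_bound) (use h(2) e in \<open>auto intro: less_imp_le\<close>)
  have 2: "norm ((\<integral>x. complex_of_real (f x) \<partial>m) - mean h) \<le> e"
   unfolding Bochner_Integration.integral_diff[OF i3 i4, symmetric]
   by (rule integral_bound) (use h(2) e in \<open>auto intro: less_imp_le\<close>)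
  show ?thesis
   using norm_triangle_ineq4[of "(\<integral>x. complex_of_real (f (g x)) \<partial>m) - (\<integral>x. h (g x) \<partial>m)"
     "(\<integral>x. complex_of_real (f x) \<partial>m) - mean h"] 1 2
    integral_epimorphism_trig[OF g h(1)] by simp
 qed
 then have "norm ((\<integral>x. complex_of_real (f (g x)) \<partial>m) - (\<integral>x. complex_of_real (f x) \<partial>m)) \<le> 0 + e" if "e > 0" for e
  using that half_gt_zero[OF that] by fastforce
 then have "norm ((\<integral>x. complex_of_real (f (g x)) \<partial>m) - (\<integral>x. complex_of_real (f x) \<partial>m)) \<le> 0"
  by (rule field_le_epsilon)
 then show ?thesis unfolding integral_complex_of_real by simp
qed

lemma separating_open_compact:
 assumes K: "compact (K :: 'a set)" and U: "open U" "K \<subseteq> U"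
 shows "\<exists>f :: 'a \<Rightarrow> real. cont f \<and> (\<forall>x. indicator K x \<le> f x \<and> f x \<le> indicator U x)"
proof -
 have "closed (- U)" "closed K" "- U \<inter> K = {}" using U compact_imp_closed[OF K] by auto
 from compact_Hausdorff_separating_function[OF compact_UNIV this] obtain f :: "'a \<Rightarrow> real"
  where f: "cont f" "\<forall>x. 0 \<le> f x \<and> f x \<le> 1" "\<forall>x\<in>-U. f x = 0" "\<forall>x\<in>K. f x = 1" by blast
 have "indicator K x \<le> f x \<and> f x \<le> indicator U x" for x using f(2-4) U(2) by (auto simp: indicator_def)
 then show ?thesis using f(1) by blast
qed

text \<open>Urysohn functions and outer regularity give "at most" for preimages of compact sets, and
  complements give "at least" for open sets. The latter is carried to compact sets by outer
  regularity of the preimage and then to Borel sets by inner regularity; complements yield the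
  opposite inequality.\<close>

lemma emeasure_epi_vimage:
 assumes g: "epimorphism g" and A: "A \<in> sets borel"
 shows "emeasure m (g -` A) = emeasure m A"
proof -
 have cg: "cont g" using g by (simp add: epimorphism_def)
 have mg: "g -` A \<in> sets borel" if "A \<in> sets borel" for A
  using measurable_sets[OF borel_measurable_continuous_onI[OF cg] that] by simp
 have le: "emeasure m (g -` K) \<le> emeasure m K" if K: "compact K" for K
 proof -
  have Kb: "K \<in> sets borel" by (rule borel_closed[OF compact_imp_closed[OF K]])
  have "emeasure m (g -` K) \<le> emeasure m U" if U: "open U" "K \<subseteq> U" for U
  proof -
   obtain f :: "'a \<Rightarrow> real" where f: "cont f" "\<And>x. indicator K x \<le> f x" "\<And>x. f x \<le> indicator U x"
    using separating_open_compact[OF K U] by blast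
   have "measure m (g -` K) = (\<integral>x. indicator (g -` K) x \<partial>m)" by simp
   also have "\<dots> \<le> (\<integral>x. f (g x) \<partial>m)"
   proof (rule integral_mono)
    show "integrable m (indicator (g -` K) :: 'a \<Rightarrow> real)"
     using mg[OF Kb] by (simp add: integrable_indicator_iff less_top[symmetric])
    show "integrable m (\<lambda>x. f (g x))"
     by (rule integrable_cont[OF continuous_on_compose2[OF f(1) cg]]) simp
    show "indicator (g -` K) x \<le> f (g x)" for x using f(2)[of "g x"] by (simp add: indicator_def)
   qed
   also have "\<dots> = mean f" by (rule integral_epimorphism[OF g f(1)])
   also have "\<dots> \<le> (\<integral>x. indicator U x \<partial>m)"
   proof (rule integral_mono)
    show "integrable m (indicator U :: 'a \<Rightarrow> real)"
     using U(1) by (simp add: integrable_indicator_iff less_top[symmetric])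
   qed (use f in \<open>auto intro: integrable_cont\<close>)
   also have "\<dots> = measure m U" by simp
   finally show ?thesis by (simp add: emeasure_eq_measure)
  qed
  then show ?thesis unfolding outer_regular[OF Kb] by (intro INF_greatest) blast
 qed
 have compl: "emeasure m (- B) \<le> emeasure m (- C)"
  if "emeasure m C \<le> emeasure m B" "B \<in> sets borel" "C \<in> sets borel" for B C
  using prob_compl[of B] prob_compl[of C] that by (simp add: Compl_eq_Diff_UNIV emeasure_eq_measure)
 have ge_open: "emeasure m U \<le> emeasure m (g -` U)" if U: "open U" for U
 proof -
  have "compact (- U)" using compact_UNIV closed_Compl[OF U] compact_Int_closed[of UNIV "- U"] by simp
  from compl[OF le[OF this]] U show ?thesis using mg[of "- U"] by (simp add: vimage_Compl)
 qed
 have ge_compact: "emeasure m K \<le> emeasure m (g -` K)" if K: "compact K" for K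
 proof -
  have Kb: "K \<in> sets borel" by (rule borel_closed[OF compact_imp_closed[OF K]])
  have "emeasure m K \<le> emeasure m V" if V: "open V" "g -` K \<subseteq> V" for V
  proof -
   \<comment> \<open>g maps closed sets to closed sets, so V contains the full preimage of this open
     neighbourhood of K.\<close>
   define U where "U = - (g ` (- V))"
   have "compact (- V)" using compact_UNIV closed_Compl[OF V(1)] compact_Int_closed[of UNIV "- V"] by simp
   then have "compact (g ` (- V))" by (rule compact_continuous_image[OF continuous_on_subset[OF cg subset_UNIV]])
   then have "open U" unfolding U_def by (intro open_Compl compact_imp_closed)
   moreover have "K \<subseteq> U" "g -` U \<subseteq> V" using V(2) unfolding U_def by auto
   ultimately have "emeasure m K \<le> emeasure m U" "emeasure m U \<le> emeasure m (g -` U)" "emeasure m (g -` U) \<le> emeasure m V"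
    using V(1) by (auto intro!: emeasure_mono ge_open)
   then show ?thesis by (meson order_trans)
  qed
  then show ?thesis unfolding outer_regular[OF mg[OF Kb]] by (intro INF_greatest) blast
 qed
 have ge: "emeasure m A \<le> emeasure m (g -` A)" if A: "A \<in> sets borel" for A
  unfolding inner_regular[OF A]
 proof (intro SUP_least)
  fix K assume "K \<in> {K. compact K \<and> K \<subseteq> A}"
  then have K: "compact K" "K \<subseteq> A" by auto
  have "emeasure m (g -` K) \<le> emeasure m (g -` A)" using K(2) mg[OF A] by (intro emeasure_mono) auto
  then show "emeasure m K \<le> emeasure m (g -` A)" using ge_compact[OF K(1)] by (rule order_trans[rotated])
 qed
 have "emeasure m (- A) \<le> emeasure m (g -` (- A))" by (rule ge) (use A in auto)
 from compl[OF this] have "emeasure m (g -` A) \<le> emeasure m A"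
  using A mg[of "- A"] by (simp add: vimage_Compl)
 with ge[OF A] show ?thesis by (rule antisym[rotated])
qed

lemma epimorphism_measurable: "epimorphism g \<Longrightarrow> g \<in> measurable m m"
 by (simp add: epimorphism_def measurable_cong_sets[OF sets_m sets_m] borel_measurable_continuous_onI)

lemma distr_epimorphism:
 assumes "epimorphism g"
 shows "distr m m g = m"
proof (rule measure_eqI)
 fix A assume "A \<in> sets (distr m m g)"
 then show "emeasure (distr m m g) A = emeasure m A"
  using emeasure_epi_vimage[OF assms, of A]
  by (subst emeasure_distr[OF epimorphism_measurable[OF assms]]) auto
qed simp

lemma integral_epimorphism_borel:
 fixes f :: "'a \<Rightarrow> 'b::{banach,second_countable_topology}"
 assumes "epimorphism g" "f \<in> borel_measurable m"
 shows "(\<integral>x. f (g x) \<partial>m) = mean f"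
 using integral_distr[OF epimorphism_measurable[OF assms(1)] assms(2)] distr_epimorphism[OF assms(1)] by simp

abbreviation L1_dist :: "('a \<Rightarrow> complex) \<Rightarrow> ('a \<Rightarrow> complex) \<Rightarrow> real" where
 "L1_dist f g \<equiv> \<integral>x. norm (f x - g x) \<partial>m"

text \<open>Regularity encloses A between a compact K and an open U of nearly equal measure. A
  Urysohn function between their indicators differs from that of A only on U - K, and is then
  approximated uniformly.\<close>

lemma indicator_approx_trig:
 assumes A: "A \<in> sets borel" and e: "e > 0"
 shows "\<exists>g\<in>trig. L1_dist (indicator A) g < e"
proof -
 have e2: "e/4 > 0" using e by simp
 obtain U where U: "open U" "A \<subseteq> U" "measure m U < measure m A + e/4"
 proof -
  have "(INF U\<in>{U. open U \<and> A \<subseteq> U}. emeasure m U) < ennreal (measure m A + e/4)"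
   unfolding outer_regular[OF A, symmetric] unfolding emeasure_eq_measure
   by (rule ennreal_lessI) (use e2 measure_nonneg[of m A] in linarith)+
  then obtain U where "open U" "A \<subseteq> U" "emeasure m U < ennreal (measure m A + e/4)" unfolding INF_less_iff by blast
  then show thesis using that unfolding emeasure_eq_measure ennreal_less_iff[OF measure_nonneg] by blast
 qed
 \<comment> \<open>\<open>ennreal\<close> truncates negative reals to 0, so the strict comparison is
   made only for a nonnegative bound; otherwise the empty set serves.\<close>
 have "\<exists>K. compact K \<and> K \<subseteq> A \<and> measure m A - e/4 < measure m K"
 proof (cases "measure m A - e/4 < 0")
  case True
  then show ?thesis by (intro exI[of _ "{}"]) auto
 next
  case False
  have "ennreal (measure m A - e/4) < (SUP K\<in>{K. compact K \<and> K \<subseteq> A}. emeasure m K)"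
   unfolding inner_regular[OF A, symmetric] unfolding emeasure_eq_measure
   by (subst ennreal_less_iff) (use e2 False in linarith)+
  then obtain K where "compact K" "K \<subseteq> A" "ennreal (measure m A - e/4) < emeasure m K" unfolding less_SUP_iff by blast
  moreover have "0 \<le> measure m A - e/4" using False by simp
  ultimately show ?thesis unfolding emeasure_eq_measure by (metis ennreal_less_iff)
 qed
 then obtain K where K: "compact K" "K \<subseteq> A" "measure m A - e/4 < measure m K" by blast
 have Kb: "K \<in> sets borel" by (rule borel_closed[OF compact_imp_closed[OF K(1)]])
 have "K \<subseteq> U" using K U by blast
 from separating_open_compact[OF K(1) U(1) this] obtain f :: "'a \<Rightarrow> real"
  where f: "cont f" "\<And>x. indicator K x \<le> f x" "\<And>x. f x \<le> indicator U x" by blast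
 obtain g where g: "g \<in> trig" "\<And>x. norm (of_real (f x) - g x) < e/4" using trig_dense[OF f(1) e2] by blast
 have UK: "U - K \<in> sets borel" using U(1) Kb by auto
 have iUK: "integrable m (indicator (U - K) :: 'a \<Rightarrow> real)"
  using UK by (simp add: integrable_indicator_iff less_top[symmetric])
 have "norm (indicator A x - g x) \<le> indicator (U - K) x + e/4" for x
 proof -
  have "norm (indicator A x - g x) \<le> norm (indicator A x - complex_of_real (f x)) + norm (of_real (f x) - g x)"
   using norm_triangle_ineq[of "indicator A x - complex_of_real (f x)" "of_real (f x) - g x"] by simp
  moreover have "norm (indicator A x - complex_of_real (f x)) = \<bar>indicator A x - f x\<bar>"
  proof -
   have "indicator A x - complex_of_real (f x) = complex_of_real (indicator A x - f x)"
    by (simp add: indicator_def)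
   then show ?thesis by (simp only: norm_of_real)
  qed
  moreover have "\<bar>indicator A x - f x\<bar> \<le> indicator (U - K) x"
   using f(2)[of x] f(3)[of x] K(2) U(2) by (cases "x \<in> K"; cases "x \<in> A"; cases "x \<in> U") auto
  ultimately show ?thesis using g(2)[of x] by linarith
 qed
 then have "L1_dist (indicator A) g \<le> (\<integral>x. indicator (U - K) x + e/4 \<partial>m)"
 proof (intro integral_mono)
  have "(\<lambda>x. indicator A x - g x) \<in> borel_measurable borel"
   using A borel_measurable_continuous_onI[OF continuous_trig[OF g(1)]]
   by (intro borel_measurable_diff borel_measurable_indicator)
  moreover obtain B where B: "\<And>x. norm (g x) \<le> B" using bounded_continuous[OF continuous_trig[OF g(1)]] by blast
  moreover have "norm (indicator A x - g x) \<le> 1 + B" for x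
   using norm_triangle_ineq4[of "indicator A x" "g x"] B[of x] by (auto simp: indicator_def split: if_splits)
  ultimately show "integrable m (\<lambda>x. norm (indicator A x - g x))"
   by (intro integrable_norm integrable_bounded)
 qed (use iUK in auto)
 also have "\<dots> = measure m (U - K) + e/4"
  using iUK UK by (simp add: prob_space[simplified])
 also have "measure m (U - K) = measure m U - measure m K"
  using \<open>K \<subseteq> U\<close> U(1) Kb by (intro finite_measure_Diff) auto
 finally show ?thesis using g(1) U(3) K(3) e by (intro bexI[of _ g]) linarith
qed

lemma continuous_approx_indicators:
 fixes f :: "'a \<Rightarrow> complex"
 assumes f: "cont f" and e: "e > 0"
 shows "\<exists>g\<in>lspan ((\<lambda>A. indicator A) ` sets borel). L1_dist f g < e"
proof -
 define U where "U x = {y. norm (f y - f x) < e/2}" for x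
 have op: "open (U x)" for x
  unfolding U_def by (rule open_Collect_less) (intro continuous_intros f)+
 have mem: "x \<in> U x" for x using e by (simp add: U_def)
 obtain S A where S: "finite S" "\<And>s. s \<in> S \<Longrightarrow> A s \<in> sets borel" "\<And>s. s \<in> S \<Longrightarrow> A s \<subseteq> U s"
   "disjoint_family_on A S" "(\<Union>s\<in>S. A s) = UNIV"
  by (rule finite_borel_partition[OF compact_UNIV op mem]) (rule that)
 define g where "g = (\<lambda>x. \<Sum>s\<in>S. f s * indicator (A s) x)"
 have "g \<in> lspan ((\<lambda>A. indicator A) ` sets borel)"
  unfolding g_def by (rule lspan_sum) (use S(2) in \<open>auto intro: lspan.base\<close>)
 moreover have b: "norm (f x - g x) \<le> e/2" for x
 proof -
  obtain s where s: "s \<in> S" "x \<in> A s" "\<forall>f. (\<Sum>t\<in>S. indicator (A t) x * f t) = (f s :: complex)"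
   using simple_sum[OF S(1,4,5), of x] by blast
  have "g x = f s" unfolding g_def using spec[OF s(3), of f] by (simp add: mult.commute)
  then show ?thesis using s(2) S(3)[OF s(1)] by (auto simp: U_def)
 qed
 have "L1_dist f g \<le> (\<integral>x. e/2 \<partial>m)"
 proof (rule integral_mono[OF _ _ b])
  have gb: "g \<in> borel_measurable borel" unfolding g_def
   by (intro borel_measurable_sum borel_measurable_times borel_measurable_const borel_measurable_indicator S(2))
  show "integrable m (\<lambda>x. norm (f x - g x))"
   by (rule integrable_norm[OF integrable_bounded[OF borel_measurable_diff[OF borel_measurable_continuous_onI[OF f] gb] b]])
 qed simp
 then have "L1_dist f g < e" using e by (simp add: prob_space[simplified])
 ultimately show ?thesis by blast
qed

section \<open>Mixing in terms of characters\<close>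


text \<open>This class contains the characters as well as the indicators, so a single approximation
  argument covers the passage in both directions.\<close>

definition bdd_borel :: "('a \<Rightarrow> complex) \<Rightarrow> bool"
 where "bdd_borel f \<longleftrightarrow> f \<in> borel_measurable borel \<and> bounded (range f)"

lemma bdd_borel_integrable:
 assumes "bdd_borel f"
 shows "integrable m f"
proof -
 obtain B where B: "\<forall>x. norm (f x) \<le> B" using assms unfolding bdd_borel_def bounded_iff by auto
 have "f \<in> borel_measurable borel" using assms by (simp only: bdd_borel_def)
 from integrable_bounded[OF this spec[OF B]] show ?thesis .
qed

lemma bdd_borel_add: "bdd_borel f \<Longrightarrow> bdd_borel g \<Longrightarrow> bdd_borel (\<lambda>x. f x + g x)"
 using borel_measurable_add[of f borel g] bounded_plus_comp[of f UNIV g] by (simp only: bdd_borel_def)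

lemma bdd_borel_diff: "bdd_borel f \<Longrightarrow> bdd_borel g \<Longrightarrow> bdd_borel (\<lambda>x. f x - g x)"
 using borel_measurable_diff[of f borel g] bounded_minus_comp[of f UNIV g] by (simp only: bdd_borel_def)

lemma bdd_borel_mult:
 assumes "bdd_borel f" "bdd_borel g"
 shows "bdd_borel (\<lambda>x. f x * g x)"
proof -
 obtain A B where A: "\<forall>x. norm (f x) \<le> A" and B: "\<forall>x. norm (g x) \<le> B"
  using assms unfolding bdd_borel_def bounded_iff by auto
 have "norm (f x * g x) \<le> A * B" for x
  unfolding norm_mult using A B by (intro mult_mono) (auto intro: order_trans[OF norm_ge_zero])
 then have "bounded (range (\<lambda>x. f x * g x))" unfolding bounded_iff by auto
 moreover have "(\<lambda>x. f x * g x) \<in> borel_measurable borel"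
  using assms unfolding bdd_borel_def by (intro borel_measurable_times) auto
 ultimately show ?thesis unfolding bdd_borel_def by (intro conjI)
qed

lemma bdd_borel_const: "bdd_borel (\<lambda>x. c)"
 by (auto simp: bdd_borel_def bounded_iff)

lemma bdd_borel_prod:
 "(\<And>i. i \<in> I \<Longrightarrow> bdd_borel (f i)) \<Longrightarrow> bdd_borel (\<lambda>x. \<Prod>i\<in>I. f i x)"
proof (induct I rule: infinite_finite_induct)
 case (insert i I)
 then show ?case using bdd_borel_mult[of "f i"] by simp
qed (simp_all add: bdd_borel_const)

lemma bdd_borel_comp:
 assumes "bdd_borel f" "epimorphism g"
 shows "bdd_borel (\<lambda>x. f (g x))"
proof -
 have "g \<in> borel_measurable borel"
  using assms(2) by (simp add: epimorphism_def borel_measurable_continuous_onI)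
 then have "(\<lambda>x. f (g x)) \<in> borel_measurable borel"
  using assms(1) unfolding bdd_borel_def by (blast intro: measurable_compose)
 moreover have "bounded (range (\<lambda>x. f (g x)))"
  using assms(1) unfolding bdd_borel_def by (auto intro: bounded_subset)
 ultimately show ?thesis unfolding bdd_borel_def by (intro conjI)
qed

lemma bdd_borel_continuous: "cont f \<Longrightarrow> bdd_borel f"
 unfolding bdd_borel_def
 by (simp add: borel_measurable_continuous_onI compact_imp_bounded compact_continuous_image compact_UNIV)

lemma bdd_borel_character: "f \<in> characters \<Longrightarrow> bdd_borel f"
 by (rule bdd_borel_continuous) (simp add: characters_def)

lemma bdd_borel_indicator: "A \<in> sets borel \<Longrightarrow> bdd_borel (indicator A)"
 unfolding bdd_borel_def bounded_iff
 by (auto intro!: exI[of _ 1] borel_measurable_indicator simp: indicator_def)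

text \<open>One factor w varies while the others, collected in H n, stay bounded by M. Since the
  powers of t preserve m, replacing w by g changes every integral by at most M times the L^1
  distance, uniformly in n.\<close>

lemma weak_limit_extend:
 assumes t: "epimorphism t"
  and H: "\<And>n. bdd_borel (H n)" "\<And>n x. norm (H n x) \<le> M"
  and D: "\<And>f. f \<in> D \<Longrightarrow> bdd_borel f"
  and lim: "\<And>f. f \<in> D \<Longrightarrow> (\<lambda>n. \<integral>x. f ((t ^^ n) x) * H n x \<partial>m) \<longlonglongrightarrow> mean f * C"
  and w: "bdd_borel w" and dense: "\<And>e. e > 0 \<Longrightarrow> \<exists>g\<in>lspan D. L1_dist w g < e"
 shows "(\<lambda>n. \<integral>x. w ((t ^^ n) x) * H n x \<partial>m) \<longlonglongrightarrow> mean w * C"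
proof (rule LIMSEQ_I)
 have M: "M \<ge> 0" using H(2)[of 0 0] norm_ge_zero order_trans by blast
 note tn = epi_funpow[OF t]
 have i: "integrable m (\<lambda>x. f ((t ^^ n) x) * H n x)" if "bdd_borel f" for f n
  by (rule bdd_borel_integrable[OF bdd_borel_mult[OF bdd_borel_comp[OF that tn] H(1)]])
 have span: "bdd_borel g \<and> (\<lambda>n. \<integral>x. g ((t ^^ n) x) * H n x \<partial>m) \<longlonglongrightarrow> mean g * C"
  if "g \<in> lspan D" for g
  using that
 proof (induct rule: lspan.induct)
  case (base f c)
  have "bdd_borel (\<lambda>x. c * f x)"
   by (rule bdd_borel_mult[OF bdd_borel_const D[OF base]])
  moreover have "(\<lambda>n. c * (\<integral>x. f ((t ^^ n) x) * H n x \<partial>m)) \<longlonglongrightarrow> c * (mean f * C)"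
   by (intro tendsto_mult_left lim base)
  ultimately show ?case by (simp add: mult.assoc)
 next
  case (add f g)
  then have f: "bdd_borel f" and g: "bdd_borel g" by auto
  have "(\<lambda>n. (\<integral>x. f ((t ^^ n) x) * H n x \<partial>m) + (\<integral>x. g ((t ^^ n) x) * H n x \<partial>m))
    \<longlonglongrightarrow> mean f * C + mean g * C"
   using add by (intro tendsto_add) auto
  then have "(\<lambda>n. \<integral>x. (f ((t ^^ n) x) + g ((t ^^ n) x)) * H n x \<partial>m) \<longlonglongrightarrow> (\<integral>x. f x + g x \<partial>m) * C"
   unfolding distrib_right Bochner_Integration.integral_add[OF i[OF f] i[OF g]]
    Bochner_Integration.integral_add[OF bdd_borel_integrable[OF f] bdd_borel_integrable[OF g]] .
  then show ?case using bdd_borel_add[OF f g] by blast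
 qed
 fix e :: real assume e: "e > 0"
 \<comment> \<open>Chosen so that the replacement errors in the integral and in the limit together
   cost at most e / 2; the summand 1 keeps the denominator positive.\<close>
 define d where "d = e / (2 * (M + norm C + 1))"
 have d: "d > 0" using e M by (simp add: d_def add_nonneg_pos)
 have d2: "(M + norm C) * d \<le> e / 2"
 proof -
  have "(M + norm C) * d \<le> (M + norm C + 1) * d" using d by (intro mult_right_mono) auto
  also have "\<dots> = e / 2"
  proof -
   have "M + norm C + 1 \<noteq> 0" using M norm_ge_zero[of C] by linarith
   moreover have "s * (e / (2 * s)) = e / 2" if "s \<noteq> 0" for s :: real using that by simp
   ultimately show ?thesis unfolding d_def by blast
  qed
  finally show ?thesis .
 qed
 obtain g where g: "g \<in> lspan D" "L1_dist w g < d" using dense[OF d] by blast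
 have bg: "bdd_borel g" using span[OF g(1)] by blast
 have bwg: "bdd_borel (\<lambda>x. w x - g x)" by (rule bdd_borel_diff[OF w bg])
 note bwgn = bdd_borel_comp[OF bwg tn]
 obtain N where N: "\<And>n. n \<ge> N \<Longrightarrow> norm ((\<integral>x. g ((t ^^ n) x) * H n x \<partial>m) - mean g * C) < e / 2"
  using LIMSEQ_D[OF conjunct2[OF span[OF g(1)]], of "e / 2"] e by auto
 have "norm ((\<integral>x. w ((t ^^ n) x) * H n x \<partial>m) - mean w * C) < e" if n: "n \<ge> N" for n
 proof -
  let ?W = "\<integral>x. w ((t ^^ n) x) * H n x \<partial>m" and ?G = "\<integral>x. g ((t ^^ n) x) * H n x \<partial>m"
  have 1: "norm (?W - ?G) \<le> M * L1_dist w g"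
  proof -
   have "?W - ?G = (\<integral>x. (w ((t ^^ n) x) - g ((t ^^ n) x)) * H n x \<partial>m)"
    unfolding left_diff_distrib by (rule Bochner_Integration.integral_diff[OF i[OF w] i[OF bg], symmetric])
   also have "norm \<dots> \<le> (\<integral>x. norm ((w ((t ^^ n) x) - g ((t ^^ n) x)) * H n x) \<partial>m)"
    by (rule integral_norm_bound)
   also have "\<dots> \<le> (\<integral>x. norm (w ((t ^^ n) x) - g ((t ^^ n) x)) * M \<partial>m)"
   proof (rule integral_mono)
    show "integrable m (\<lambda>x. norm ((w ((t ^^ n) x) - g ((t ^^ n) x)) * H n x))"
     by (rule integrable_norm[OF bdd_borel_integrable[OF bdd_borel_mult[OF bwgn H(1)]]])
    show "integrable m (\<lambda>x. norm (w ((t ^^ n) x) - g ((t ^^ n) x)) * M)"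
     by (rule integrable_mult_left) (rule integrable_norm[OF bdd_borel_integrable[OF bwgn]])
    show "norm ((w ((t ^^ n) x) - g ((t ^^ n) x)) * H n x) \<le> norm (w ((t ^^ n) x) - g ((t ^^ n) x)) * M" for x
     unfolding norm_mult by (intro mult_left_mono H norm_ge_zero)
   qed
   also have "\<dots> = (\<integral>x. norm (w ((t ^^ n) x) - g ((t ^^ n) x)) \<partial>m) * M" by simp
   also have "(\<integral>x. norm (w ((t ^^ n) x) - g ((t ^^ n) x)) \<partial>m) = L1_dist w g"
    using integral_epimorphism_borel[OF tn, of "\<lambda>x. norm (w x - g x)" n]
     borel_measurable_integrable[OF integrable_norm[OF bdd_borel_integrable[OF bwg]]] by simp
   finally show ?thesis by (simp add: mult.commute)
  qed
  have 2: "norm (mean g * C - mean w * C) \<le> norm C * L1_dist w g"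
  proof -
   have "mean w * C - mean g * C = (\<integral>x. w x - g x \<partial>m) * C"
    unfolding Bochner_Integration.integral_diff[OF bdd_borel_integrable[OF w] bdd_borel_integrable[OF bg]]
    by (rule left_diff_distrib[symmetric])
   then have "norm (mean g * C - mean w * C) = norm C * norm (\<integral>x. w x - g x \<partial>m)"
    by (metis norm_minus_commute norm_mult mult.commute)
   also have "\<dots> \<le> norm C * L1_dist w g"
    by (intro mult_left_mono integral_norm_bound norm_ge_zero)
   finally show ?thesis .
  qed
  have "norm (p - t) \<le> norm (p - q) + norm (q - r) + norm (r - t)" for p q r t :: complex
   using norm_triangle_ineq[of "p - q" "q - r"] norm_triangle_ineq[of "p - r" "r - t"] by simp
  then have "norm (?W - mean w * C) \<le> norm (?W - ?G) + norm (?G - mean g * C)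
    + norm (mean g * C - mean w * C)" .
  also have "\<dots> < M * L1_dist w g + e / 2 + norm C * L1_dist w g"
   using 1 2 N[OF n] by linarith
  also have "\<dots> = (M + norm C) * L1_dist w g + e / 2" by (simp add: algebra_simps)
  also have "\<dots> \<le> (M + norm C) * d + e / 2" using g(2) M by (intro add_right_mono mult_left_mono) auto
  also have "\<dots> \<le> e" using d2 by simp
  finally show ?thesis .
 qed
 then show "\<exists>N. \<forall>n\<ge>N. norm ((\<integral>x. w ((t ^^ n) x) * H n x \<partial>m) - mean w * C) < e" by blast
qed

definition decorrelates :: "('a \<Rightarrow> 'a) set \<Rightarrow> (('a \<Rightarrow> 'a) \<Rightarrow> 'a \<Rightarrow> complex) \<Rightarrow> bool" where
 "decorrelates F f \<longleftrightarrow>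
  (\<lambda>n. \<integral>x. (orbit_prod F f n x) \<partial>m) \<longlonglongrightarrow> (\<Prod>t\<in>F. mean (f t))"

text \<open>The factors are released one at a time: the induction is on the set G of factors already
  allowed in W, the others still being confined to D.\<close>

lemma decorrelates_extend:
 assumes F: "finite F" "\<And>t. t \<in> F \<Longrightarrow> epimorphism t"
  and D: "\<And>f. f \<in> D \<Longrightarrow> bdd_borel f" and W: "\<And>f. f \<in> W \<Longrightarrow> bdd_borel f"
  and dense: "\<And>w e. w \<in> W \<Longrightarrow> e > 0 \<Longrightarrow> \<exists>g\<in>lspan D. L1_dist w g < e"
  and dec: "\<And>f. (\<And>t. t \<in> F \<Longrightarrow> f t \<in> D) \<Longrightarrow> decorrelates F f"
  and f: "\<And>t. t \<in> F \<Longrightarrow> f t \<in> W"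
 shows "decorrelates F f"
proof -
 have "\<forall>f. (\<forall>t\<in>G. f t \<in> W) \<and> (\<forall>t\<in>F - G. f t \<in> D) \<longrightarrow> decorrelates F f" if "finite G" "G \<subseteq> F" for G
  using that
 proof induct
  case empty
  then show ?case using dec by auto
 next
  case (insert \<beta> G)
  show ?case
  proof (intro allI impI)
   fix f assume f: "(\<forall>t\<in>insert \<beta> G. f t \<in> W) \<and> (\<forall>t\<in>F - insert \<beta> G. f t \<in> D)"
   have \<beta>: "\<beta> \<in> F" "\<beta> \<notin> G" using insert by auto
   have bf: "bdd_borel (f t)" if "t \<in> F" for t using f that D W by blast
   define H where "H n x = (\<Prod>t\<in>F - {\<beta>}. f t ((t ^^ n) x))" for n x
   define C where "C = (\<Prod>t\<in>F - {\<beta>}. mean (f t))"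
   have dec_iff: "decorrelates F (f(\<beta> := g)) \<longleftrightarrow>
     (\<lambda>n. \<integral>x. g ((\<beta> ^^ n) x) * H n x \<partial>m) \<longlonglongrightarrow> mean g * C" for g
   proof -
    have "(\<Prod>t\<in>F - {\<beta>}. (f(\<beta> := g)) t ((t ^^ n) x)) = H n x" for n x
     unfolding H_def by (rule prod.cong) auto
    moreover have "(\<Prod>t\<in>F - {\<beta>}. mean ((f(\<beta> := g)) t)) = C"
     unfolding C_def by (rule prod.cong) auto
    ultimately show ?thesis
     unfolding decorrelates_def prod.remove[OF F(1) \<beta>(1)] by (simp only: fun_upd_same)
   qed
   have "\<exists>B. \<forall>x. norm (f t x) \<le> B" if "t \<in> F" for t
    using bf[OF that] unfolding bdd_borel_def bounded_iff by auto
   then obtain B where B: "\<And>t x. t \<in> F \<Longrightarrow> norm (f t x) \<le> B t" by metis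
   have "(\<lambda>n. \<integral>x. f \<beta> ((\<beta> ^^ n) x) * H n x \<partial>m) \<longlonglongrightarrow> mean (f \<beta>) * C"
   proof (rule weak_limit_extend[where D = D and M = "\<Prod>t\<in>F - {\<beta>}. B t"])
    show "epimorphism \<beta>" using F \<beta> by blast
    show "bdd_borel (H n)" for n unfolding H_def
    proof (rule bdd_borel_prod)
     show "bdd_borel (\<lambda>x. f t ((t ^^ n) x))" if "t \<in> F - {\<beta>}" for t
      using that by (intro bdd_borel_comp[of "f t" "t ^^ n"] bf epi_funpow F) auto
    qed
    show "norm (H n x) \<le> (\<Prod>t\<in>F - {\<beta>}. B t)" for n x
     unfolding H_def prod_norm[symmetric] by (intro prod_mono) (use B in auto)
    show "bdd_borel (f \<beta>)" using bf \<beta> by blast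
    show "(\<lambda>n. \<integral>x. g ((\<beta> ^^ n) x) * H n x \<partial>m) \<longlonglongrightarrow> mean g * C" if "g \<in> D" for g
    proof -
     have "decorrelates F (f(\<beta> := g))" using insert f that \<beta> by auto
     then show ?thesis unfolding dec_iff .
    qed
    show "\<exists>g\<in>lspan D. (\<integral>x. norm (f \<beta> x - g x) \<partial>m) < e" if "e > 0" for e
     using dense[of "f \<beta>"] f that by blast
   qed (rule D)
   then show "decorrelates F f" using dec_iff[of "f \<beta>"] by simp
  qed
 qed
 from this[OF F(1) order_refl] show ?thesis using f by auto
qed

text \<open>The orbit product is itself a character, so its integral is 1 or 0 according to whether
  the relation holds at time n. A sequence of zeros and ones converges to 0 only by being eventually
  0; if every factor is trivial, both sides are constantly 1.\<close>

lemma decorrelates_characters_iff: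
 assumes F: "finite F" "\<And>t. t \<in> F \<Longrightarrow> epimorphism t" and f: "\<And>t. t \<in> F \<Longrightarrow> f t \<in> characters"
 shows "decorrelates F f \<longleftrightarrow>
  ((\<exists>t\<in>F. \<exists>x. f t x \<noteq> 1) \<longrightarrow> finite (relation_times F f))"
proof -
 have "(\<lambda>x. \<Prod>t\<in>F. f t ((t ^^ n) x)) \<in> characters" for n
 proof (rule character_prod)
  show "(\<lambda>x. f t ((t ^^ n) x)) \<in> characters" if "t \<in> F" for t
   by (rule character_comp[OF f[OF that] epi_funpow[OF F(2)[OF that]]])
 qed
 from integral_character[OF this]
 have l: "(\<integral>x. (orbit_prod F f n x) \<partial>m) = (if \<forall>x. (orbit_prod F f n x) = 1 then 1 else 0)" for n .
 show ?thesis
 proof (cases "\<exists>t\<in>F. \<exists>x. f t x \<noteq> 1")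
  case True
  then have "\<exists>t\<in>F. mean (f t) = 0" using integral_character[OF f] by auto
  then have r: "(\<Prod>t\<in>F. mean (f t)) = 0" using F(1) by (simp add: prod_zero_iff)
  define P where "P n \<longleftrightarrow> (\<forall>x. (orbit_prod F f n x) = 1)" for n
  have "(\<lambda>n. if P n then 1 else 0 :: complex) \<longlonglongrightarrow> 0 \<longleftrightarrow> finite {n. P n}"
  proof
   assume "(\<lambda>n. if P n then 1 else 0 :: complex) \<longlonglongrightarrow> 0"
   from LIMSEQ_D[OF this, of 1] obtain N where "\<And>n. n \<ge> N \<Longrightarrow> \<not> P n" by fastforce
   then have "{n. P n} \<subseteq> {..<N}" by (auto simp: not_le[symmetric])
   then show "finite {n. P n}" using finite_subset by blast
  next
   assume "finite {n. P n}"
   then obtain N where N: "\<forall>n\<in>{n. P n}. n < N" unfolding finite_nat_set_iff_bounded by blast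
   show "(\<lambda>n. if P n then 1 else 0 :: complex) \<longlonglongrightarrow> 0"
    by (rule tendsto_eventually) (use N in \<open>auto simp: eventually_sequentially intro!: exI[of _ N]\<close>)
  qed
  then show ?thesis using True unfolding decorrelates_def l r P_def by simp
 next
  case False
  then have "mean (f t) = 1" if "t \<in> F" for t using integral_character[OF f[OF that]] that by auto
  then have r: "(\<Prod>t\<in>F. mean (f t)) = 1" by simp
  have "(orbit_prod F f n x) = 1" for n x by (rule prod.neutral) (use False in auto)
  then show ?thesis using False unfolding decorrelates_def l r by simp
 qed
qed

lemma decorrelates_indicators_iff:
 assumes F: "finite F" "\<And>t. t \<in> F \<Longrightarrow> epimorphism t" and A: "\<And>t. t \<in> F \<Longrightarrow> A t \<in> sets borel"
 shows "decorrelates F (\<lambda>t. indicator (A t)) \<longleftrightarrow>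
  (\<lambda>n. measure m (orbit_preimage F A n)) \<longlonglongrightarrow> (\<Prod>t\<in>F. measure m (A t))"
proof -
 have int: "(\<integral>x. indicator B x \<partial>m) = complex_of_real (measure m B)" for B
 proof -
  have "(\<lambda>x. indicator B x) = (\<lambda>x. complex_of_real (indicator B x))" by (auto simp: indicator_def)
  then show ?thesis by (simp only: integral_complex_of_real) simp
 qed
 have "(\<Prod>t\<in>F. indicator (A t) ((t ^^ n) x)) = (indicator (orbit_preimage F A n) x :: complex)" for n x
  using F(1) by (induct F) (auto simp: indicator_def)
 then show ?thesis unfolding decorrelates_def by (simp only: int of_real_prod[symmetric] tendsto_of_real_iff)
qed

text \<open>A set of the completion differs from a Borel set by a part of a null set, and
  epimorphisms pull null sets back to null sets, so neither side of the limit changes.\<close>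

lemma mixing_iff_Borel:
 assumes F: "finite F" "card F > 1" "\<And>t. t \<in> F \<Longrightarrow> epimorphism t"
 shows "mixing m F \<longleftrightarrow> (\<forall>A. (\<forall>t\<in>F. A t \<in> sets borel) \<longrightarrow>
  (\<lambda>n. measure m (orbit_preimage F A n)) \<longlonglongrightarrow> (\<Prod>t\<in>F. measure m (A t)))" (is "_ \<longleftrightarrow> ?R")
proof -
 have mg: "(t ^^ n) -` A \<in> sets borel" if "t \<in> F" "A \<in> sets borel" for t n A
  using measurable_sets[OF epimorphism_measurable[OF epi_funpow[OF F(3)[OF that(1)]]], of A n] that(2) by simp
 have F0: "F \<noteq> {}" using F by auto
 have inter: "orbit_preimage F A n \<in> sets borel" if "\<forall>t\<in>F. A t \<in> sets borel" for A n
  using F(1) F0 mg that by (intro sets.finite_INT) auto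
 have meas: "measure (completion m) B = measure m B" if "B \<in> sets borel" for B
  using that by simp
 show ?thesis
 proof
  assume mix: "mixing m F"
  show ?R
  proof (intro allI impI)
   fix A :: "('a \<Rightarrow> 'a) \<Rightarrow> 'a set" assume A: "\<forall>t\<in>F. A t \<in> sets borel"
   then have "\<forall>t\<in>F. A t \<in> sets (completion m)" by simp
   with mix have "(\<lambda>n. measure (completion m) (orbit_preimage F A n))
     \<longlonglongrightarrow> (\<Prod>t\<in>F. measure (completion m) (A t))" unfolding mixing_def by blast
   moreover have "(\<Prod>t\<in>F. measure (completion m) (A t)) = (\<Prod>t\<in>F. measure m (A t))"
    using A meas by (intro prod.cong) auto
   ultimately show "(\<lambda>n. measure m (orbit_preimage F A n)) \<longlonglongrightarrow> (\<Prod>t\<in>F. measure m (A t))"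
    using meas[OF inter[OF A]] by simp
  qed
 next
  assume R: ?R
  have "(\<lambda>n. measure (completion m) (orbit_preimage F B n)) \<longlonglongrightarrow> (\<Prod>t\<in>F. measure (completion m) (B t))"
   if B: "\<forall>t\<in>F. B t \<in> sets (completion m)" for B
  proof -
   have "\<exists>A N. A \<in> sets borel \<and> N \<in> null_sets m \<and> A \<subseteq> B t \<and> B t \<subseteq> A \<union> N" if "t \<in> F" for t
    using B[rule_format, OF that] by (elim sets_completionE) auto
   then obtain A N where AN: "\<And>t. t \<in> F \<Longrightarrow> A t \<in> sets borel" "\<And>t. t \<in> F \<Longrightarrow> N t \<in> null_sets m"
    "\<And>t. t \<in> F \<Longrightarrow> A t \<subseteq> B t" "\<And>t. t \<in> F \<Longrightarrow> B t \<subseteq> A t \<union> N t" by metis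
   have eq: "measure (completion m) T = measure m S"
    if "S \<in> sets borel" "S \<subseteq> T" "T \<subseteq> S \<union> M" "M \<in> null_sets m" for S T M
   proof -
    have "T - S \<subseteq> M" using that by blast
    then have "T - S \<in> null_sets (completion m)"
     using null_sets_completionI[OF that(4)] by (rule completion.complete2)
    then have "measure (completion m) (S \<union> (T - S)) = measure (completion m) S"
     using that(1) by (intro measure_Un_null_set) simp_all
    moreover have "S \<union> (T - S) = T" using that(2) by blast
    ultimately show ?thesis using that(1) by simp
   qed
   have "measure (completion m) (B t) = measure m (A t)" if "t \<in> F" for t
    by (rule eq[OF AN(1)[OF that] AN(3)[OF that] AN(4)[OF that] AN(2)[OF that]])
   then have r: "(\<Prod>t\<in>F. measure (completion m) (B t)) = (\<Prod>t\<in>F. measure m (A t))" by simp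
   have "measure (completion m) (orbit_preimage F B n) = measure m (orbit_preimage F A n)" for n
   proof (rule eq)
    show "orbit_preimage F A n \<in> sets borel" using inter AN(1) by blast
    show "orbit_preimage F A n \<subseteq> (orbit_preimage F B n)" using AN(3) by blast
    show "orbit_preimage F B n \<subseteq> (orbit_preimage F A n) \<union> (\<Union>t\<in>F. (t ^^ n) -` N t)"
     using AN(4) by blast
    have "(t ^^ n) -` N t \<in> null_sets m" if "t \<in> F" for t
     using AN(2)[OF that] mg[OF that, of "N t" n]
      emeasure_epi_vimage[OF epi_funpow[OF F(3)[OF that]], of "N t" n]
     by (auto simp: null_sets_def)
    then show "(\<Union>t\<in>F. (t ^^ n) -` N t) \<in> null_sets m"
     by (intro null_sets_UN' countable_finite F(1))
   qed
   moreover have "(\<lambda>n. measure m (orbit_preimage F A n)) \<longlonglongrightarrow> (\<Prod>t\<in>F. measure m (A t))"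
    using R AN(1) by blast
   ultimately show ?thesis by (simp only: r)
  qed
  then show "mixing m F" unfolding mixing_def using F by blast
 qed
qed

text \<open>Indicators and characters each lie in the L^1 closure of the span of the other class, so
  decorrelation transfers both ways.\<close>

theorem mixing_iff_characters:
 assumes F: "finite F" "card F > 1" "\<And>t. t \<in> F \<Longrightarrow> epimorphism t"
 shows "mixing m F \<longleftrightarrow> (\<forall>f. (\<forall>t\<in>F. f t \<in> characters) \<and> (\<exists>t\<in>F. \<exists>x. f t x \<noteq> 1) \<longrightarrow>
  finite (relation_times F f))"
proof -
 let ?I = "(\<lambda>A. indicator A) ` sets borel :: ('a \<Rightarrow> complex) set"
 have bI: "bdd_borel f" if "f \<in> ?I" for f using that bdd_borel_indicator by blast
 have mixB: "mixing m F \<longleftrightarrow> (\<forall>A. (\<forall>t\<in>F. A t \<in> sets borel) \<longrightarrow>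
  (\<lambda>n. measure m (orbit_preimage F A n)) \<longlonglongrightarrow> (\<Prod>t\<in>F. measure m (A t)))"
  by (rule mixing_iff_Borel[OF F])
 have decI: "decorrelates F (\<lambda>t. indicator (A t)) \<longleftrightarrow>
  (\<lambda>n. measure m (orbit_preimage F A n)) \<longlonglongrightarrow> (\<Prod>t\<in>F. measure m (A t))"
  if "\<forall>t\<in>F. A t \<in> sets borel" for A
  by (rule decorrelates_indicators_iff[OF F(1,3)]) (use that in auto)
 have decC: "decorrelates F f \<longleftrightarrow>
  ((\<exists>t\<in>F. \<exists>x. f t x \<noteq> 1) \<longrightarrow> finite (relation_times F f))"
  if "\<forall>t\<in>F. f t \<in> characters" for f
  by (rule decorrelates_characters_iff[OF F(1,3)]) (use that in auto)
 have "mixing m F \<longleftrightarrow> (\<forall>f. (\<forall>t\<in>F. f t \<in> ?I) \<longrightarrow> decorrelates F f)"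
 proof
  assume mix: "mixing m F"
  show "\<forall>f. (\<forall>t\<in>F. f t \<in> ?I) \<longrightarrow> decorrelates F f"
  proof (intro allI impI)
   fix f :: "('a \<Rightarrow> 'a) \<Rightarrow> 'a \<Rightarrow> complex" assume "\<forall>t\<in>F. f t \<in> ?I"
   then obtain A where A: "\<And>t. t \<in> F \<Longrightarrow> A t \<in> sets borel" "\<And>t. t \<in> F \<Longrightarrow> f t = indicator (A t)"
    unfolding image_iff by metis
   have "decorrelates F (\<lambda>t. indicator (A t))"
    using mix A(1) decI[of A] unfolding mixB by simp
   then show "decorrelates F f" using A(2) unfolding decorrelates_def by simp
  qed
 next
  assume dec: "\<forall>f. (\<forall>t\<in>F. f t \<in> ?I) \<longrightarrow> decorrelates F f"
  show "mixing m F"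
   unfolding mixB
  proof (intro allI impI)
   fix A :: "('a \<Rightarrow> 'a) \<Rightarrow> 'a set" assume A: "\<forall>t\<in>F. A t \<in> sets borel"
   have "decorrelates F (\<lambda>t. indicator (A t))"
    by (rule dec[rule_format]) (use A in simp)
   then show "(\<lambda>n. measure m (orbit_preimage F A n)) \<longlonglongrightarrow> (\<Prod>t\<in>F. measure m (A t))"
    unfolding decI[OF A] .
  qed
 qed
 also have "\<dots> \<longleftrightarrow> (\<forall>f. (\<forall>t\<in>F. f t \<in> characters) \<longrightarrow> decorrelates F f)"
 proof (intro iffI allI impI)
  fix f :: "('a \<Rightarrow> 'a) \<Rightarrow> 'a \<Rightarrow> complex"
  assume dec: "\<forall>f. (\<forall>t\<in>F. f t \<in> ?I) \<longrightarrow> decorrelates F f" and f: "\<forall>t\<in>F. f t \<in> characters"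
  show "decorrelates F f"
  proof (rule decorrelates_extend[where D = ?I and W = characters])
   show "\<exists>g\<in>lspan ?I. L1_dist w g < e" if "w \<in> characters" "e > 0" for w e
    by (rule continuous_approx_indicators) (use that in \<open>auto simp: characters_def\<close>)
   show "decorrelates F f" if "\<And>t. t \<in> F \<Longrightarrow> f t \<in> ?I" for f
    by (rule dec[rule_format]) (rule that)
   show "f t \<in> characters" if "t \<in> F" for t using f that by (rule bspec)
  qed (fact F(1) F(3) bI bdd_borel_character)+
 next
  fix f :: "('a \<Rightarrow> 'a) \<Rightarrow> 'a \<Rightarrow> complex"
  assume dec: "\<forall>f. (\<forall>t\<in>F. f t \<in> characters) \<longrightarrow> decorrelates F f" and f: "\<forall>t\<in>F. f t \<in> ?I"
  show "decorrelates F f"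
  proof (rule decorrelates_extend[where D = characters and W = ?I])
   show "\<exists>g\<in>trig. L1_dist w g < e" if "w \<in> ?I" "e > 0" for w e
    using that(1) indicator_approx_trig[OF _ that(2)] by fastforce
   show "decorrelates F f" if "\<And>t. t \<in> F \<Longrightarrow> f t \<in> characters" for f
    by (rule dec[rule_format]) (rule that)
   show "f t \<in> ?I" if "t \<in> F" for t using f that by (rule bspec)
  qed (fact F(1) F(3) bI bdd_borel_character)+
 qed
 also have "\<dots> \<longleftrightarrow> (\<forall>f. (\<forall>t\<in>F. f t \<in> characters) \<and> (\<exists>t\<in>F. \<exists>x. f t x \<noteq> 1) \<longrightarrow>
  finite (relation_times F f))"
  using decC by (simp only: imp_conjL cong: imp_cong)
 finally show ?thesis .
qed

end

section \<open>Zeros of Newton series\<close>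

text \<open>Divide out one zero t at a time. The quotient R satisfies coeff R j = coeff S (j + 1) +
  t * coeff R (j + 1), so divisibility of the high coefficients descends to R with the threshold
  lowered by one. After all divisions every coefficient is divisible by e.\<close>

lemma dvd_poly_if_many_zeros:
 fixes S :: "int poly"
 assumes "finite T" "\<And>t. t \<in> T \<Longrightarrow> poly S t = 0" "\<And>j. j \<ge> card T \<Longrightarrow> e dvd coeff S j"
 shows "e dvd poly S x"
 using assms
proof (induct T arbitrary: S rule: finite_induct)
 case empty
 then show ?case by (simp add: poly_altdef dvd_sum)
next
 case (insert t T)
 from insert(4)[of t] obtain R where R: "S = [:- t, 1:] * R" by (auto simp: poly_eq_0_iff_dvd dvd_def)
 have zeros: "poly R s = 0" if "s \<in> T" for s
  using insert(4)[of s] insert(2) that by (auto simp: R)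
 have step: "coeff R j = coeff S (Suc j) + t * coeff R (Suc j)" for j by (simp add: R)
 \<comment> \<open>Downward induction on the index j: k counts the steps from above the degree,
   where the coefficients vanish.\<close>
 have dvd: "\<forall>j\<ge>card T. degree R < j + k \<longrightarrow> e dvd coeff R j" for k
 proof (induct k)
  case 0
  then show ?case by (simp add: coeff_eq_0)
 next
  case (Suc k)
  show ?case
  proof (intro allI impI)
   fix j assume j: "card T \<le> j" "degree R < j + Suc k"
   then have "e dvd coeff R (Suc j)" using Suc by simp
   moreover have "e dvd coeff S (Suc j)" using insert(5)[of "Suc j"] insert(1,2) j by simp
   ultimately show "e dvd coeff R j" unfolding step[of j] by simp
  qed
 qed
 from dvd[of "Suc (degree R)"] have "e dvd coeff R j" if "j \<ge> card T" for j using that by simp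
 then have "e dvd poly R x" using insert(3)[of R] zeros by blast
 then show ?case by (simp add: R)
qed

text \<open>The falling factorial: i! times the binomial polynomial, which itself does not have
  integer coefficients for i > 1.\<close>

definition ffact_poly :: "nat \<Rightarrow> int poly" where
 "ffact_poly i = (\<Prod>j<i. [:- int j, 1:])"

lemma coeff_ffact_poly: "j > i \<Longrightarrow> coeff (ffact_poly i) j = 0"
proof -
 have "degree (ffact_poly i) \<le> i"
  unfolding ffact_poly_def
  using degree_prod_sum_le[of "{..<i}" "\<lambda>j. [:- int j, 1:]"] by simp
 then show "j > i \<Longrightarrow> ?thesis" by (simp add: coeff_eq_0)
qed

lemma poly_ffact_poly: "poly (ffact_poly i) (int n) = fact i * int (n choose i)"
proof -
 have "real_of_int (poly (ffact_poly i) (int n)) = (\<Prod>j<i. real n - real j)"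
  unfolding ffact_poly_def by (simp add: poly_prod)
 also have "\<dots> = fact i * (real n gchoose i)" by (simp add: gbinomial_mult_fact lessThan_atLeast0)
 also have "\<dots> = real_of_int (fact i * int (n choose i))" by (simp add: binomial_gbinomial)
 finally show ?thesis by (simp only: of_int_eq_iff)
qed

text \<open>Legendre's formula in recursive form: n! contributes n div p factors p, plus those of (n
  div p)!. As p >= 2, twice n div p is at most n.\<close>

lemma multiplicity_fact_le:
 assumes p: "prime (p::nat)"
 shows "multiplicity p (fact n :: nat) \<le> n"
proof -
 have p1: "p > 1" using p by (rule prime_gt_1_nat)
 have rec: "multiplicity p (fact n :: nat) = n div p + multiplicity p (fact (n div p) :: nat)" for n
 proof (induct n)
  case (Suc n)
  have s: "multiplicity p (fact (Suc k) :: nat) = multiplicity p (Suc k) + multiplicity p (fact k :: nat)" for k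
   unfolding fact_Suc using p by (subst prime_elem_multiplicity_mult_distrib) auto
  show ?case
  proof (cases "p dvd Suc n")
   case True
   then have "Suc n div p = Suc (n div p)" using p1 by (simp add: div_Suc dvd_eq_mod_eq_0)
   moreover have "Suc n = p * (Suc n div p)" using True by simp
   ultimately have "multiplicity p (Suc n) = Suc (multiplicity p (Suc (n div p)))"
    using p p1 by (metis multiplicity_times_same nat.distinct(1) not_prime_unit prime_def not_prime_0)
   then show ?thesis unfolding s \<open>Suc n div p = Suc (n div p)\<close> using Suc s[of "n div p"] by simp
  next
   case False
   then have "Suc n div p = n div p" by (simp add: div_Suc dvd_eq_mod_eq_0)
   then show ?thesis unfolding s using Suc False by (simp add: not_dvd_imp_multiplicity_0)
  qed
 qed simp
 show ?thesis
 proof (induct n rule: less_induct)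
  case (less n)
  show ?case
  proof (cases "n = 0")
   case False
   then have "n div p < n" using p1 by simp
   from less[OF this] have "multiplicity p (fact n :: nat) \<le> n div p + n div p" using rec[of n] by simp
   also have "\<dots> \<le> n div p * p" using p1 by (metis mult_2_right mult_le_mono2 Suc_leI One_nat_def numeral_2_eq_2)
   also have "\<dots> \<le> n" by simp
   finally show ?thesis .
  qed simp
 qed
qed

text \<open>Hansel's argument for the Skolem--Mahler--Lech theorem: after multiplication by \<open>N!\<close>
 the Newton series is a polynomial whose higher coefficients are highly divisible by \<open>p\<close>.
 Dividing out \<open>k\<close> zeros makes all the remaining values divisible by \<open>p ^ k\<close>.\<close>

lemma Newton_series_zero:
 fixes d :: "nat \<Rightarrow> int"
 assumes p: "prime (p::nat)" and d: "\<And>i. int p ^ (2 * i) dvd d i"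
  and b: "\<And>n. b n = (\<Sum>i\<le>n. int (n choose i) * d i)"
  and inf: "infinite {n. b n = 0}"
 shows "b t = 0"
proof (rule ccontr)
 assume bt: "b t \<noteq> 0"
 \<comment> \<open>k zeros will make b t divisible by p^k, and p^k > k, the absolute value of b
   t.\<close>
 define k where "k = nat \<bar>b t\<bar>"
 have p1: "p > 1" using p by (rule prime_gt_1_nat)
 obtain T where T: "T \<subseteq> {n. b n = 0}" "finite T" "card T = k"
  using infinite_arbitrarily_large[OF inf, of k] by blast
 obtain N where N: "\<forall>n\<in>insert t T. n \<le> N" using T(2) finite_nat_set_iff_bounded_le[of "insert t T"] by auto
 define e where "e = multiplicity p (fact N :: nat)"
 define c where "c i = int (fact N div fact i)" for i
 \<comment> \<open>N! times the Newton series cut off at N, as an integer polynomial; it has the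
   right values at all arguments up to N, which include T and t.\<close>
 define S where "S = (\<Sum>i\<le>N. smult (c i * d i) (ffact_poly i))"
 have fd: "(fact i :: nat) dvd fact N" if "i \<le> N" for i using that by (rule fact_dvd)
 have cf: "c i * fact i = fact N" if "i \<le> N" for i
 proof -
  have "(fact N div fact i) * fact i = (fact N :: nat)" using fd[OF that] by simp
  then show ?thesis unfolding c_def by (metis of_nat_fact of_nat_mult)
 qed
 have val: "poly S (int n) = fact N * b n" if n: "n \<le> N" for n
 proof -
  have "poly S (int n) = (\<Sum>i\<le>N. c i * d i * (fact i * int (n choose i)))"
   unfolding S_def by (simp add: poly_sum poly_ffact_poly)
  also have "\<dots> = (\<Sum>i\<le>N. fact N * (int (n choose i) * d i))"
   by (rule sum.cong) (auto simp: cf[symmetric])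
  also have "\<dots> = fact N * (\<Sum>i\<le>N. int (n choose i) * d i)" by (simp add: sum_distrib_left)
  also have "(\<Sum>i\<le>N. int (n choose i) * d i) = (\<Sum>i\<le>n. int (n choose i) * d i)"
   using n by (intro sum.mono_neutral_right) auto
  finally show ?thesis by (simp add: b)
 qed
 \<comment> \<open>N! / i! retains at least e - i factors p, and d i supplies 2 i more.\<close>
 have div: "int p ^ (e + i) dvd c i * d i" if i: "i \<le> N" for i
 proof -
  have "(fact N :: nat) = (fact N div fact i) * fact i" using fd[OF i] by simp
  moreover have "(fact N div fact i :: nat) \<noteq> 0" using fd[OF i] by (metis calculation fact_nonzero mult_0)
  ultimately have "e = multiplicity p (fact N div fact i :: nat) + multiplicity p (fact i :: nat)"
   unfolding e_def using p prime_elem_multiplicity_mult_distrib[of p "fact N div fact i :: nat" "fact i"]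
   by simp
  then have "e \<le> multiplicity p (fact N div fact i :: nat) + i" using multiplicity_fact_le[OF p, of i] by simp
  then have "p ^ (e + i) dvd p ^ (multiplicity p (fact N div fact i :: nat) + i + i)" by (intro le_imp_power_dvd) simp
  also have "\<dots> = p ^ multiplicity p (fact N div fact i :: nat) * p ^ (2 * i)" by (simp add: power_add mult_2)
  finally have "int p ^ (e + i) dvd int p ^ multiplicity p (fact N div fact i :: nat) * int p ^ (2 * i)"
   by (metis of_nat_dvd_iff of_nat_mult of_nat_power)
  also have "\<dots> dvd c i * d i"
  proof (rule mult_dvd_mono[OF _ d])
   have "p ^ multiplicity p (fact N div fact i :: nat) dvd fact N div fact i" by (rule multiplicity_dvd)
   then show "int p ^ multiplicity p (fact N div fact i :: nat) dvd c i"
    unfolding c_def by (metis of_nat_dvd_iff of_nat_power)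
  qed
  finally show ?thesis .
 qed
 have coeffs: "int p ^ (e + j) dvd coeff S j" for j
  unfolding S_def coeff_sum coeff_smult
 proof (rule dvd_sum)
  fix i assume i: "i \<in> {..N}"
  show "int p ^ (e + j) dvd c i * d i * coeff (ffact_poly i) j"
  proof (cases "j > i")
   case False
   then have "int p ^ (e + j) dvd int p ^ (e + i)" by (intro le_imp_power_dvd) simp
   also have "\<dots> dvd c i * d i" using div i by simp
   finally show ?thesis by simp
  qed (simp add: coeff_ffact_poly)
 qed
 have "int p ^ (e + k) dvd poly S (int t)"
 proof (rule dvd_poly_if_many_zeros[of "int ` T"])
  show "poly S s = 0" if "s \<in> int ` T" for s using that T(1) N val by auto
  show "int p ^ (e + k) dvd coeff S j" if "j \<ge> card (int ` T)" for j
  proof -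
   have "j \<ge> k" using that T by (simp add: card_image)
   then have "int p ^ (e + k) dvd int p ^ (e + j)" by (intro le_imp_power_dvd) simp
   then show ?thesis using coeffs[of j] by (rule dvd_trans)
  qed
 qed (simp add: T)
 then have 1: "int p ^ (e + k) dvd fact N * b t" using val N by simp
 \<comment> \<open>N! contains exactly e factors p, so cancelling them leaves p^k to divide b
   t.\<close>
 obtain w where w: "(fact N :: nat) = p ^ e * w" "\<not> p dvd w"
  unfolding e_def using multiplicity_decompose'[of "fact N :: nat" p] p by (metis fact_nonzero not_prime_unit)
 have "(fact N :: int) = int p ^ e * int w" using w(1) by (metis of_nat_fact of_nat_mult of_nat_power)
 with 1 have "int p ^ e * int p ^ k dvd int p ^ e * (int w * b t)" by (simp add: power_add mult.assoc)
 then have 2: "int p ^ k dvd int w * b t" using p1 by simp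
 have "coprime p w" using w(2) p by (simp add: prime_imp_coprime)
 then have "coprime (int p ^ k) (int w)" by simp
 with 2 have "int p ^ k dvd b t" by (simp add: coprime_dvd_mult_right_iff)
 from dvd_imp_le_int[OF bt this] have "int p ^ k \<le> \<bar>b t\<bar>" by simp
 then have "int (p ^ k) \<le> int k" by (simp add: k_def)
 then have "p ^ k \<le> k" by (simp only: of_nat_le_iff)
 moreover have "k < p ^ k" using p1 by (simp add: power_gt_expt)
 ultimately show False by simp
qed

text \<open>Gaussian elimination without division: a variable v occurring in equation r is
  eliminated from the others by cross-multiplication with its coefficient, and the smaller system is
  solved by induction.\<close>

lemma homogeneous_system_solution:
 fixes a :: "'e \<Rightarrow> 'u \<Rightarrow> int"
 assumes "finite Q" "finite U" "card Q < card U"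
 shows "\<exists>x. (\<exists>u\<in>U. x u \<noteq> 0) \<and> (\<forall>q\<in>Q. (\<Sum>u\<in>U. a q u * x u) = 0)"
 using assms
proof (induct Q arbitrary: U a rule: finite_induct)
 case empty
 then have "U \<noteq> {}" by auto
 then show ?case by (intro exI[of _ "\<lambda>_. 1"]) auto
next
 case (insert r Q)
 show ?case
 proof (cases "\<forall>u\<in>U. a r u = 0")
  case True
  obtain x where "\<exists>u\<in>U. x u \<noteq> 0" "\<forall>q\<in>Q. (\<Sum>u\<in>U. a q u * x u) = 0"
  proof -
   have "card Q < card U" using insert by simp
   from insert(3)[OF insert(4) this, of a] show thesis using that by blast
  qed
  then show ?thesis using True by (intro exI[of _ x]) simp
 next
  case False
  then obtain v where v: "v \<in> U" "a r v \<noteq> 0" by blast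
  have fin: "finite (U - {v})" and card: "card Q < card (U - {v})" using insert v by auto
  obtain y where y: "\<exists>u\<in>U - {v}. y u \<noteq> 0"
   "\<forall>q\<in>Q. (\<Sum>u\<in>U - {v}. (a r v * a q u - a q v * a r u) * y u) = 0"
   using insert(3)[OF fin card, of "\<lambda>q u. a r v * a q u - a q v * a r u"] by blast
  \<comment> \<open>Scaling the other unknowns by the pivot coefficient keeps the solution of
    equation r for the pivot unknown integral.\<close>
  define x where "x u = (if u = v then - (\<Sum>u\<in>U - {v}. a r u * y u) else a r v * y u)" for u
  have sum: "(\<Sum>u\<in>U. a q u * x u) = a r v * (\<Sum>u\<in>U - {v}. a q u * y u) - a q v * (\<Sum>u\<in>U - {v}. a r u * y u)" for q
  proof -
   have "(\<Sum>u\<in>U - {v}. a q u * x u) = (\<Sum>u\<in>U - {v}. a r v * (a q u * y u))"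
    by (rule sum.cong) (auto simp: x_def)
   then show ?thesis unfolding sum.remove[OF insert(4) v(1)]
    by (simp add: x_def sum_distrib_left)
  qed
  have "(\<Sum>u\<in>U. a q u * x u) = 0" if "q \<in> Q" for q
  proof -
   have "(\<Sum>u\<in>U - {v}. (a r v * a q u - a q v * a r u) * y u) = (\<Sum>u\<in>U. a q u * x u)"
    unfolding sum by (simp add: left_diff_distrib sum_subtractf sum_distrib_left mult.assoc)
   then show ?thesis using y(2) that by simp
  qed
  moreover have "(\<Sum>u\<in>U. a r u * x u) = 0" unfolding sum by simp
  moreover have "\<exists>u\<in>U. x u \<noteq> 0" using y(1) v by (auto simp: x_def)
  ultimately show ?thesis by (intro exI[of _ x]) simp
 qed
qed

section \<open>Relations between integer matrices\<close>

text \<open>The lattice Z^I, with vectors extended by 0 outside I so that addition and equality are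
  those of the function type.\<close>

definition vecs :: "'i set \<Rightarrow> ('i \<Rightarrow> int) set" where
 "vecs I = {v. \<forall>i. i \<notin> I \<longrightarrow> v i = 0}"

definition sc :: "int \<Rightarrow> ('i \<Rightarrow> int) \<Rightarrow> 'i \<Rightarrow> int" where
 "sc c v = (\<lambda>i. c * v i)"

lemma sc_apply [simp]: "sc c v i = c * v i"
 by (simp add: sc_def)

lemma sum_fun_apply: "(\<Sum>a\<in>A. f a) i = (\<Sum>a\<in>A. f a i :: int)"
 by (induct A rule: infinite_finite_induct) auto

lemma sc_simps: "sc c (u + v) = sc c u + sc c v" "sc (a + b) v = sc a v + sc b v" "sc a (sc b v) = sc (a * b) v"
 "sc 0 v = 0" "sc c 0 = 0" "sc 1 v = v"
 by (auto simp: fun_eq_iff algebra_simps)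

lemma sc_sum: "sc c (\<Sum>a\<in>A. f a) = (\<Sum>a\<in>A. sc c (f a))"
 by (auto simp: fun_eq_iff sum_fun_apply sum_distrib_left)

lemma vecs_closed:
 "u \<in> vecs I \<Longrightarrow> v \<in> vecs I \<Longrightarrow> u + v \<in> vecs I"
 "u \<in> vecs I \<Longrightarrow> v \<in> vecs I \<Longrightarrow> u - v \<in> vecs I"
 "v \<in> vecs I \<Longrightarrow> sc c v \<in> vecs I" "0 \<in> vecs I"
 by (auto simp: vecs_def)

lemma vecs_sum: "(\<And>a. a \<in> A \<Longrightarrow> f a \<in> vecs I) \<Longrightarrow> (\<Sum>a\<in>A. f a) \<in> vecs I"
 by (auto simp: vecs_def sum_fun_apply)

text \<open>Additivity is required of all integer functions, so it rewrites without membership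
  conditions; only stability refers to the lattice.\<close>

definition endo :: "'i set \<Rightarrow> (('i \<Rightarrow> int) \<Rightarrow> ('i \<Rightarrow> int)) \<Rightarrow> bool" where
 "endo I T \<longleftrightarrow> (\<forall>u v. T (u + v) = T u + T v) \<and> (\<forall>v\<in>vecs I. T v \<in> vecs I)"

lemma endo_add: "endo I T \<Longrightarrow> T (u + v) = T u + T v"
 by (simp add: endo_def)

lemma endo_mem: "endo I T \<Longrightarrow> v \<in> vecs I \<Longrightarrow> T v \<in> vecs I"
 by (simp add: endo_def)

lemma endo_0: "endo I T \<Longrightarrow> T 0 = 0"
 using endo_add[of I T 0 0] by simp

lemma endo_diff: "endo I T \<Longrightarrow> T (u - v) = T u - T v"
 using endo_add[of I T "u - v" v] by simp

lemma endo_sc: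
 assumes "endo I T"
 shows "T (sc c v) = sc c (T v)"
proof -
 have n: "T (sc (int n) v) = sc (int n) (T v)" for n
  by (induct n) (simp_all only: of_nat_0 of_nat_Suc sc_simps endo_0[OF assms] endo_add[OF assms])
 show ?thesis
 proof (cases "c \<ge> 0")
  case True
  then show ?thesis using n[of "nat c"] by simp
 next
  case False
  have "sc c v = 0 - sc (int (nat (- c))) v" using False by (auto simp: fun_eq_iff)
  moreover have "sc c (T v) = 0 - sc (int (nat (- c))) (T v)" using False by (auto simp: fun_eq_iff)
  ultimately show ?thesis by (simp only: endo_diff[OF assms] endo_0[OF assms] n)
 qed
qed

lemma endo_sum:
 assumes "endo I T"
 shows "T (\<Sum>a\<in>A. f a) = (\<Sum>a\<in>A. T (f a))"
 by (induct A rule: infinite_finite_induct)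
  (simp_all only: sum.infinite sum.empty sum.insert endo_0[OF assms] endo_add[OF assms] not_False_eq_True)

lemma endo_funpow: "endo I T \<Longrightarrow> endo I (T ^^ n)"
 by (induct n) (auto simp: endo_def)

lemma endo_minus_id: "endo I T \<Longrightarrow> endo I (\<lambda>v. T v - v)"
 by (auto simp: endo_def intro: vecs_closed(2))

definition unit_vec :: "'i \<Rightarrow> 'i \<Rightarrow> int" where
 "unit_vec i = (\<lambda>j. if j = i then 1 else 0)"

lemma unit_vec_mem: "i \<in> I \<Longrightarrow> unit_vec i \<in> vecs I"
 by (auto simp: unit_vec_def vecs_def)

lemma coord_expansion:
 assumes "finite I" "v \<in> vecs I"
 shows "v = (\<Sum>i\<in>I. sc (v i) (unit_vec i))"
proof
 fix j
 have "(\<Sum>i\<in>I. sc (v i) (unit_vec i)) j = (\<Sum>i\<in>I. if i = j then v j else 0)"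
  unfolding sum_fun_apply by (rule sum.cong) (auto simp: unit_vec_def)
 then show "v j = (\<Sum>i\<in>I. sc (v i) (unit_vec i)) j"
  using assms by (auto simp: vecs_def)
qed

lemma endo_expansion:
 assumes "finite I" "endo I T" "v \<in> vecs I"
 shows "T v = (\<Sum>i\<in>I. sc (v i) (T (unit_vec i)))"
 by (subst coord_expansion[OF assms(1,3)])
  (simp add: endo_sum[OF assms(2)] endo_sc[OF assms(2)])

text \<open>A substitute for the adjugate matrix. The unit vector i and the columns of T are one
  vector too many for \<open>card I\<close> coordinates, hence dependent; by injectivity the unit
  vector has a nonzero coefficient c i in the dependence, so c i times it is in the image.\<close>

lemma injective_endo_right_inverse:
 assumes I: "finite I" and T: "endo I T" and inj: "\<And>v. v \<in> vecs I \<Longrightarrow> T v = 0 \<Longrightarrow> v = 0"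
 shows "\<exists>D S. D \<noteq> 0 \<and> endo I S \<and> (\<forall>v\<in>vecs I. T (S v) = sc D v)"
proof -
 have "\<exists>c w. c \<noteq> 0 \<and> w \<in> vecs I \<and> T w = sc c (unit_vec i)" if i: "i \<in> I" for i
 proof -
  \<comment> \<open>\<open>None\<close> is the unknown coefficient of the unit vector i, and
    \<open>Some j\<close> is coordinate j of the preimage.\<close>
  define a where "a k u = (case u of None \<Rightarrow> - unit_vec i k | Some j \<Rightarrow> T (unit_vec j) k)" for k and u :: "'a option"
  have "card I < card (insert None (Some ` I))" using I by (simp add: card_image)
  from homogeneous_system_solution[OF I _ this, of a] I obtain x
   where x: "\<exists>u\<in>insert None (Some ` I). x u \<noteq> 0"
    "\<forall>k\<in>I. (\<Sum>u\<in>insert None (Some ` I). a k u * x u) = 0" by auto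
  define w where "w = (\<Sum>j\<in>I. sc (x (Some j)) (unit_vec j))"
  have w: "w \<in> vecs I" unfolding w_def by (intro vecs_sum vecs_closed unit_vec_mem)
  have Tw: "T w = sc (x None) (unit_vec i)"
  proof
   fix k
   show "T w k = sc (x None) (unit_vec i) k"
   proof (cases "k \<in> I")
    case True
    have "T w k = (\<Sum>j\<in>I. a k (Some j) * x (Some j))"
     unfolding w_def endo_sum[OF T] endo_sc[OF T] sum_fun_apply
     by (simp add: a_def mult.commute)
    moreover have "(\<Sum>u\<in>insert None (Some ` I). a k u * x u) = a k None * x None + (\<Sum>j\<in>I. a k (Some j) * x (Some j))"
     using I by (simp add: sum.reindex)
    ultimately show ?thesis using x(2) True by (simp add: a_def)
   next
    case False
    then show ?thesis using endo_mem[OF T w] i by (auto simp: vecs_def unit_vec_def)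
   qed
  qed
  have wi: "w j = x (Some j)" if "j \<in> I" for j
  proof -
   have "w j = (\<Sum>k\<in>I. if k = j then x (Some j) else 0)"
    unfolding w_def sum_fun_apply by (rule sum.cong) (auto simp: unit_vec_def)
   then show ?thesis using that I by simp
  qed
  have "x None \<noteq> 0"
  proof
   assume z: "x None = 0"
   then have "w = 0" using inj[OF w] Tw by (simp add: sc_simps)
   then have "x (Some j) = 0" if "j \<in> I" for j using wi[OF that] by simp
   then show False using x(1) z by auto
  qed
  then show ?thesis using w Tw by blast
 qed
 then obtain c w where cw: "\<And>i. i \<in> I \<Longrightarrow> c i \<noteq> 0" "\<And>i. i \<in> I \<Longrightarrow> w i \<in> vecs I"
  "\<And>i. i \<in> I \<Longrightarrow> T (w i) = sc (c i) (unit_vec i)" by metis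
 define D where "D = (\<Prod>i\<in>I. c i)"
 \<comment> \<open>The product over the other indices raises each individual multiple c i to the
   common multiple D.\<close>
 define S where "S v = (\<Sum>i\<in>I. sc (v i * (\<Prod>j\<in>I - {i}. c j)) (w i))" for v
 have "D \<noteq> 0" unfolding D_def using I cw(1) by simp
 moreover have "endo I S"
  unfolding endo_def S_def
  by (auto simp: distrib_right sc_simps sum.distrib intro!: vecs_sum vecs_closed cw)
 moreover have "T (S v) = sc D v" if v: "v \<in> vecs I" for v
 proof -
  have "T (S v) = (\<Sum>i\<in>I. sc (v i * (\<Prod>j\<in>I - {i}. c j)) (sc (c i) (unit_vec i)))"
   unfolding S_def endo_sum[OF T] endo_sc[OF T] by (simp add: cw)
  also have "\<dots> = (\<Sum>i\<in>I. sc D (sc (v i) (unit_vec i)))"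
  proof (rule sum.cong[OF refl])
   fix i assume "i \<in> I"
   then have "D = c i * (\<Prod>j\<in>I - {i}. c j)" unfolding D_def using I by (simp add: prod.remove)
   then show "sc (v i * (\<Prod>j\<in>I - {i}. c j)) (sc (c i) (unit_vec i)) = sc D (sc (v i) (unit_vec i))"
    by (simp add: sc_simps mult.assoc mult.left_commute mult.commute)
  qed
  also have "\<dots> = sc D v" unfolding sc_sum[symmetric] coord_expansion[OF I v, symmetric] ..
  finally show ?thesis .
 qed
 ultimately show ?thesis by blast
qed

section \<open>Powers congruent to the identity and the Skolem-Mahler-Lech argument\<close>

definition cong_id :: "'i set \<Rightarrow> int \<Rightarrow> (('i \<Rightarrow> int) \<Rightarrow> ('i \<Rightarrow> int)) \<Rightarrow> bool" where
 "cong_id I q T \<longleftrightarrow> (\<forall>v\<in>vecs I. \<forall>i. q dvd (T v - v) i)"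

lemma cong_id_funpow:
 assumes T: "endo I T" "cong_id I q T"
 shows "cong_id I q (T ^^ n)"
proof (induct n)
 case (Suc n)
 show ?case unfolding cong_id_def
 proof (intro ballI allI)
  fix v i assume v: "v \<in> vecs I"
  have "q dvd (T ((T ^^ n) v) - (T ^^ n) v) i"
   using T(2) endo_mem[OF endo_funpow[OF T(1)] v] unfolding cong_id_def by blast
  moreover have "q dvd ((T ^^ n) v - v) i" using Suc v unfolding cong_id_def by blast
  ultimately have "q dvd (T ((T ^^ n) v) - (T ^^ n) v) i + ((T ^^ n) v - v) i" by (rule dvd_add)
  then show "q dvd ((T ^^ Suc n) v - v) i" by simp
 qed
qed (simp add: cong_id_def)

text \<open>There are finitely many matrices modulo q, so two powers i < j of T agree. S inverts T
  up to the factor D, a unit modulo q, so the power i can be cancelled.\<close>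

lemma ex_cong_id_power:
 assumes I: "finite I" and T: "endo I T" and S: "endo I S"
  and inv: "\<And>v. v \<in> vecs I \<Longrightarrow> T (S v) = sc D v" and q: "q > 0" "coprime q D"
 shows "\<exists>b>0. cong_id I q (T ^^ b)"
proof -
 define f where "f n = (\<lambda>p\<in>I \<times> I. (T ^^ n) (unit_vec (fst p)) (snd p) mod q)" for n
 have "f n \<in> (I \<times> I) \<rightarrow>\<^sub>E {0..<q}" for n
  unfolding f_def restrict_PiE_iff using q(1) by simp
 then have "range f \<subseteq> (I \<times> I) \<rightarrow>\<^sub>E {0..<q}" by blast
 moreover have "finite ((I \<times> I) \<rightarrow>\<^sub>E {0..<q})" using I by (intro finite_PiE) auto
 ultimately have "finite (range f)" by (rule finite_subset)
 then have "\<not> inj f" using finite_imageD infinite_UNIV_nat by blast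
 then obtain i j where ij: "i < j" "f i = f j" unfolding inj_def by (metis linorder_neqE_nat)
 define b where "b = j - i"
 have dvd1: "q dvd ((T ^^ j) v - (T ^^ i) v) k" if v: "v \<in> vecs I" for v k
 proof (cases "k \<in> I")
  case True
  have e: "(T ^^ n) v k = (\<Sum>l\<in>I. v l * (T ^^ n) (unit_vec l) k)" for n
   by (subst endo_expansion[OF I endo_funpow[OF T] v]) (simp add: sum_fun_apply)
  have "q dvd (T ^^ j) (unit_vec l) k - (T ^^ i) (unit_vec l) k" if "l \<in> I" for l
   using fun_cong[OF ij(2), of "(l, k)"] that True by (simp add: f_def mod_eq_dvd_iff[symmetric])
  then have "q dvd (\<Sum>l\<in>I. v l * ((T ^^ j) (unit_vec l) k - (T ^^ i) (unit_vec l) k))"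
   by (intro dvd_sum) simp
  then show ?thesis by (simp add: e right_diff_distrib sum_subtractf)
 next
  case False
  then show ?thesis using endo_mem[OF endo_funpow[OF T] v]
   by (simp add: vecs_def)
 qed
 have inv_pow: "(T ^^ n) ((S ^^ n) v) = sc (D ^ n) v" if "v \<in> vecs I" for n v
  using that
 proof (induct n arbitrary: v)
  case (Suc n)
  have "(T ^^ Suc n) ((S ^^ Suc n) v) = (T ^^ n) (T (S ((S ^^ n) v)))" by (simp add: funpow_swap1)
  also have "\<dots> = sc D ((T ^^ n) ((S ^^ n) v))"
   using inv[OF endo_mem[OF endo_funpow[OF S] Suc(2)]] endo_sc[OF endo_funpow[OF T]]
   by simp
  finally show ?case unfolding Suc(1)[OF Suc(2)] sc_simps by (simp only: power_Suc)
 qed (simp add: sc_simps)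
 have "cong_id I q (T ^^ b)"
  unfolding cong_id_def
 proof (intro ballI allI)
  fix v k assume v: "v \<in> vecs I"
  have Sv: "(S ^^ i) v \<in> vecs I" by (rule endo_mem[OF endo_funpow[OF S] v])
  have "(T ^^ j) ((S ^^ i) v) = (T ^^ b) ((T ^^ i) ((S ^^ i) v))"
   using ij(1) unfolding b_def by (metis add.commute comp_apply funpow_add le_add_diff_inverse2 less_imp_le)
  then have "((T ^^ j) ((S ^^ i) v) - (T ^^ i) ((S ^^ i) v)) k = D ^ i * ((T ^^ b) v - v) k"
   by (simp add: inv_pow[OF v] endo_sc[OF endo_funpow[OF T]] right_diff_distrib)
  then have "q dvd D ^ i * ((T ^^ b) v - v) k" using dvd1[OF Sv, of k] by simp
  moreover have "coprime q (D ^ i)" using q(2) by simp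
  ultimately show "q dvd ((T ^^ b) v - v) k" by (simp only: coprime_dvd_mult_right_iff)
 qed
 then show ?thesis using ij(1) by (intro exI[of _ b]) (simp add: b_def)
qed

text \<open>The binomial theorem for B = id + (B - id), whose induction step is Pascal's
  rule.\<close>

lemma funpow_Newton_expansion:
 assumes B: "endo I B"
 shows "(B ^^ n) v = (\<Sum>j\<le>n. sc (int (n choose j)) (((\<lambda>v. B v - v) ^^ j) v))"
proof -
 define P where "P = (\<lambda>v. B v - v)"
 have P: "endo I P" unfolding P_def by (rule endo_minus_id[OF B])
 have "(B ^^ n) v = (\<Sum>j\<le>n. sc (int (n choose j)) ((P ^^ j) v))"
 proof (induct n)
  case 0
  show ?case by (simp add: sc_simps)
 next
  case (Suc n)
  have "(B ^^ Suc n) v = (B ^^ n) v + P ((B ^^ n) v)" by (simp add: P_def)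
  also have "\<dots> = (\<Sum>j\<le>n. sc (int (n choose j)) ((P ^^ j) v)) + (\<Sum>j\<le>n. sc (int (n choose j)) ((P ^^ Suc j) v))"
   unfolding Suc endo_sum[OF P] endo_sc[OF P] by simp
  also have "(\<Sum>j\<le>n. sc (int (n choose j)) ((P ^^ j) v)) = (\<Sum>j\<le>Suc n. sc (int (n choose j)) ((P ^^ j) v))"
   by (simp add: sc_simps binomial_eq_0)
  also have "(\<Sum>j\<le>Suc n. sc (int (n choose j)) ((P ^^ j) v)) =
    v + (\<Sum>j\<le>n. sc (int (n choose Suc j)) ((P ^^ Suc j) v))"
   by (subst sum.atMost_Suc_shift) (simp add: sc_simps)
  also have "v + (\<Sum>j\<le>n. sc (int (n choose Suc j)) ((P ^^ Suc j) v)) + (\<Sum>j\<le>n. sc (int (n choose j)) ((P ^^ Suc j) v))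
   = v + (\<Sum>j\<le>n. sc (int (Suc n choose Suc j)) ((P ^^ Suc j) v))"
   by (simp add: sum.distrib sc_simps add.assoc add.commute add.left_commute)
  also have "\<dots> = (\<Sum>j\<le>Suc n. sc (int (Suc n choose j)) ((P ^^ j) v))"
   by (subst sum.atMost_Suc_shift) (simp add: sc_simps del: binomial_Suc_Suc)
  finally show ?case .
 qed
 then show ?thesis unfolding P_def .
qed

lemma infinite_residue_class:
 assumes "infinite (S :: nat set)" "b > 0"
 shows "\<exists>a. infinite {k. a + b * k \<in> S}"
proof (rule ccontr)
 assume "\<not> ?thesis"
 then have "finite (\<Union>a<b. (\<lambda>k. a + b * k) ` {k. a + b * k \<in> S})" by auto
 moreover have "S \<subseteq> (\<Union>a<b. (\<lambda>k. a + b * k) ` {k. a + b * k \<in> S})"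
 proof
  fix n assume "n \<in> S"
  moreover have "n = n mod b + b * (n div b)" by simp
  ultimately have "n \<in> (\<lambda>k. n mod b + b * k) ` {k. n mod b + b * k \<in> S}" by (auto intro!: image_eqI[of _ _ "n div b"])
  then show "n \<in> (\<Union>a<b. (\<lambda>k. a + b * k) ` {k. a + b * k \<in> S})" using assms(2) by (intro UN_I[of "n mod b"]) auto
 qed
 ultimately show False using assms(1) finite_subset by blast
qed

text \<open>Skolem-Mahler-Lech for sums of matrix orbits. With b chosen so that every b-th power B t
  is the identity modulo p^2, the j-th power of B t - id is divisible by p^(2 j). Each coordinate
  along a residue class modulo b is therefore a series to which \<open>Newton_series_zero\<close>
  applies.\<close>

lemma vanishing_progression:
 assumes I: "finite I" and F: "finite F" and T: "\<And>t. t \<in> F \<Longrightarrow> endo I (T t)"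
  and inj: "\<And>t v. t \<in> F \<Longrightarrow> v \<in> vecs I \<Longrightarrow> T t v = 0 \<Longrightarrow> v = 0"
  and u: "\<And>t. t \<in> F \<Longrightarrow> u t \<in> vecs I"
  and inf: "infinite {n. (orbit_sum F T u n) = 0}"
 shows "\<exists>a b. b > 0 \<and> (\<forall>n. (orbit_sum F T u (a + b * n)) = 0)"
proof -
 have "\<exists>D S. D \<noteq> 0 \<and> endo I S \<and> (\<forall>v\<in>vecs I. T t (S v) = sc D v)" if "t \<in> F" for t
  by (rule injective_endo_right_inverse[OF I T[OF that] inj[OF that]])
 then obtain D S where DS: "\<And>t. t \<in> F \<Longrightarrow> D t \<noteq> 0" "\<And>t. t \<in> F \<Longrightarrow> endo I (S t)"
  "\<And>t v. t \<in> F \<Longrightarrow> v \<in> vecs I \<Longrightarrow> T t (S t v) = sc (D t) v" by metis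
 \<comment> \<open>A prime larger than every |D t| divides none of them, so all T t are invertible
   modulo p^2.\<close>
 obtain p where p: "prime p" "p > nat (\<Sum>t\<in>F. \<bar>D t\<bar>)" using bigger_prime by blast
 define q where "q = int p ^ 2"
 have q0: "q > 0" using p(1) by (simp add: q_def prime_gt_0_nat)
 have cop: "coprime q (D t)" if "t \<in> F" for t
 proof -
  have "\<bar>D t\<bar> \<le> (\<Sum>t\<in>F. \<bar>D t\<bar>)" using F that by (intro member_le_sum) auto
  then have "\<bar>D t\<bar> < int p" using p(2) by linarith
  then have "\<not> int p dvd D t" using dvd_imp_le_int[OF DS(1)[OF that], of "int p"] by auto
  then have "coprime (int p) (D t)" using p(1) by (simp add: prime_imp_coprime)
  then show ?thesis by (simp add: q_def)
 qed
 have "\<exists>b>0. cong_id I q (T t ^^ b)" if "t \<in> F" for t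
  by (rule ex_cong_id_power[OF I T[OF that] DS(2)[OF that] DS(3)[OF that] q0 cop[OF that]])
 then obtain \<beta> where \<beta>: "\<And>t. t \<in> F \<Longrightarrow> \<beta> t > 0" "\<And>t. t \<in> F \<Longrightarrow> cong_id I q (T t ^^ \<beta> t)" by metis
 define b where "b = (\<Prod>t\<in>F. \<beta> t)"
 have b0: "b > 0" unfolding b_def using \<beta>(1) by (intro prod_pos) auto
 define B where "B t = T t ^^ b" for t
 have B: "endo I (B t)" if "t \<in> F" for t unfolding B_def by (rule endo_funpow[OF T[OF that]])
 have congB: "cong_id I q (B t)" if "t \<in> F" for t
 proof -
  have "b = \<beta> t * (\<Prod>t\<in>F - {t}. \<beta> t)" unfolding b_def by (rule prod.remove[OF F that])
  then have "B t = (T t ^^ \<beta> t) ^^ (\<Prod>t\<in>F - {t}. \<beta> t)" by (simp only: B_def funpow_mult)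
  then show ?thesis using cong_id_funpow[OF endo_funpow[OF T[OF that]] \<beta>(2)[OF that]] by simp
 qed
 \<comment> \<open>Only one residue class with infinitely many zeros is needed; the orbit sum is
   restricted to it by starting from the vectors w t.\<close>
 obtain a where a: "infinite {k. a + b * k \<in> {n. (orbit_sum F T u n) = 0}}"
  using infinite_residue_class[OF inf b0] by blast
 define w where "w t = (T t ^^ a) (u t)" for t
 have w: "w t \<in> vecs I" if "t \<in> F" for t
  unfolding w_def by (rule endo_mem[OF endo_funpow[OF T[OF that]] u[OF that]])
 have split: "(T t ^^ (a + b * k)) (u t) = (B t ^^ k) (w t)" for t k
  unfolding B_def w_def funpow_mult by (subst add.commute) (simp add: funpow_add mult.commute)
 define P where "P t = (\<lambda>v. B t v - v)" for t
 have P: "endo I (P t)" if "t \<in> F" for t unfolding P_def by (rule endo_minus_id[OF B[OF that]])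
 have Pdvd: "q ^ j dvd (P t ^^ j) (w t) i" if t: "t \<in> F" for t j i
 proof (induct j arbitrary: i)
  case (Suc j)
  define v where "v = (\<lambda>i. (P t ^^ j) (w t) i div q ^ j)"
  have v: "(P t ^^ j) (w t) = sc (q ^ j) v" using Suc by (auto simp: v_def fun_eq_iff)
  have "v \<in> vecs I"
   using endo_mem[OF endo_funpow[OF P[OF t]] w[OF t], of j] by (auto simp: vecs_def v_def)
  then have "q dvd P t v i" using congB[OF t] unfolding cong_id_def P_def by blast
  moreover have "(P t ^^ Suc j) (w t) i = q ^ j * P t v i"
   by (simp add: v endo_sc[OF P[OF t]])
  ultimately show ?case by (simp add: mult.commute)
 qed simp
 have "(orbit_sum F B w k) i = 0" for k i
 proof (rule Newton_series_zero[OF p(1)])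
  show "int p ^ (2 * j) dvd (\<Sum>t\<in>F. (P t ^^ j) (w t) i)" for j
   using Pdvd[of _ j i] unfolding q_def power_mult[symmetric] by (intro dvd_sum) auto
  show "(orbit_sum F B w n) i = (\<Sum>j\<le>n. int (n choose j) * (\<Sum>t\<in>F. (P t ^^ j) (w t) i))" for n
  proof -
   have "(orbit_sum F B w n) i = (\<Sum>t\<in>F. \<Sum>j\<le>n. int (n choose j) * (P t ^^ j) (w t) i)"
    unfolding sum_fun_apply P_def
    by (rule sum.cong[OF refl], subst funpow_Newton_expansion[OF B]) (simp_all add: sum_fun_apply)
   also have "\<dots> = (\<Sum>j\<le>n. \<Sum>t\<in>F. int (n choose j) * (P t ^^ j) (w t) i)" by (rule sum.swap)
   finally show ?thesis by (simp add: sum_distrib_left)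
  qed
  have "{k. a + b * k \<in> {n. (orbit_sum F T u n) = 0}} \<subseteq> {n. (orbit_sum F B w n) i = 0}"
   by (auto simp: split)
  then show "infinite {n. (orbit_sum F B w n) i = 0}" using a finite_subset by blast
 qed
 then have "\<forall>n. (orbit_sum F T u (a + b * n)) = 0" unfolding split by (auto simp: fun_eq_iff)
 then show ?thesis using b0 by blast
qed

text \<open>A polynomial in B applied to v, where e is the number of coefficients; the degree is
  thus below e, and e = 0 gives the zero polynomial.\<close>

definition act :: "(('i \<Rightarrow> int) \<Rightarrow> ('i \<Rightarrow> int)) \<Rightarrow> (nat \<Rightarrow> int) \<Rightarrow> nat \<Rightarrow> ('i \<Rightarrow> int) \<Rightarrow> ('i \<Rightarrow> int)" where
 "act B x e v = (\<Sum>k<e. sc (x k) ((B ^^ k) v))"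

lemma funpow_act:
 assumes "endo I B"
 shows "(B ^^ n) (act B x e v) = (\<Sum>k<e. sc (x k) ((B ^^ (n + k)) v))"
 unfolding act_def endo_sum[OF endo_funpow[OF assms]] endo_sc[OF endo_funpow[OF assms]]
  funpow_add comp_apply ..

lemma act_mem:
 assumes "endo I B" "v \<in> vecs I"
 shows "act B x e v \<in> vecs I"
 unfolding act_def
 by (intro vecs_sum vecs_closed(3) endo_mem[OF endo_funpow[OF assms(1)] assms(2)])

lemma coord_eq_0_iff: "v \<in> vecs I \<Longrightarrow> v = 0 \<longleftrightarrow> (\<forall>i\<in>I. v i = 0)"
 by (auto simp: vecs_def fun_eq_iff)

lemma sc_eq_0_iff: "sc c v = 0 \<longleftrightarrow> c = 0 \<or> v = 0"
 by (auto simp: fun_eq_iff)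

text \<open>A relation of minimal support is killed by a polynomial \<open>f\<close> of minimal degree \<open>e\<close> in
 the operators. If more than \<open>card I + 1\<close> operators were involved, then on \<open>card I + 1\<close> of them
 the \<open>e * (card I + 1)\<close> coefficients of polynomials of degree less than \<open>e\<close> could be chosen
 to satisfy the \<open>e * card I\<close> equations of a relation with smaller support.\<close>

lemma support_reduction:
 assumes I: "finite I" and F: "finite F" and B: "\<And>t. t \<in> F \<Longrightarrow> endo I (B t)"
  and w0: "\<And>t. t \<in> F \<Longrightarrow> w0 t \<in> vecs I" "\<exists>t\<in>F. w0 t \<noteq> 0"
  and rel0: "\<And>n. (orbit_sum F B w0 n) = 0"
 shows "\<exists>E w. E \<subseteq> F \<and> card E \<le> card I + 1 \<and> (\<forall>t\<in>E. w t \<in> vecs I) \<and> (\<exists>t\<in>E. w t \<noteq> 0) \<and>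
  (\<forall>n. (orbit_sum E B w n) = 0)"
proof -
 define K where "K w \<longleftrightarrow> (\<forall>t\<in>F. w t \<in> vecs I) \<and> (\<forall>n. (orbit_sum F B w n) = 0)" for w
 define supp where "supp w = {t \<in> F. w t \<noteq> (0 :: 'a \<Rightarrow> int)}" for w
 have "K w0 \<and> supp w0 \<noteq> {}" using w0 rel0 unfolding K_def supp_def by auto
 from ex_has_least_nat[of "\<lambda>w. K w \<and> supp w \<noteq> {}", OF this, of "\<lambda>w. card (supp w)"]
 obtain w where w: "K w" "supp w \<noteq> {}"
  and min: "\<And>v. K v \<Longrightarrow> supp v \<noteq> {} \<Longrightarrow> card (supp w) \<le> card (supp v)" by blast
 have wI: "w t \<in> vecs I" if "t \<in> F" for t using w(1) that unfolding K_def by blast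
 have fs: "finite (supp v)" "supp v \<subseteq> F" for v using F by (auto simp: supp_def)
 have small: "v t = 0" if "K v" "card (supp v) < card (supp w)" "t \<in> F" for v t
  using min[OF that(1)] that(2,3) by (force simp: supp_def)
 have Bn: "endo I (B t ^^ n)" if "t \<in> F" for t n by (rule endo_funpow[OF B[OF that]])
 show ?thesis
 proof (cases "card (supp w) \<le> card I + 1")
  case True
  have "(\<Sum>t\<in>supp w. (B t ^^ n) (w t)) = (orbit_sum F B w n)" for n
   by (rule sum.mono_neutral_left[OF F fs(2)]) (auto simp: supp_def intro: endo_0[OF Bn])
  then have "(\<Sum>t\<in>supp w. (B t ^^ n) (w t)) = 0" for n using w(1) unfolding K_def by simp
  moreover have "\<exists>t\<in>supp w. w t \<noteq> 0" using w(2) by (auto simp: supp_def)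
  ultimately show ?thesis using True fs(2) wI by (intro exI[of _ "supp w"] exI[of _ w]) blast
 next
  case False
  then obtain E where E: "E \<subseteq> supp w" "card E = card I + 1" "finite E"
   using obtain_subset_with_card_n[of "card I + 1" "supp w"] by auto
  have EF: "E \<subseteq> F" using E(1) fs(2) by blast
  \<comment> \<open>\<open>Suc e\<close> coefficients: e is a bound for the degree of a nonzero
    polynomial that kills all w t simultaneously.\<close>
  define Ann where "Ann e \<longleftrightarrow> (\<exists>f. (\<exists>k<Suc e. f k \<noteq> 0) \<and> (\<forall>t\<in>F. act (B t) f (Suc e) (w t) = 0))" for e
  have "\<exists>e. Ann e"
  proof -
   \<comment> \<open>This degree bound leaves one coefficient more than the
     \<open>card F * card I\<close> equations.\<close>
   define e where "e = card (F \<times> I)"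
   have "card (F \<times> I) < card {..<Suc e}" by (simp add: e_def)
   from homogeneous_system_solution[OF _ _ this, of "\<lambda>q k. (B (fst q) ^^ k) (w (fst q)) (snd q)"] F I
   obtain f where f: "\<exists>k\<in>{..<Suc e}. f k \<noteq> 0"
    "\<forall>q\<in>F \<times> I. (\<Sum>k<Suc e. (B (fst q) ^^ k) (w (fst q)) (snd q) * f k) = 0" by auto
   have "act (B t) f (Suc e) (w t) = 0" if t: "t \<in> F" for t
    unfolding coord_eq_0_iff[OF act_mem[OF B[OF t] wI[OF t]]]
   proof
    fix i assume "i \<in> I"
    then show "act (B t) f (Suc e) (w t) i = 0"
     using bspec[OF f(2), of "(t, i)"] t unfolding act_def sum_fun_apply by (simp add: mult.commute)
   qed
   then show ?thesis using f(1) unfolding Ann_def by blast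
  qed
  define e where "e = (LEAST e. Ann e)"
  have Ae: "Ann e" unfolding e_def using \<open>\<exists>e. Ann e\<close> by (rule LeastI_ex)
  have least: "\<not> Ann e'" if "e' < e" for e' using that unfolding e_def by (rule not_less_Least)
  obtain f where f: "\<exists>k<Suc e. f k \<noteq> 0" "\<And>t. t \<in> F \<Longrightarrow> act (B t) f (Suc e) (w t) = 0"
   using Ae unfolding Ann_def by blast
  have minimal: "\<forall>k<e. g k = 0" if g: "\<And>t. t \<in> F \<Longrightarrow> act (B t) g e (w t) = 0" for g
  proof (cases e)
   case (Suc e')
   then show ?thesis using least[of e'] g unfolding Ann_def by auto
  qed simp
  \<comment> \<open>By minimality f has exact degree e, so its top term can be solved for in the
    recurrence used below.\<close>
  have fe: "f e \<noteq> 0"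
  proof
   assume z: "f e = 0"
   have "act (B t) f e (w t) = 0" if "t \<in> F" for t
    using f(2)[OF that] z by (simp add: act_def sc_simps)
   from minimal[OF this] f(1) z show False by (auto simp: less_Suc_eq)
  qed
  have e0: "e > 0"
  proof (rule ccontr)
   assume "\<not> e > 0"
   then have "sc (f 0) (w t) = 0" if "t \<in> F" for t using f(2)[OF that] by (simp add: act_def)
   then have "w t = 0" if "t \<in> F" for t using fe \<open>\<not> e > 0\<close> that by (simp add: sc_eq_0_iff)
   then show False using w(2) by (auto simp: supp_def)
  qed
  have card_lt: "card ({..<e} \<times> I) < card (E \<times> {..<e})"
   using e0 E by (simp add: card_cartesian_product mult.commute)
  \<comment> \<open>The relation is imposed only at the times n < e; the recurrence given by f takes
    care of all later times.\<close>
  from homogeneous_system_solution[OF _ _ this, of "\<lambda>q u. (B (fst u) ^^ (fst q + snd u)) (w (fst u)) (snd q)"] I E(3)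
  obtain x where x: "\<exists>u\<in>E \<times> {..<e}. x u \<noteq> 0"
   "\<forall>q\<in>{..<e} \<times> I. (\<Sum>u\<in>E \<times> {..<e}. (B (fst u) ^^ (fst q + snd u)) (w (fst u)) (snd q) * x u) = 0" by auto
  define v where "v t = (if t \<in> E then act (B t) (\<lambda>k. x (t, k)) e (w t) else 0)" for t
  have vI: "v t \<in> vecs I" if "t \<in> F" for t
   unfolding v_def using act_mem[OF B[OF that] wI[OF that]] vecs_closed(4) by auto
  have vF: "(orbit_sum F B v n) = (\<Sum>t\<in>E. (B t ^^ n) (act (B t) (\<lambda>k. x (t, k)) e (w t)))" for n
  proof -
   have "(orbit_sum F B v n) = (orbit_sum E B v n)"
    by (rule sum.mono_neutral_right[OF F EF]) (auto simp: v_def intro: endo_0[OF Bn])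
   also have "\<dots> = (\<Sum>t\<in>E. (B t ^^ n) (act (B t) (\<lambda>k. x (t, k)) e (w t)))"
    by (rule sum.cong) (simp_all add: v_def)
   finally show ?thesis .
  qed
  have sI: "(orbit_sum F B v n) \<in> vecs I" for n
   by (intro vecs_sum endo_mem[OF Bn] vI)
  have v_small: "orbit_sum F B v n = 0" if n: "n < e" for n
   unfolding coord_eq_0_iff[OF sI]
  proof
   fix i assume i: "i \<in> I"
   have "(orbit_sum F B v n) i = (\<Sum>t\<in>E. \<Sum>k<e. x (t, k) * (B t ^^ (n + k)) (w t) i)"
    unfolding vF sum_fun_apply
   proof (rule sum.cong[OF refl])
    fix t assume "t \<in> E"
    then have "t \<in> F" using EF by blast
    show "(B t ^^ n) (act (B t) (\<lambda>k. x (t, k)) e (w t)) i = (\<Sum>k<e. x (t, k) * (B t ^^ (n + k)) (w t) i)"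
     unfolding funpow_act[OF B[OF \<open>t \<in> F\<close>]] sum_fun_apply sc_apply ..
   qed
   also have "\<dots> = (\<Sum>u\<in>E \<times> {..<e}. (B (fst u) ^^ (n + snd u)) (w (fst u)) i * x u)"
    unfolding sum.cartesian_product by (rule sum.cong) (auto simp: mult.commute)
   also have "\<dots> = 0" using bspec[OF x(2), of "(n, i)"] n i by simp
   finally show "(orbit_sum F B v n) i = 0" .
  qed
  have fv: "(\<Sum>j<Suc e. sc (f j) ((B t ^^ (n + j)) (v t))) = 0" if t: "t \<in> F" for t n
  proof (cases "t \<in> E")
   case True
   have "(\<Sum>j<Suc e. sc (f j) ((B t ^^ (n + j)) (v t)))
     = (\<Sum>j<Suc e. \<Sum>k<e. sc (f j * x (t, k)) ((B t ^^ (n + j + k)) (w t)))"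
    using True by (simp only: v_def if_True funpow_act[OF B[OF t]] sc_sum sc_simps)
   also have "\<dots> = (\<Sum>k<e. \<Sum>j<Suc e. sc (f j * x (t, k)) ((B t ^^ (n + j + k)) (w t)))" by (rule sum.swap)
   also have "\<dots> = (\<Sum>k<e. sc (x (t, k)) ((B t ^^ (n + k)) (act (B t) f (Suc e) (w t))))"
    unfolding funpow_act[OF B[OF t]] sc_sum sc_simps by (simp only: ac_simps)
   also have "\<dots> = 0"
    unfolding f(2)[OF t] endo_0[OF Bn[OF t]] sc_simps by (rule sum.neutral) blast
   finally show ?thesis .
  next
   case False
   then have "v t = 0" by (simp add: v_def)
   then show ?thesis by (simp only: endo_0[OF Bn[OF t]] sc_simps sum.neutral_const)
  qed
  \<comment> \<open>Since f also kills every v t, the orbit sums of v satisfy the linear recurrence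
    with coefficients f. As f e is nonzero and the integers have no zero divisors, e initial zeros
    force all the others.\<close>
  have v_all: "orbit_sum F B v n = 0" for n
  proof (induct n rule: less_induct)
   case (less n)
   show ?case
   proof (cases "n < e")
    case False
    define l where "l = n - e"
    have n: "n = l + e" using False by (simp add: l_def)
    have "0 = (\<Sum>t\<in>F. \<Sum>j<Suc e. sc (f j) ((B t ^^ (l + j)) (v t)))"
     by (rule sum.neutral[symmetric]) (use fv in blast)
    also have "\<dots> = (\<Sum>j<Suc e. sc (f j) (orbit_sum F B v (l + j)))"
     unfolding sc_sum by (rule sum.swap)
    also have "\<dots> = (\<Sum>j<e. sc (f j) (orbit_sum F B v (l + j))) + sc (f e) (orbit_sum F B v n)"
     by (simp only: sum.lessThan_Suc n)
    also have "(\<Sum>j<e. sc (f j) (orbit_sum F B v (l + j))) = 0"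
    proof (rule sum.neutral, rule ballI)
     fix j assume "j \<in> {..<e}"
     then have "l + j < n" by (simp add: n)
     show "sc (f j) (orbit_sum F B v (l + j)) = 0"
      unfolding less[OF \<open>l + j < n\<close>] by (simp only: sc_simps)
    qed
    finally have "sc (f e) (orbit_sum F B v n) = 0" by (simp only: add_0)
    then show ?thesis using fe by (simp only: sc_eq_0_iff) blast
   qed (rule v_small)
  qed
  have "K v" unfolding K_def using vI v_all by blast
  moreover have "card (supp v) < card (supp w)"
  proof -
   have "supp v \<subseteq> E" by (auto simp: supp_def v_def)
   then have "card (supp v) \<le> card E" using E(3) by (rule card_mono[rotated])
   then show ?thesis using False E(2) by simp
  qed
  ultimately have v0: "v t = 0" if "t \<in> F" for t using small that by blast
  \<comment> \<open>All v t vanish, although the polynomial g attached to \<delta> is nonzero.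
    Applying this one g to every component of w gives a relation y that loses the component
    \<delta>, so y vanishes too. Then g kills every w t with degree below e, contrary to the choice
    of e.\<close>
  obtain \<delta> k where \<delta>: "\<delta> \<in> E" "k < e" "x (\<delta>, k) \<noteq> 0" using x(1) by auto
  define g where "g k = x (\<delta>, k)" for k
  define y where "y t = act (B t) g e (w t)" for t
  have "y \<delta> = 0" using v0[of \<delta>] \<delta>(1) EF unfolding y_def g_def v_def by auto
  have "K y"
   unfolding K_def
  proof (intro conjI ballI allI)
   show "y t \<in> vecs I" if "t \<in> F" for t unfolding y_def by (rule act_mem[OF B[OF that] wI[OF that]])
   fix n
   have "(orbit_sum F B y n) = (\<Sum>t\<in>F. \<Sum>k<e. sc (g k) ((B t ^^ (n + k)) (w t)))"
    unfolding y_def by (rule sum.cong[OF refl]) (rule funpow_act[OF B])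
   also have "\<dots> = (\<Sum>k<e. sc (g k) (orbit_sum F B w (n + k)))"
    unfolding sc_sum by (rule sum.swap)
   also have "\<dots> = 0"
    by (rule sum.neutral) (use w(1) in \<open>simp add: K_def sc_simps\<close>)
   finally show "orbit_sum F B y n = 0" .
  qed
  moreover have "card (supp y) < card (supp w)"
  proof (rule psubset_card_mono[OF fs(1)], rule psubsetI)
   show "supp y \<subseteq> supp w"
   proof
    fix t assume "t \<in> supp y"
    then have t: "t \<in> F" "y t \<noteq> 0" by (auto simp: supp_def)
    have "w t \<noteq> 0"
    proof
     assume "w t = 0"
     then have "y t = 0" unfolding y_def act_def
      by (simp only: endo_0[OF Bn[OF t(1)]] sc_simps sum.neutral_const)
     then show False using t(2) by blast
    qed
    then show "t \<in> supp w" using t(1) by (simp add: supp_def)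
   qed
   show "supp y \<noteq> supp w" using \<delta>(1) E(1) \<open>y \<delta> = 0\<close> by (auto simp: supp_def)
  qed
  ultimately have "y t = 0" if "t \<in> F" for t using small that by blast
  then have "g k = 0" using minimal[of g] \<delta>(2) unfolding y_def by blast
  then show ?thesis using \<delta>(3) by (simp add: g_def)
 qed
qed

section \<open>The character group as a lattice\<close>

lemma character_0: "f \<in> characters \<Longrightarrow> f 0 = 1"
 using character_nonzero[of f 0] unfolding characters_def
 by (metis (mono_tags, lifting) add_0 mem_Collect_eq mult_cancel_right1)

text \<open>Values that are n-th roots of unity form a finite set, and a continuous function with
  finitely many values on a connected space is constant.\<close>

lemma character_torsion_free:
 fixes f :: "'a::topological_ab_group_add \<Rightarrow> complex"
 assumes "connected (UNIV :: 'a set)" "f \<in> characters" "n > 0" "\<And>x. f x ^ n = 1"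
 shows "f x = 1"
proof -
 have "f ` UNIV \<subseteq> {z. z ^ n = 1}" using assms(4) by auto
 moreover have "finite {z :: complex. z ^ n = 1}" by (rule finite_roots_unity) (use assms(3) in simp)
 ultimately have "finite (f ` UNIV)" by (rule finite_subset)
 then have "f constant_on UNIV"
  by (rule continuous_finite_range_constant[OF assms(1), rotated]) (use assms(2) in \<open>simp add: characters_def\<close>)
 then have "f x = f 0" unfolding constant_on_def by auto
 then show ?thesis using character_0[OF assms(2)] by simp
qed

text \<open>The homomorphism from the lattice Z^A to the character group, turning additive relations
  between exponent vectors into multiplicative ones between characters.\<close>

definition char_comb :: "('a \<Rightarrow> complex) set \<Rightarrow> (('a \<Rightarrow> complex) \<Rightarrow> int) \<Rightarrow> 'a \<Rightarrow> complex" where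
 "char_comb A k x = (\<Prod>\<phi>\<in>A. \<phi> x powi k \<phi>)"

lemma character_powi:
 assumes "f \<in> characters"
 shows "(\<lambda>x. f x powi k) \<in> characters"
 using assms character_nonzero[OF assms] unfolding characters_def
 by (auto simp: norm_power_int power_int_mult_distrib intro!: continuous_on_power_int)

lemma char_comb_character: "A \<subseteq> characters \<Longrightarrow> char_comb A k \<in> characters"
 unfolding char_comb_def[abs_def] by (rule character_prod) (auto intro: character_powi)

lemma char_comb_0: "char_comb A 0 x = 1"
 by (simp add: char_comb_def)

lemma char_comb_add:
 assumes "A \<subseteq> characters"
 shows "char_comb A (k + l) x = char_comb A k x * char_comb A l x"
 unfolding char_comb_def prod.distrib[symmetric]
proof (rule prod.cong[OF refl])
 fix \<phi> assume "\<phi> \<in> A"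
 then have "\<phi> x \<noteq> 0" using assms character_nonzero by blast
 then show "\<phi> x powi (k + l) \<phi> = \<phi> x powi k \<phi> * \<phi> x powi l \<phi>" by (simp add: power_int_add)
qed

lemma char_comb_sc: "char_comb A (sc c k) x = char_comb A k x powi c"
proof -
 have "(\<Prod>\<phi>\<in>A. g \<phi> powi c) = (\<Prod>\<phi>\<in>A. g \<phi>) powi c" for g :: "_ \<Rightarrow> complex"
  by (induct A rule: infinite_finite_induct) (simp_all add: power_int_mult_distrib)
 then show ?thesis unfolding char_comb_def sc_apply mult.commute[of c] power_int_mult .
qed

lemma char_comb_sum:
 assumes "A \<subseteq> characters"
 shows "char_comb A (\<Sum>i\<in>S. k i) x = (\<Prod>i\<in>S. char_comb A (k i) x)"
 by (induct S rule: infinite_finite_induct)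
  (simp_all only: sum.infinite sum.empty sum.insert prod.infinite prod.empty prod.insert
   char_comb_0 char_comb_add[OF assms] not_False_eq_True)

lemma char_comb_eq_1:
 assumes "independent_characters A" "k \<in> vecs A" "\<And>x. char_comb A k x = 1"
 shows "k = 0"
 unfolding coord_eq_0_iff[OF assms(2)]
 using assms(1,3) unfolding independent_characters_def char_comb_def by blast

lemma maximal_independent_characters:
 assumes "group_dim TYPE('a::topological_ab_group_add) = enat d"
 shows "\<exists>A :: ('a \<Rightarrow> complex) set. independent_characters A \<and> card A = d"
  and "independent_characters (B :: ('a \<Rightarrow> complex) set) \<Longrightarrow> card B \<le> d"
proof -
 have le: "card B \<le> d" if "independent_characters B" for B :: "('a \<Rightarrow> complex) set"
 proof -
  have "enat (card B) \<le> group_dim TYPE('a)" unfolding group_dim_def by (rule SUP_upper) (use that in simp)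
  then show ?thesis by (simp add: assms)
 qed
 then show "independent_characters (B :: ('a \<Rightarrow> complex) set) \<Longrightarrow> card B \<le> d" .
 show "\<exists>A :: ('a \<Rightarrow> complex) set. independent_characters A \<and> card A = d"
 proof (rule ccontr)
  assume no: "\<not> ?thesis"
  have "independent_characters ({} :: ('a \<Rightarrow> complex) set)" by (simp add: independent_characters_def)
  \<comment> \<open>The empty set is independent of size 0. Hence d - 1 is a genuine predecessor and
    a smaller upper bound.\<close>
  then have "d > 0" using no by (metis card.empty gr0I)
  have "group_dim TYPE('a) \<le> enat (d - 1)" unfolding group_dim_def
  proof (rule SUP_least)
   fix A :: "('a \<Rightarrow> complex) set" assume "A \<in> {A. independent_characters A}"
   then have "card A \<le> d" "card A \<noteq> d" using le no by auto
   then show "enat (card A) \<le> enat (d - 1)" by simp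
  qed
  then show False using \<open>d > 0\<close> by (simp add: assms)
 qed
qed

text \<open>Adjoining f to a maximal independent set creates a relation, in which the exponent of f
  is nonzero because A is independent. The sign of that exponent decides on which side the relation
  is inverted. A member of A is treated apart, as adjoining it creates nothing new.\<close>

lemma character_multiple_in_lattice:
 fixes A :: "('a::topological_ab_group_add \<Rightarrow> complex) set"
 assumes A: "independent_characters A" and max: "\<And>B :: ('a \<Rightarrow> complex) set. independent_characters B \<Longrightarrow> card B \<le> card A"
  and f: "f \<in> characters"
 shows "\<exists>N>0. \<exists>k\<in>vecs A. \<forall>x. f x ^ N = char_comb A k x"
proof (cases "f \<in> A")
 case True
 have fin: "finite A" using A by (simp add: independent_characters_def)
 have "char_comb A (unit_vec f) x = f x" for x
 proof -
  have "char_comb A (unit_vec f) x = (\<Prod>\<phi>\<in>A. if \<phi> = f then f x else 1)"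
   unfolding char_comb_def by (rule prod.cong) (auto simp: unit_vec_def)
  then show ?thesis using True fin by simp
 qed
 then show ?thesis using unit_vec_mem[OF True]
  by (intro exI[of _ 1] conjI bexI[of _ "unit_vec f"]) simp_all
next
 case False
 have fin: "finite A" and Ac: "A \<subseteq> characters" using A by (auto simp: independent_characters_def)
 have "\<not> independent_characters (insert f A)" using max[of "insert f A"] False fin by auto
 moreover have "insert f A \<subseteq> characters \<and> finite (insert f A)" using fin Ac f by simp
 ultimately have "\<not> (\<forall>k::('a \<Rightarrow> complex) \<Rightarrow> int. (\<forall>x. (\<Prod>\<phi>\<in>insert f A. \<phi> x powi k \<phi>) = 1) \<longrightarrow>
   (\<forall>\<phi>\<in>insert f A. k \<phi> = 0))"
  unfolding independent_characters_def by argo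
 then obtain k :: "('a \<Rightarrow> complex) \<Rightarrow> int"
  where k: "\<forall>x. (\<Prod>\<phi>\<in>insert f A. \<phi> x powi k \<phi>) = 1" "\<not> (\<forall>\<phi>\<in>insert f A. k \<phi> = 0)"
  unfolding not_all not_imp by (elim exE conjE)
 define l where "l = (\<lambda>\<phi>. if \<phi> \<in> A then k \<phi> else 0)"
 have l: "l \<in> vecs A" by (simp add: l_def vecs_def)
 have rel: "f x powi k f * char_comb A l x = 1" for x
 proof -
  have "char_comb A l x = (\<Prod>\<phi>\<in>A. \<phi> x powi k \<phi>)" unfolding char_comb_def by (rule prod.cong) (auto simp: l_def)
  then show ?thesis using k(1) fin False by simp
 qed
 have "k f \<noteq> 0"
 proof
  assume z: "k f = 0"
  then have "l = 0" using rel by (intro char_comb_eq_1[OF A l]) simp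
  then have "l \<phi> = 0" for \<phi> by (simp only: zero_fun_apply)
  then have "k \<phi> = 0" if "\<phi> \<in> A" for \<phi> using that unfolding l_def by metis
  then show False using k(2) z by auto
 qed
 have f0: "f x \<noteq> 0" for x by (rule character_nonzero[OF f])
 show ?thesis
 proof (cases "k f > 0")
  case True
  have "f x ^ nat (k f) = char_comb A (sc (-1) l) x" for x
  proof -
   have "f x powi k f = inverse (char_comb A l x)" using rel[of x] by (metis inverse_unique mult.commute)
   moreover have "f x powi k f = f x ^ nat (k f)" using True by (simp add: power_int_def)
   ultimately show ?thesis by (simp only: char_comb_sc power_int_minus power_int_1_right)
  qed
  then show ?thesis using True vecs_closed(3)[OF l, of "-1"]
   by (intro exI[of _ "nat (k f)"] conjI bexI[of _ "sc (-1) l"]) simp_all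
 next
  case False
  with \<open>k f \<noteq> 0\<close> have neg: "k f < 0" by simp
  have "f x ^ nat (- k f) = char_comb A l x" for x
  proof -
   have "f x powi k f = inverse (f x ^ nat (- k f))" using neg by (simp add: power_int_def power_inverse)
   then have "inverse (f x ^ nat (- k f)) * char_comb A l x = 1" using rel[of x] by simp
   moreover have "p = q" if "inverse p * q = 1" for p q :: complex
    using that by (metis inverse_inverse_eq inverse_unique)
   ultimately show ?thesis by blast
  qed
  then show ?thesis using neg l by (intro exI[of _ "nat (- k f)"] conjI bexI[of _ l]) simp_all
 qed
qed

lemma common_multiple_in_lattice:
 fixes A :: "('a::topological_ab_group_add \<Rightarrow> complex) set"
 assumes A: "independent_characters A" and max: "\<And>B :: ('a \<Rightarrow> complex) set. independent_characters B \<Longrightarrow> card B \<le> card A"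
  and P: "finite P" "P \<subseteq> characters"
 shows "\<exists>N>0. \<exists>c. \<forall>f\<in>P. c f \<in> vecs A \<and> (\<forall>x. f x ^ N = char_comb A (c f) x)"
 using P
proof (induct P rule: finite_induct)
 case empty
 then show ?case by auto
next
 case (insert g P)
 then obtain N c where N: "N > 0" "\<forall>f\<in>P. c f \<in> vecs A \<and> (\<forall>x. f x ^ N = char_comb A (c f) x)" by auto
 obtain M k where M: "M > 0" "k \<in> vecs A" "\<forall>x. g x ^ M = char_comb A k x"
  using character_multiple_in_lattice[OF A max, of g] insert(4) by blast
 define c' where "c' f = (if f = g then sc (int N) k else sc (int M) (c f))" for f
 have "c' f \<in> vecs A \<and> (\<forall>x. f x ^ (M * N) = char_comb A (c' f) x)" if f: "f \<in> insert g P" for f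
 proof (cases "f = g")
  case True
  have "g x ^ (M * N) = char_comb A (sc (int N) k) x" for x
   unfolding char_comb_sc power_mult using M(3) by simp
  then show ?thesis using True vecs_closed(3)[OF M(2), of "int N"] by (simp only: c'_def if_True refl) blast
 next
  case False
  then have f: "f \<in> P" using f by simp
  have "f x ^ (M * N) = char_comb A (sc (int M) (c f)) x" for x
  proof -
   have "f x ^ (M * N) = (f x ^ N) ^ M" by (simp add: power_mult[symmetric] mult.commute)
   then show ?thesis unfolding char_comb_sc using N(2) f by simp
  qed
  then show ?thesis using False f N(2) vecs_closed(3)[of "c f" A "int M"] by (simp only: c'_def if_False) blast
 qed
 then show ?case using N(1) M(1) by (intro exI[of _ "M * N"]) auto
qed

text \<open>The dual action of the epimorphisms on characters, up to a common denominator \<open>N\<close>, by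
 endomorphisms of the lattice spanned by a maximal independent set of characters.\<close>

lemma dual_lattice_action:
 fixes A :: "('a::topological_ab_group_add \<Rightarrow> complex) set"
 assumes conn: "connected (UNIV :: 'a set)"
  and A: "independent_characters A" and max: "\<And>B :: ('a \<Rightarrow> complex) set. independent_characters B \<Longrightarrow> card B \<le> card A"
  and F: "finite F" "\<And>t. t \<in> F \<Longrightarrow> epimorphism t"
 shows "\<exists>T. (\<forall>t\<in>F. endo A (T t) \<and> (\<forall>v\<in>vecs A. T t v = 0 \<longrightarrow> v = 0)) \<and>
  (\<forall>G u n. G \<subseteq> F \<and> (\<forall>t\<in>G. u t \<in> vecs A) \<longrightarrow>
   ((\<forall>x. (\<Prod>t\<in>G. char_comb A (u t) ((t ^^ n) x)) = 1) \<longleftrightarrow> (orbit_sum G T u n) = 0))"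
proof -
 have fin: "finite A" and Ac: "A \<subseteq> characters" using A by (auto simp: independent_characters_def)
 define P where "P = (\<lambda>(t, \<phi>). \<phi> \<circ> t) ` (F \<times> A)"
 have "finite P" unfolding P_def using F(1) fin by auto
 moreover have "P \<subseteq> characters"
 proof
  fix f assume "f \<in> P"
  then obtain t \<phi> where "t \<in> F" "\<phi> \<in> A" "f = \<phi> \<circ> t" by (auto simp: P_def)
  then show "f \<in> characters" using character_comp[of \<phi> t] Ac F(2) by (auto simp: o_def)
 qed
 ultimately have "\<exists>N>0. \<exists>c. \<forall>f\<in>P. c f \<in> vecs A \<and> (\<forall>x. f x ^ N = char_comb A (c f) x)"
  by (intro common_multiple_in_lattice[OF A max])
 then obtain N c where N: "N > 0" "\<forall>f\<in>P. c f \<in> vecs A \<and> (\<forall>x. f x ^ N = char_comb A (c f) x)"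
  by (elim exE conjE)
 have c: "c (\<phi> \<circ> t) \<in> vecs A" "\<phi> (t x) ^ N = char_comb A (c (\<phi> \<circ> t)) x" if "t \<in> F" "\<phi> \<in> A" for t \<phi> x
 proof -
  have "\<phi> \<circ> t \<in> P" using that by (auto simp: P_def)
  then show "c (\<phi> \<circ> t) \<in> vecs A" "\<phi> (t x) ^ N = char_comb A (c (\<phi> \<circ> t)) x" using N(2) by (auto simp: o_def)
 qed
 \<comment> \<open>T t is N times the dual of t, written in the coordinates of A.\<close>
 define T where "T t v = (\<Sum>\<phi>\<in>A. sc (v \<phi>) (c (\<phi> \<circ> t)))" for t v
 have T: "endo A (T t)" if "t \<in> F" for t
  unfolding endo_def T_def
 proof (intro conjI allI ballI)
  show "(\<Sum>\<phi>\<in>A. sc ((u + v) \<phi>) (c (\<phi> \<circ> t))) = (\<Sum>\<phi>\<in>A. sc (u \<phi>) (c (\<phi> \<circ> t))) + (\<Sum>\<phi>\<in>A. sc (v \<phi>) (c (\<phi> \<circ> t)))" for u v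
   by (simp only: plus_fun_apply sc_simps sum.distrib)
  show "(\<Sum>\<phi>\<in>A. sc (v \<phi>) (c (\<phi> \<circ> t))) \<in> vecs A" for v
   by (intro vecs_sum vecs_closed(3) c(1) that)
 qed
 have ET: "char_comb A (T t v) x = char_comb A v (t x) ^ N" if t: "t \<in> F" for t v x
 proof -
  have "char_comb A (T t v) x = (\<Prod>\<phi>\<in>A. char_comb A (c (\<phi> \<circ> t)) x powi v \<phi>)"
   unfolding T_def char_comb_sum[OF Ac] char_comb_sc ..
  also have "\<dots> = (\<Prod>\<phi>\<in>A. (\<phi> (t x) powi v \<phi>) ^ N)"
  proof (rule prod.cong[OF refl])
   fix \<phi> assume "\<phi> \<in> A"
   then have "char_comb A (c (\<phi> \<circ> t)) x powi v \<phi> = (\<phi> (t x) ^ N) powi v \<phi>" using c(2)[OF t] by simp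
   also have "\<dots> = (\<phi> (t x) powi v \<phi>) ^ N"
    by (metis power_int_mult power_int_of_nat mult.commute)
   finally show "char_comb A (c (\<phi> \<circ> t)) x powi v \<phi> = (\<phi> (t x) powi v \<phi>) ^ N" .
  qed
  also have "\<dots> = char_comb A v (t x) ^ N" unfolding char_comb_def prod_power_distrib ..
  finally show ?thesis .
 qed
 have ETn: "char_comb A ((T t ^^ n) v) x = char_comb A v ((t ^^ n) x) ^ (N ^ n)" if t: "t \<in> F" for t v x n
 proof (induct n arbitrary: x)
  case (Suc n)
  have "char_comb A ((T t ^^ Suc n) v) x = char_comb A ((T t ^^ n) v) (t x) ^ N" using ET[OF t] by simp
  also have "\<dots> = char_comb A v ((t ^^ n) (t x)) ^ (N ^ Suc n)"
   unfolding Suc by (simp add: power_mult[symmetric] mult.commute)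
  finally show ?case by (simp add: funpow_swap1)
 qed simp
 \<comment> \<open>If T t kills v, the character of v composed with t has trivial N-th power, so it
   is trivial; surjectivity of t then makes the character itself trivial.\<close>
 have inj: "v = 0" if t: "t \<in> F" and v: "v \<in> vecs A" "T t v = 0" for t v
 proof (rule char_comb_eq_1[OF A v(1)])
  fix x
  obtain y where y: "x = t y" using F(2)[OF t] unfolding epimorphism_def surj_def by blast
  have "char_comb A v (t z) ^ N = 1" for z using ET[OF t, of v z] v(2) char_comb_0[of A z] by simp
  from character_torsion_free[OF conn character_comp[OF char_comb_character[OF Ac] F(2)[OF t]] N(1) this]
  show "char_comb A v x = 1" unfolding y .
 qed
 have rel: "(\<forall>x. (\<Prod>t\<in>G. char_comb A (u t) ((t ^^ n) x)) = 1) \<longleftrightarrow> (orbit_sum G T u n) = 0"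
  if G: "G \<subseteq> F" and u: "\<forall>t\<in>G. u t \<in> vecs A" for G u n
 proof -
  have E: "char_comb A (orbit_sum G T u n) x = (\<Prod>t\<in>G. char_comb A (u t) ((t ^^ n) x)) ^ (N ^ n)" for x
   unfolding char_comb_sum[OF Ac] prod_power_distrib
   by (rule prod.cong[OF refl]) (use ETn G in blast)
  have sI: "(orbit_sum G T u n) \<in> vecs A"
  proof (rule vecs_sum)
   fix t assume "t \<in> G"
   then show "(T t ^^ n) (u t) \<in> vecs A" using G u endo_mem[OF endo_funpow[OF T]] by blast
  qed
  have char: "(\<lambda>x. \<Prod>t\<in>G. char_comb A (u t) ((t ^^ n) x)) \<in> characters"
  proof (rule character_prod)
   fix t assume "t \<in> G"
   then show "(\<lambda>x. char_comb A (u t) ((t ^^ n) x)) \<in> characters"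
    using G by (intro character_comp[OF char_comb_character[OF Ac] epi_funpow[OF F(2)]]) blast
  qed
  show ?thesis
  proof
   assume "\<forall>x. (\<Prod>t\<in>G. char_comb A (u t) ((t ^^ n) x)) = 1"
   then show "orbit_sum G T u n = 0" by (intro char_comb_eq_1[OF A sI]) (simp only: E power_one)
  next
   assume "orbit_sum G T u n = 0"
   then have "(\<Prod>t\<in>G. char_comb A (u t) ((t ^^ n) x)) ^ (N ^ n) = 1" for x
    using E[of x] char_comb_0[of A x] by simp
   then show "\<forall>x. (\<Prod>t\<in>G. char_comb A (u t) ((t ^^ n) x)) = 1"
    using character_torsion_free[OF conn char, of "N ^ n"] N(1) by simp
  qed
 qed
 show ?thesis
 proof (rule exI[of _ T], intro conjI ballI allI)
  show "endo A (T t)" if "t \<in> F" for t by (rule T[OF that])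
  show "T t v = 0 \<longrightarrow> v = 0" if "t \<in> F" "v \<in> vecs A" for t v using inj[OF that] by (rule impI)
  show "G \<subseteq> F \<and> (\<forall>t\<in>G. u t \<in> vecs A) \<longrightarrow>
   ((\<forall>x. (\<Prod>t\<in>G. char_comb A (u t) ((t ^^ n) x)) = 1) \<longleftrightarrow> (orbit_sum G T u n) = 0)" for G u n
   by (rule impI, erule conjE, rule rel)
 qed
qed

section \<open>Proof of the equivalence\<close>

theorem theorem1p2:
  fixes m :: "'a::{topological_ab_group_add, t2_space} measure"
    and F :: "('a \<Rightarrow> 'a) set"
    and d :: nat
  assumes "compact (UNIV :: 'a set)"
    and "connected (UNIV :: 'a set)"
    and "normalized_haar m"
    and "group_dim TYPE('a) = enat d"
    and "finite F"
    and "\<forall>\<gamma>\<in>F. epimorphism \<gamma>"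
    and "card F > d"
  shows "mixing m F \<longleftrightarrow> (\<forall>E. E \<subseteq> F \<and> card E = d + 1 \<longrightarrow> mixing m E)"
proof -
 interpret compact_haar m by (unfold_locales) (rule assms)+
 have epi: "\<And>t. t \<in> F \<Longrightarrow> epimorphism t" using assms(6) by blast
 show ?thesis
 proof (cases "d = 0")
  \<comment> \<open>Both sides are false for d = 0. The group is trivial, because a nontrivial
    character would form an independent set; so it has only one self-map and F cannot have two
    elements. On the right, a singleton is never mixing.\<close>
  case True
  have triv: "x = 0" for x :: 'a
  proof (rule ccontr)
   assume "x \<noteq> 0"
   then obtain \<psi> :: "'a \<Rightarrow> complex" where \<psi>: "\<psi> \<in> characters" "\<psi> x \<noteq> 1" using characters_separate_zero by blast
   have "k = 0" if "\<forall>x. \<psi> x powi k = 1" for k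
   proof (rule ccontr)
    assume "k \<noteq> 0"
    have "\<psi> y ^ nat \<bar>k\<bar> = 1" for y
     using spec[OF that, of y] by (auto simp: power_int_def power_inverse abs_if split: if_splits)
    from character_torsion_free[OF assms(2) \<psi>(1) _ this] show False using \<open>k \<noteq> 0\<close> \<psi>(2) by simp
   qed
   then have "independent_characters {\<psi>}" using \<psi>(1) by (simp add: independent_characters_def)
   from maximal_independent_characters(2)[OF assms(4) this] show False using True by simp
  qed
  have "\<not> mixing m F"
  proof
   assume "mixing m F"
   then have "card F > 1" by (simp add: mixing_def)
   moreover have "t = \<delta>" for t \<delta> :: "'a \<Rightarrow> 'a" using triv by (metis ext)
   ultimately show False using card_le_Suc0_iff_eq[OF assms(5)] by (metis One_nat_def not_le)
  qed
  moreover obtain t where "t \<in> F" using assms(7) True by (metis card_gt_0_iff ex_in_conv)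
  moreover have "\<not> mixing m {t}" by (simp add: mixing_def)
  ultimately show ?thesis using True by (metis One_nat_def add_0 card.empty card_insert_disjoint empty_iff
     empty_subsetI finite.emptyI insert_subset)
 next
  case False
  then have cardF: "card F > 1" using assms(7) by simp
  have E_facts: "finite E" "card E > 1" "\<And>t. t \<in> E \<Longrightarrow> epimorphism t" if "E \<subseteq> F" "card E = d + 1" for E
   using that False assms(5) epi finite_subset by auto
  have mixF: "mixing m F \<longleftrightarrow> (\<forall>f. (\<forall>t\<in>F. f t \<in> characters) \<and> (\<exists>t\<in>F. \<exists>x. f t x \<noteq> 1) \<longrightarrow>
    finite (relation_times F f))"
   by (rule mixing_iff_characters[OF assms(5) cardF epi])
  have mixE: "mixing m E \<longleftrightarrow> (\<forall>f. (\<forall>t\<in>E. f t \<in> characters) \<and> (\<exists>t\<in>E. \<exists>x. f t x \<noteq> 1) \<longrightarrow>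
    finite (relation_times E f))" if "E \<subseteq> F" "card E = d + 1" for E
   by (rule mixing_iff_characters[OF E_facts(1,2,3)[OF that]])
  show ?thesis
  proof (intro iffI allI impI)
   fix E assume mix: "mixing m F" and "E \<subseteq> F \<and> card E = d + 1"
   then have E: "E \<subseteq> F" "card E = d + 1" by auto
   show "mixing m E" unfolding mixE[OF E]
   proof (intro allI impI)
    fix f :: "('a \<Rightarrow> 'a) \<Rightarrow> 'a \<Rightarrow> complex"
    assume f: "(\<forall>t\<in>E. f t \<in> characters) \<and> (\<exists>t\<in>E. \<exists>x. f t x \<noteq> 1)"
    \<comment> \<open>Padding with trivial characters turns a relation over E into one over F with
      the same times.\<close>
    define h where "h t = (if t \<in> E then f t else (\<lambda>x. 1))" for t
    have "\<forall>t\<in>F. h t \<in> characters" using f character_const_1 by (auto simp: h_def)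
    moreover have "\<exists>t\<in>F. \<exists>x. h t x \<noteq> 1" using f E(1) unfolding h_def by force
    ultimately have "finite (relation_times F h)" using mix unfolding mixF by blast
    moreover have "(orbit_prod F h n x) = (orbit_prod E f n x)" for n x
     using prod.mono_neutral_cong_right[OF assms(5) E(1), of "\<lambda>t. h t ((t ^^ n) x)" "\<lambda>t. f t ((t ^^ n) x)"]
     by (simp add: h_def)
    ultimately show "finite (relation_times E f)" by simp
   qed
  next
   assume sub: "\<forall>E. E \<subseteq> F \<and> card E = d + 1 \<longrightarrow> mixing m E"
   show "mixing m F" unfolding mixF
   proof (intro allI impI, rule ccontr)
    fix f :: "('a \<Rightarrow> 'a) \<Rightarrow> 'a \<Rightarrow> complex"
    assume f: "(\<forall>t\<in>F. f t \<in> characters) \<and> (\<exists>t\<in>F. \<exists>x. f t x \<noteq> 1)"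
     and inf: "infinite (relation_times F f)"
    obtain A :: "('a \<Rightarrow> complex) set" where A: "independent_characters A" "card A = d"
     using maximal_independent_characters(1)[OF assms(4)] by blast
    have max: "card B \<le> card A" if "independent_characters B" for B :: "('a \<Rightarrow> complex) set"
     using maximal_independent_characters(2)[OF assms(4) that] A(2) by simp
    have fin: "finite A" and Ac: "A \<subseteq> characters" using A(1) by (auto simp: independent_characters_def)
    have "\<exists>T. (\<forall>t\<in>F. endo A (T t) \<and> (\<forall>v\<in>vecs A. T t v = 0 \<longrightarrow> v = 0)) \<and>
     (\<forall>G u n. G \<subseteq> F \<and> (\<forall>t\<in>G. u t \<in> vecs A) \<longrightarrow>
      ((\<forall>x. (\<Prod>t\<in>G. char_comb A (u t) ((t ^^ n) x)) = 1) \<longleftrightarrow> (orbit_sum G T u n) = 0))"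
     by (rule dual_lattice_action[OF assms(2) A(1) max assms(5) epi])
    then obtain T where T': "\<forall>t\<in>F. endo A (T t) \<and> (\<forall>v\<in>vecs A. T t v = 0 \<longrightarrow> v = 0)"
     and rel': "\<forall>G u n. G \<subseteq> F \<and> (\<forall>t\<in>G. u t \<in> vecs A) \<longrightarrow>
      ((\<forall>x. (\<Prod>t\<in>G. char_comb A (u t) ((t ^^ n) x)) = 1) \<longleftrightarrow> (orbit_sum G T u n) = 0)"
     by (elim exE conjE)
    have T: "\<And>t. t \<in> F \<Longrightarrow> endo A (T t)"
     and inj: "\<And>t v. t \<in> F \<Longrightarrow> v \<in> vecs A \<Longrightarrow> T t v = 0 \<Longrightarrow> v = 0"
     using T' by simp_all
    have rel: "(\<forall>x. (\<Prod>t\<in>G. char_comb A (u t) ((t ^^ n) x)) = 1) \<longleftrightarrow> (orbit_sum G T u n) = 0"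
     if "G \<subseteq> F" "\<forall>t\<in>G. u t \<in> vecs A" for G u n
     by (rule rel'[rule_format]) (use that in blast)
    have "finite (f ` F)" "f ` F \<subseteq> characters" using assms(5) f by auto
    then have "\<exists>N>0. \<exists>c. \<forall>g\<in>f ` F. c g \<in> vecs A \<and> (\<forall>x. g x ^ N = char_comb A (c g) x)"
     by (intro common_multiple_in_lattice[OF A(1) max])
    then obtain N c where N: "N > 0"
     "\<forall>g\<in>f ` F. c g \<in> vecs A \<and> (\<forall>x. g x ^ N = char_comb A (c g) x)" by (elim exE conjE)
    define u where "u t = c (f t)" for t
    have u: "\<And>t. t \<in> F \<Longrightarrow> u t \<in> vecs A" and fu: "\<And>t x. t \<in> F \<Longrightarrow> f t x ^ N = char_comb A (u t) x"
     using N(2) by (auto simp: u_def)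
    obtain \<beta> z where \<beta>: "\<beta> \<in> F" "f \<beta> z \<noteq> 1" using f by blast
    \<comment> \<open>Taking N-th powers loses no nontrivial character, again because the character
      group is torsion-free.\<close>
    have u0: "u \<beta> \<noteq> 0"
    proof
     assume "u \<beta> = 0"
     then have r: "f \<beta> x ^ N = 1" for x using fu[OF \<beta>(1), of x] char_comb_0[of A x] by simp
     have f\<beta>: "f \<beta> \<in> characters" using f \<beta>(1) by blast
     have "f \<beta> z = 1" by (rule character_torsion_free[of "f \<beta>" N z, OF assms(2) f\<beta> N(1) r])
     then show False using \<beta>(2) by blast
    qed
    have "(relation_times F f) \<subseteq> {n. (orbit_sum F T u n) = 0}"
    proof
     fix n assume "n \<in> (relation_times F f)"
     then have n: "(orbit_prod F f n x) = 1" for x by blast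
     have "(\<Prod>t\<in>F. char_comb A (u t) ((t ^^ n) x)) = (orbit_prod F f n x) ^ N" for x
      unfolding prod_power_distrib by (rule prod.cong) (simp_all add: fu)
     then have "\<forall>x. (\<Prod>t\<in>F. char_comb A (u t) ((t ^^ n) x)) = 1" by (simp only: n power_one) blast
     then show "n \<in> {n. (orbit_sum F T u n) = 0}" using rel[of F u n] u by blast
    qed
    then have "infinite {n. (orbit_sum F T u n) = 0}" using inf infinite_super by blast
    then have "\<exists>a b. b > 0 \<and> (\<forall>n. (orbit_sum F T u (a + b * n)) = 0)"
     by (intro vanishing_progression[OF fin assms(5) T inj u])
    then obtain a b
     where b: "b > 0" "\<forall>n. (orbit_sum F T u (a + b * n)) = 0" by (elim exE conjE)
    \<comment> \<open>The relation at the times a + b n becomes a relation at all times n for the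
      b-th powers, started at the vectors w t.\<close>
    define B where "B t = T t ^^ b" for t
    define w where "w t = (T t ^^ a) (u t)" for t
    have Bw: "(B t ^^ n) ((T t ^^ k) v) = (T t ^^ (k + b * n)) v" for t n k v
     unfolding B_def funpow_mult by (subst add.commute) (simp add: funpow_add mult.commute)
    have injn: "v = 0" if "t \<in> F" "v \<in> vecs A" "(T t ^^ n) v = 0" for t v n
     using that(3)
    proof (induct n)
     case (Suc n)
     have "(T t ^^ n) v \<in> vecs A" by (rule endo_mem[OF endo_funpow[OF T[OF that(1)]] that(2)])
     then have "(T t ^^ n) v = 0"
      by (rule inj[OF that(1)]) (use Suc(2) in \<open>simp only: funpow.simps comp_apply\<close>)
     then show ?case by (rule Suc(1))
    qed simp
    have "\<exists>E w. E \<subseteq> F \<and> card E \<le> card A + 1 \<and> (\<forall>t\<in>E. w t \<in> vecs A) \<and> (\<exists>t\<in>E. w t \<noteq> 0) \<and>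
      (\<forall>n. (orbit_sum E B w n) = 0)"
    proof (rule support_reduction[OF fin assms(5), of B w])
     show "endo A (B t)" if "t \<in> F" for t unfolding B_def by (rule endo_funpow[OF T[OF that]])
     show "w t \<in> vecs A" if "t \<in> F" for t
      unfolding w_def by (rule endo_mem[OF endo_funpow[OF T[OF that]] u[OF that]])
     show "\<exists>t\<in>F. w t \<noteq> 0" using injn[OF \<beta>(1) u[OF \<beta>(1)], of a] u0 \<beta>(1) unfolding w_def by blast
     show "orbit_sum F B w n = 0" for n unfolding w_def Bw by (rule spec[OF b(2)])
    qed
    then obtain E v where E: "E \<subseteq> F" "card E \<le> d + 1" "\<forall>t\<in>E. v t \<in> vecs A" "\<exists>t\<in>E. v t \<noteq> 0"
     "\<forall>n. (orbit_sum E B v n) = 0" unfolding A(2) by blast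
    \<comment> \<open>The reduced support may be smaller than d + 1; it is enlarged inside F and the
      relation is extended by zero vectors.\<close>
    obtain G where G: "E \<subseteq> G" "G \<subseteq> F" "card G = d + 1"
     using exists_subset_between[OF E(2) _ E(1) assms(5)] assms(7) by auto
    define y where "y t = (if t \<in> E then v t else 0)" for t
    have y: "\<forall>t\<in>G. y t \<in> vecs A" using E(3) vecs_closed(4) by (auto simp: y_def)
    \<comment> \<open>The new starting vectors need no offset, so time n for the b-th powers is time
      b n for the original maps. These times are infinite in number since b > 0, which contradicts
      mixing of G.\<close>
    have yrel: "orbit_sum G T y (b * n) = 0" for n
    proof -
     have "(orbit_sum G T y (b * n)) = (orbit_sum E B v n)"
     proof (rule sum.mono_neutral_cong_right)
      show "finite G" using G(2) assms(5) finite_subset by blast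
      show "\<forall>t\<in>G - E. (T t ^^ (b * n)) (y t) = 0"
      proof
       fix t assume "t \<in> G - E"
       then have "t \<in> F" "y t = 0" using G(2) by (auto simp: y_def)
       then show "(T t ^^ (b * n)) (y t) = 0" using endo_0[OF endo_funpow[OF T]] by metis
      qed
      show "(T t ^^ (b * n)) (y t) = (B t ^^ n) (v t)" if "t \<in> E" for t
       unfolding B_def funpow_mult using that by (simp add: y_def mult.commute)
     qed (rule G(1))
     then show ?thesis using E(5) by simp
    qed
    define h where "h t = char_comb A (y t)" for t :: "'a \<Rightarrow> 'a"
    have "\<forall>t\<in>G. h t \<in> characters" unfolding h_def using char_comb_character[OF Ac] by blast
    moreover have "\<exists>t\<in>G. \<exists>x. h t x \<noteq> 1"
    proof -
     obtain t where t: "t \<in> E" "v t \<noteq> 0" using E(4) by blast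
     then have "y t \<noteq> 0" "t \<in> G" using G(1) by (auto simp: y_def)
     then show ?thesis using char_comb_eq_1[OF A(1), of "y t"] y unfolding h_def by blast
    qed
    moreover have "mixing m G" using sub G by blast
    ultimately have "finite (relation_times G h)" unfolding mixE[OF G(2,3)] by blast
    moreover have "range (\<lambda>n. b * n) \<subseteq> (relation_times G h)"
     using rel[OF G(2) y] yrel unfolding h_def by blast
    ultimately have "finite (range (\<lambda>n. b * n))" using finite_subset by blast
    moreover have "inj (\<lambda>n. b * n)" using b(1) by (auto simp: inj_def)
    ultimately show False using finite_imageD infinite_UNIV_nat by blast
   qed
  qed
 qed
qed

end
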